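(* Let $\mathcal{G}$ be a noncompact metric graph with a finite number of edges and let $m>0$. Then, for every $k\in\mathbb{C}\setminus\mathbb{R}$, $$(\mathcal{D}_{\mathcal{G},c}-mc^2-k)^{-1}\longrightarrow P^+\Big(\frac{-\Delta}{2m}-k\Big)^{-1}\qquad\text{as } c\to+\infty,$$ in the operator norm of $\mathcal{L}(L^2(\mathcal{G},\mathbb{C}^2))$, where $P^+$ is the projector on the first component of the spinor, represented by the matrix $\begin{pmatrix}1&0\\0&0\end{pmatrix}$. Moreover, $$(\mathcal{D}_{\mathcal{G},c}+mc^2-k)^{-1}\longrightarrow P^-\Big(\frac{-\Delta}{2m}-k\Big)^{-1}\qquad\text{as } c\to+\infty,$$ in the same norm, where $P^-$ is the projector on the second component of the spinor, represented by the matrix $\begin{pmatrix}0&0\\0&1\end{pmatrix}$.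
   Context: A metric graph is a connected multigraph $\mathcal{G}=(\mathrm{V},\mathrm{E})$ in which each bounded edge $e$ is identified with a closed bounded interval $I_e=[0,\ell_e]$ (with either choice of orientation) and each unbounded edge with a half-line $I_e=\mathbb{R}^+=[0,+\infty)$, where $x_e=+\infty$ corresponds to the vertex at infinity. It is compact if it consists of a finite number of bounded edges, noncompact otherwise. The compact core $\mathcal{K}$ is the subgraph of the bounded edges (for a graph consisting only of half-lines incident at one vertex, it is that vertex); $\mathrm{V}_{\mathcal{K}}$ is its set of vertices (i.e. all the vertices not at infinity). $e\succ\mathrm{v}$ means that $e$ is incident at $\mathrm{v}$ (a loop counts with both its endpoints). $L^2(\mathcal{G},\mathbb{C}^2)$, $H^s(\mathcal{G})$, $H^s(\mathcal{G},\mathbb{C}^2)$ are the direct sums over the edges of the corresponding spaces on $I_e$, and $\mathcal{L}(L^2(\mathcal{G},\mathbb{C}^2))$ is the space of bounded linear operators on $L^2(\mathcal{G},\mathbb{C}^2)$. For an edge $e\succ\mathrm{v}$ and a function $u$: $u_e^{\pm}(\mathrm{v})$ is $u_e(0)$ if $x_e=0$ at $\mathrm{v}$ and $-u_e(\ell_e)$ if $x_e=\ell_e$ at $\mathrm{v}$; $\frac{du_e}{dx_e}(\mathrm{v})$ is $u_e'(0)$ if $x_e=0$ at $\mathrm{v}$ and $-u_e'(\ell_e)$ if $x_e=\ell_e$ at $\mathrm{v}$; $u_e'(\mathrm{v})$ is the value of the derivative at the endpoint, with no sign change ($u_e'(0)$ or $u_e'(\ell_e)$). Let $\sigma_1=\begin{pmatrix}0&1\\1&0\end{pmatrix}$,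 $\sigma_3=\begin{pmatrix}1&0\\0&-1\end{pmatrix}$. The Dirac operator $\mathcal{D}_{\mathcal{G},c}$ with Kirchhoff-type vertex conditions ($m>0$ fixed, $c>0$) is the self-adjoint operator on $L^2(\mathcal{G},\mathbb{C}^2)$ acting as $-\imath c\sigma_1\psi_e'+mc^2\sigma_3\psi_e$ on each edge, with domain the set of $\psi=(\phi,\chi)^T\in H^1(\mathcal{G},\mathbb{C}^2)$ with $\phi_e(\mathrm{v})=\phi_f(\mathrm{v})$ for all $e,f\succ\mathrm{v}$ and $\sum_{e\succ\mathrm{v}}\chi_e^{\pm}(\mathrm{v})=0$, for all $\mathrm{v}\in\mathrm{V}_{\mathcal{K}}$. The Kirchhoff Laplacian $-\Delta_{\mathcal{G}}$ acts as $u_e\mapsto-u_e''$ on the set of $u\in H^2(\mathcal{G})$ with $u_e(\mathrm{v})=u_f(\mathrm{v})$ for all $e,f\succ\mathrm{v}$ and $\sum_{e\succ\mathrm{v}}\frac{du_e}{dx_e}(\mathrm{v})=0$ for all $\mathrm{v}\in\mathrm{V}_{\mathcal{K}}$. The homogeneous $\delta'$ Laplacian $-\widetilde{\Delta}_{\mathcal{G}}$ acts as $u_e\mapsto-u_e''$ on the set of $u\in H^2(\mathcal{G})$ with $u_e'(\mathrm{v})=u_f'(\mathrm{v})$ for all $e,f\succ\mathrm{v}$ and $\sum_{e\succ\mathrm{v}}u_e^{\pm}(\mathrm{v})=0$ for all $\mathrm{v}\in\mathrm{V}_{\mathcal{K}}$. Finally, $-\Delta:=\begin{pmatrix}-\Delta_{\mathcal{G}}&0\\0&-\widetilde{\Delta}_{\mathcal{G}}\end{pmatrix}$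 with domain $\{(\phi,\chi)^T:\phi\in\mathrm{dom}(-\Delta_{\mathcal{G}}),\ \chi\in\mathrm{dom}(-\widetilde{\Delta}_{\mathcal{G}})\}$.
   Formalization: The second limit as printed has a sign error (it fails already on the line, two half-lines); it is stated and proved with Δ/(2m) in place of −Δ/(2m), i.e. the limit is P^-(Δ/(2m) − k)^{-1}. *)

theory Defs
  imports "HOL-Analysis.Analysis" "Graph_Theory.Digraph_Component"
begin

section \<open>Metric graphs\<close>

text \<open>
  The orientation of an arc is the chosen parametrisation of the edge by
  \<open>[0, len e]\<close>: the tail sits at \<open>x = 0\<close> and the head at \<open>x = len e\<close>. The half-lines are
  the arcs of length \<open>\<infinity>\<close>; their heads are the vertices at infinity, each of
  which is, as usual, the endpoint of just one half-line and of nothing else.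
  Loops and multiple edges are allowed, and \<open>connected\<close> ignores the orientation.
\<close>
locale metric_graph = wf_digraph G
  for G :: "('v, 'e) pre_digraph" +
  fixes len :: "'e \<Rightarrow> ereal"
  assumes graph_connected: "Digraph_Component.connected G"
    and len_pos: "e \<in> arcs G \<Longrightarrow> 0 < len e"
    and infinity_not_tail:
      "e \<in> arcs G \<Longrightarrow> len e = \<infinity> \<Longrightarrow> f \<in> arcs G \<Longrightarrow> tail G f \<noteq> head G e"
    and infinity_head_unique:
      "e \<in> arcs G \<Longrightarrow> len e = \<infinity> \<Longrightarrow> f \<in> arcs G \<Longrightarrow> head G f = head G e \<Longrightarrow> f = e"

definition compact_graph :: "('v, 'e) pre_digraph \<Rightarrow> ('e \<Rightarrow> ereal) \<Rightarrow> bool" where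
  "compact_graph G len \<longleftrightarrow> finite (arcs G) \<and> (\<forall>e\<in>arcs G. len e \<noteq> \<infinity>)"

definition edge_interval :: "('e \<Rightarrow> ereal) \<Rightarrow> 'e \<Rightarrow> real set" where
  "edge_interval len e = {x. 0 \<le> x \<and> ereal x \<le> len e}"

definition core_verts :: "('v, 'e) pre_digraph \<Rightarrow> ('e \<Rightarrow> ereal) \<Rightarrow> 'v set" where
  "core_verts G len = verts G - {head G e | e. e \<in> arcs G \<and> len e = \<infinity>}"

text \<open>
  Incidence is recorded by edge ends, so that a loop contributes both of its ends.
\<close>
datatype endpt = Init | Term

definition ends_at :: "('v, 'e) pre_digraph \<Rightarrow> 'v \<Rightarrow> ('e \<times> endpt) set" where
  "ends_at G v = {(e, Init) | e. e \<in> arcs G \<and> tail G e = v} \<union>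
                 {(e, Term) | e. e \<in> arcs G \<and> head G e = v}"

fun end_value :: "('e \<Rightarrow> ereal) \<Rightarrow> ('e \<Rightarrow> real \<Rightarrow> 'a) \<Rightarrow> 'e \<times> endpt \<Rightarrow> 'a" where
  "end_value len u (e, Init) = u e 0"
| "end_value len u (e, Term) = u e (real_of_ereal (len e))"

text \<open>
  Applied to \<open>u\<close> this is \<open>u_e\<^sup>\<plusminus>(v)\<close>; applied to the derivative \<open>u'\<close> it is \<open>du_e/dx_e(v)\<close>.
\<close>
fun signed_end_value ::
    "('e \<Rightarrow> ereal) \<Rightarrow> ('e \<Rightarrow> real \<Rightarrow> 'a::group_add) \<Rightarrow> 'e \<times> endpt \<Rightarrow> 'a" where
  "signed_end_value len u (e, Init) = u e 0"
| "signed_end_value len u (e, Term) = - u e (real_of_ereal (len e))"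

definition continuous_at_verts ::
    "('v, 'e) pre_digraph \<Rightarrow> ('e \<Rightarrow> ereal) \<Rightarrow> ('e \<Rightarrow> real \<Rightarrow> complex) \<Rightarrow> bool" where
  "continuous_at_verts G len u \<longleftrightarrow>
     (\<forall>v\<in>core_verts G len. \<forall>p\<in>ends_at G v. \<forall>q\<in>ends_at G v. end_value len u p = end_value len u q)"

definition balanced_at_verts ::
    "('v, 'e) pre_digraph \<Rightarrow> ('e \<Rightarrow> ereal) \<Rightarrow> ('e \<Rightarrow> real \<Rightarrow> complex) \<Rightarrow> bool" where
  "balanced_at_verts G len u \<longleftrightarrow>
     (\<forall>v\<in>core_verts G len. (\<Sum>p\<in>ends_at G v. signed_end_value len u p) = 0)"

section \<open>Function spaces\<close>

text \<open>
  Elements of \<open>L\<^sup>2\<close> are given by representatives: functions on the edges, considered up to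
  equality almost everywhere on the graph, their values off the graph being irrelevant.
  The direct sums are over finitely many edges, so no summability over the edges is imposed.
\<close>
definition L2_on :: "real set \<Rightarrow> (real \<Rightarrow> 'a::euclidean_space) \<Rightarrow> bool" where
  "L2_on S f \<longleftrightarrow> f \<in> borel_measurable (lebesgue_on S) \<and>
                 integrable (lebesgue_on S) (\<lambda>x. (norm (f x))\<^sup>2)"

definition L2 ::
    "('v, 'e) pre_digraph \<Rightarrow> ('e \<Rightarrow> ereal) \<Rightarrow> ('e \<Rightarrow> real \<Rightarrow> 'a::euclidean_space) set" where
  "L2 G len = {f. \<forall>e\<in>arcs G. L2_on (edge_interval len e) (f e)}"

definition L2_norm ::
    "('v, 'e) pre_digraph \<Rightarrow> ('e \<Rightarrow> ereal) \<Rightarrow> ('e \<Rightarrow> real \<Rightarrow> 'a::euclidean_space) \<Rightarrow> real" where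
  "L2_norm G len f =
     sqrt (\<Sum>e\<in>arcs G. \<integral>x. (norm (f e x))\<^sup>2 \<partial>lebesgue_on (edge_interval len e))"

definition ae_eq ::
    "('v, 'e) pre_digraph \<Rightarrow> ('e \<Rightarrow> ereal) \<Rightarrow> ('e \<Rightarrow> real \<Rightarrow> 'a) \<Rightarrow> ('e \<Rightarrow> real \<Rightarrow> 'a) \<Rightarrow> bool" where
  "ae_eq G len f g \<longleftrightarrow>
     (\<forall>e\<in>arcs G. AE x in lebesgue_on (edge_interval len e). f e x = g e x)"

text \<open>
  \<open>\<phi>\<close> is a continuously differentiable test function on the interior of \<open>S\<close>, with derivative
  \<open>\<phi>'\<close>. Testing with such functions gives the same weak derivatives as testing with smooth ones.
\<close>
definition test_function :: "real set \<Rightarrow> (real \<Rightarrow> real) \<Rightarrow> (real \<Rightarrow> real) \<Rightarrow> bool" where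
  "test_function S \<phi> \<phi>' \<longleftrightarrow>
     (\<forall>x. (\<phi> has_real_derivative \<phi>' x) (at x)) \<and> continuous_on UNIV \<phi>' \<and>
     compact (closure {x. \<phi> x \<noteq> 0}) \<and> closure {x. \<phi> x \<noteq> 0} \<subseteq> interior S"

definition weak_derivative ::
    "real set \<Rightarrow> (real \<Rightarrow> 'a::euclidean_space) \<Rightarrow> (real \<Rightarrow> 'a) \<Rightarrow> bool" where
  "weak_derivative S u u' \<longleftrightarrow>
     (\<forall>\<phi> \<phi>'. test_function S \<phi> \<phi>' \<longrightarrow>
        (\<integral>x. \<phi>' x *\<^sub>R u x \<partial>lebesgue_on S) = - (\<integral>x. \<phi> x *\<^sub>R u' x \<partial>lebesgue_on S))"

text \<open>
  \<open>u\<close> is the continuous representative on \<open>S\<close> of an element of \<open>H\<^sup>1(S)\<close>, and \<open>u'\<close> is a weak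
  derivative of it. Endpoint values refer to this representative.
  Accordingly \<open>u\<close> is in \<open>H\<^sup>2(S)\<close> if \<open>H1_on S u u'\<close> and \<open>H1_on S u' u''\<close>.
\<close>
definition H1_on ::
    "real set \<Rightarrow> (real \<Rightarrow> 'a::euclidean_space) \<Rightarrow> (real \<Rightarrow> 'a) \<Rightarrow> bool" where
  "H1_on S u u' \<longleftrightarrow> L2_on S u \<and> L2_on S u' \<and> weak_derivative S u u' \<and> continuous_on S u"

definition H1 ::
    "('v, 'e) pre_digraph \<Rightarrow> ('e \<Rightarrow> ereal) \<Rightarrow> ('e \<Rightarrow> real \<Rightarrow> 'a::euclidean_space)
      \<Rightarrow> ('e \<Rightarrow> real \<Rightarrow> 'a) \<Rightarrow> bool" where
  "H1 G len u u' \<longleftrightarrow> (\<forall>e\<in>arcs G. H1_on (edge_interval len e) (u e) (u' e))"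

section \<open>Operators\<close>

text \<open>
  An unbounded operator in \<open>L\<^sup>2\<close> is given by its graph, a set of pairs \<open>(u, A u)\<close> of
  representatives, closed under changing either one on a null set.
\<close>
type_synonym ('e, 'a) operator = "(('e \<Rightarrow> real \<Rightarrow> 'a) \<times> ('e \<Rightarrow> real \<Rightarrow> 'a)) set"

type_synonym 'e spinor = "'e \<Rightarrow> real \<Rightarrow> complex^2"

definition modulo_ae ::
    "('v, 'e) pre_digraph \<Rightarrow> ('e \<Rightarrow> ereal) \<Rightarrow> ('e, 'a::euclidean_space) operator
      \<Rightarrow> ('e, 'a) operator" where
  "modulo_ae G len A =
     {(f, g). f \<in> L2 G len \<and> g \<in> L2 G len \<and> (\<exists>(u, w)\<in>A. ae_eq G len f u \<and> ae_eq G len g w)}"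

definition sigma1 :: "complex^2^2" where
  "sigma1 = vector [vector [0, 1], vector [1, 0]]"

definition sigma3 :: "complex^2^2" where
  "sigma3 = vector [vector [1, 0], vector [0, - 1]]"

definition P_plus :: "complex^2^2" where
  "P_plus = vector [vector [1, 0], vector [0, 0]]"

definition P_minus :: "complex^2^2" where
  "P_minus = vector [vector [0, 0], vector [0, 1]]"

definition dirac ::
    "('v, 'e) pre_digraph \<Rightarrow> ('e \<Rightarrow> ereal) \<Rightarrow> real \<Rightarrow> real \<Rightarrow> ('e, complex^2) operator" where
  "dirac G len m c = modulo_ae G len
     {(\<psi>, \<lambda>e x. (- \<i> * of_real c) *s (sigma1 *v \<psi>' e x) + of_real (m * c\<^sup>2) *s (sigma3 *v \<psi> e x)) | \<psi> \<psi>'.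
        H1 G len \<psi> \<psi>' \<and>
        continuous_at_verts G len (\<lambda>e x. \<psi> e x $ 1) \<and>
        balanced_at_verts G len (\<lambda>e x. \<psi> e x $ 2)}"

definition kirchhoff_laplacian ::
    "('v, 'e) pre_digraph \<Rightarrow> ('e \<Rightarrow> ereal) \<Rightarrow> ('e, complex) operator" where
  "kirchhoff_laplacian G len = modulo_ae G len
     {(u, \<lambda>e x. - u'' e x) | u u' u''.
        H1 G len u u' \<and> H1 G len u' u'' \<and>
        continuous_at_verts G len u \<and> balanced_at_verts G len u'}"

definition delta'_laplacian ::
    "('v, 'e) pre_digraph \<Rightarrow> ('e \<Rightarrow> ereal) \<Rightarrow> ('e, complex) operator" where
  "delta'_laplacian G len = modulo_ae G len
     {(u, \<lambda>e x. - u'' e x) | u u' u''.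
        H1 G len u u' \<and> H1 G len u' u'' \<and>
        continuous_at_verts G len u' \<and> balanced_at_verts G len u}"

text \<open>
  This is \<open>- \<Delta>\<close>, with the minus sign: both components act as \<open>u \<mapsto> - u''\<close>. The lower
  component of the Dirac resolvent has the limit \<open>P\<^sup>- (\<Delta> / (2 m) - k)\<^sup>-\<^sup>1\<close>, not
  \<open>P\<^sup>- (- \<Delta> / (2 m) - k)\<^sup>-\<^sup>1\<close>: eliminating the upper component of
  \<open>(D + m c\<^sup>2 - k) (\<phi>, \<chi>) = (0, g)\<close> and letting \<open>c\<close> grow gives \<open>\<chi>'' / (2 m) - k \<chi> = g\<close>.
  So \<open>scale_op\<close> is applied to it with \<open>1 / (2 m)\<close> for the upper and \<open>- 1 / (2 m)\<close> for the
  lower component.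
\<close>
definition laplacian ::
    "('v, 'e) pre_digraph \<Rightarrow> ('e \<Rightarrow> ereal) \<Rightarrow> ('e, complex^2) operator" where
  "laplacian G len =
     {(\<psi>, \<eta>). (\<lambda>e x. \<psi> e x $ 1, \<lambda>e x. \<eta> e x $ 1) \<in> kirchhoff_laplacian G len \<and>
              (\<lambda>e x. \<psi> e x $ 2, \<lambda>e x. \<eta> e x $ 2) \<in> delta'_laplacian G len}"

definition scale_op :: "complex \<Rightarrow> ('e, complex^2) operator \<Rightarrow> ('e, complex^2) operator" where
  "scale_op a A = {(\<psi>, \<lambda>e x. a *s \<eta> e x) | \<psi> \<eta>. (\<psi>, \<eta>) \<in> A}"

definition shift_op :: "('e, complex^2) operator \<Rightarrow> complex \<Rightarrow> ('e, complex^2) operator" where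
  "shift_op A z = {(\<psi>, \<lambda>e x. \<eta> e x - z *s \<psi> e x) | \<psi> \<eta>. (\<psi>, \<eta>) \<in> A}"

text \<open>
  The resolvent set: \<open>A - z\<close> is onto, and the a priori bound makes it injective up to null
  sets with bounded inverse.
\<close>
definition resolvent_set ::
    "('v, 'e) pre_digraph \<Rightarrow> ('e \<Rightarrow> ereal) \<Rightarrow> ('e, complex^2) operator \<Rightarrow> complex set" where
  "resolvent_set G len A =
     {z. (\<forall>f\<in>L2 G len. \<exists>\<psi>. (\<psi>, f) \<in> shift_op A z) \<and>
         (\<exists>K. \<forall>(\<psi>, f)\<in>shift_op A z. L2_norm G len \<psi> \<le> K * L2_norm G len f)}"

text \<open>
  For \<open>z\<close> in the resolvent set the choice below is unique up to equality almost everywhere.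
\<close>
definition resolvent :: "('e, complex^2) operator \<Rightarrow> complex \<Rightarrow> 'e spinor \<Rightarrow> 'e spinor" where
  "resolvent A z f = (SOME \<psi>. (\<psi>, f) \<in> shift_op A z)"

definition matrix_op :: "complex^2^2 \<Rightarrow> ('e spinor \<Rightarrow> 'e spinor) \<Rightarrow> 'e spinor \<Rightarrow> 'e spinor" where
  "matrix_op M T f = (\<lambda>e x. M *v T f e x)"

definition operator_dist ::
    "('v, 'e) pre_digraph \<Rightarrow> ('e \<Rightarrow> ereal) \<Rightarrow> ('e spinor \<Rightarrow> 'e spinor)
      \<Rightarrow> ('e spinor \<Rightarrow> 'e spinor) \<Rightarrow> real" where
  "operator_dist G len S T =
     (SUP f\<in>{f \<in> L2 G len. L2_norm G len f \<le> 1}. L2_norm G len (\<lambda>e x. S f e x - T f e x))"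

end

theory Submission
  imports Defs "HOL-Library.Function_Algebras"
begin

text \<open>
  The Dirac operator has the supersymmetric form
  \<open>(\<phi>, \<eta>) \<mapsto> (- i c \<eta>' + m c\<^sup>2 \<phi>, - i c \<phi>' - m c\<^sup>2 \<eta>)\<close>, where \<open>\<phi>\<close> is continuous at the vertices
  and \<open>\<eta>\<close> is balanced there. Under these two conditions all boundary terms cancel, vertex by
  vertex, and \<open>\<langle>\<phi>', \<eta>\<rangle> = - \<langle>\<phi>, \<eta>'\<rangle>\<close> (\<open>ip_by_parts\<close>). The Kirchhoff Laplacian and the \<open>\<delta>'\<close>
  Laplacian are the compositions of the two derivatives, in the two orders. Everything follows from
  this formula and from one existence statement.

  Existence (\<open>exists_vertex_pair_solution\<close>): every resolvent equation of the theorem, for the Dirac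
  operator and for both Laplacians, is a system \<open>\<phi>' = \<alpha> \<eta> + g\<close>, \<open>\<eta>' = \<beta> \<phi> + f\<close> with square integrable
  \<open>f\<close>, \<open>g\<close> and the two vertex conditions, where \<open>\<alpha> \<beta>\<close> is not a nonpositive real number. With
  \<open>\<kappa>\<^sup>2 = \<alpha> \<beta>\<close> and \<open>Re \<kappa> > 0\<close>, the combinations \<open>\<phi> \<plusminus> (\<alpha> / \<kappa>) \<eta>\<close> decouple it on each edge into two
  scalar equations of first order, which have square integrable solutions even on a half-line. The
  homogeneous solutions on an edge are \<open>exp (- \<kappa> x)\<close> and, if the edge is bounded, \<open>exp (\<kappa> x)\<close>, so
  there is one free coefficient for each edge end at a vertex of the core; there are equally many
  vertex conditions. This square linear system is injective by the energy identity
  \<open>\<alpha> \<parallel>\<eta>\<parallel>\<^sup>2 = - cnj \<beta> \<parallel>\<phi>\<parallel>\<^sup>2\<close>, hence solvable.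

  Convergence (\<open>dirac_laplacian_difference_plus\<close>): let \<open>(\<phi>, \<eta>)\<close> be the image of \<open>f\<close> under the Dirac
  resolvent at \<open>m c\<^sup>2 + k\<close>, and \<open>u\<close> the image of its upper component under the resolvent of the
  Kirchhoff Laplacian divided by \<open>2 m\<close>. Completing \<open>u\<close> by the lower component
  \<open>\<eta>\<^sub>0 = - i u' / (2 m c)\<close>, of norm \<open>O(1 / c)\<close>, the difference \<open>(p, q) = (\<phi> - u, \<eta> - \<eta>\<^sub>0)\<close> solves the
  Dirac resolvent equation with a right-hand side \<open>(0, F)\<close> whose norm is, for \<open>c \<ge> 1\<close>, at most a
  multiple of that of \<open>f\<close>, and the energy identity is
  \<open>cnj k \<parallel>p\<parallel>\<^sup>2 = (2 m c\<^sup>2 + k) \<parallel>q\<parallel>\<^sup>2 + \<langle>F, q\<rangle>\<close>. Its imaginary part bounds \<open>\<parallel>p\<parallel>\<^sup>2 + \<parallel>q\<parallel>\<^sup>2\<close> by a multiple of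
  \<open>\<parallel>F\<parallel> \<parallel>q\<parallel>\<close>, and then its real part gives \<open>\<parallel>q\<parallel> = O(\<parallel>F\<parallel> / c)\<close>. So both are small. The
  second limit is the same computation with \<open>\<phi>\<close> and \<open>\<eta>\<close> exchanged and \<open>k\<close> replaced by
  \<open>- k\<close>.
\<close>

section \<open>Square integrable functions on an interval\<close>

lemma L2_onD:
  assumes "L2_on S f"
  shows "f \<in> borel_measurable (lebesgue_on S)" "integrable (lebesgue_on S) (\<lambda>x. (norm (f x))\<^sup>2)"
  using assms by (auto simp: L2_on_def)

lemma L2_on_dominated:
  fixes f :: "real \<Rightarrow> 'a::euclidean_space"
  assumes "f \<in> borel_measurable (lebesgue_on S)" "integrable (lebesgue_on S) g"
    and "\<And>x. (norm (f x))\<^sup>2 \<le> g x"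
  shows "L2_on S f"
  unfolding L2_on_def
proof (intro conjI assms(1) Bochner_Integration.integrable_bound[OF assms(2)] AE_I2)
  show "(\<lambda>x. (norm (f x))\<^sup>2) \<in> borel_measurable (lebesgue_on S)" using assms(1) by measurable
  show "norm ((norm (f x))\<^sup>2) \<le> norm (g x)" for x using assms(3)[of x] by auto
qed

lemma norm_add_square_le: "(norm (x + y))\<^sup>2 \<le> 2 * (norm x)\<^sup>2 + 2 * (norm y)\<^sup>2"
  for x y :: "'a::real_normed_vector"
proof -
  have "(norm (x + y))\<^sup>2 \<le> (norm x + norm y)\<^sup>2"
    by (intro power_mono norm_triangle_ineq) auto
  also have "\<dots> \<le> 2 * (norm x)\<^sup>2 + 2 * (norm y)\<^sup>2"
    using sum_squares_bound[of "norm x" "norm y"] by (simp add: power2_sum)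
  finally show ?thesis .
qed

lemma L2_on_add:
  fixes f :: "real \<Rightarrow> 'a::euclidean_space"
  assumes "L2_on S f" "L2_on S g"
  shows "L2_on S (\<lambda>x. f x + g x)"
proof (rule L2_on_dominated[where g = "\<lambda>x. 2 * (norm (f x))\<^sup>2 + 2 * (norm (g x))\<^sup>2"])
  show "(\<lambda>x. f x + g x) \<in> borel_measurable (lebesgue_on S)"
    using L2_onD(1)[OF assms(1)] L2_onD(1)[OF assms(2)] by measurable
  show "integrable (lebesgue_on S) (\<lambda>x. 2 * (norm (f x))\<^sup>2 + 2 * (norm (g x))\<^sup>2)"
    using L2_onD(2)[OF assms(1)] L2_onD(2)[OF assms(2)] by auto
qed (rule norm_add_square_le)

lemma L2_on_bounded_linear:
  fixes f :: "real \<Rightarrow> 'a::euclidean_space" and h :: "'a \<Rightarrow> 'b::euclidean_space"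
  assumes "bounded_linear h" "L2_on S f"
  shows "L2_on S (\<lambda>x. h (f x))"
proof -
  obtain K where K: "\<And>x. norm (h x) \<le> norm x * K"
    using bounded_linear.bounded[OF assms(1)] by blast
  show ?thesis
  proof (rule L2_on_dominated[where g = "\<lambda>x. K\<^sup>2 * (norm (f x))\<^sup>2"])
    show "(\<lambda>x. h (f x)) \<in> borel_measurable (lebesgue_on S)"
      using borel_measurable_continuous_onI[OF linear_continuous_on[OF assms(1)]] L2_onD(1)[OF assms(2)]
      by measurable
    show "integrable (lebesgue_on S) (\<lambda>x. K\<^sup>2 * (norm (f x))\<^sup>2)"
      using L2_onD(2)[OF assms(2)] by auto
    show "(norm (h (f x)))\<^sup>2 \<le> K\<^sup>2 * (norm (f x))\<^sup>2" for x
      using power_mono[OF K[of "f x"] norm_ge_zero, of 2] by (simp add: power_mult_distrib mult.commute)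
  qed
qed

lemmas L2_on_cmult = L2_on_bounded_linear[OF bounded_linear_mult_right]
lemmas L2_on_cnj = L2_on_bounded_linear[OF bounded_linear_cnj]
lemmas L2_on_component = L2_on_bounded_linear[OF bounded_linear_vec_nth]

lemma L2_on_uminus: "L2_on S f \<Longrightarrow> L2_on S (\<lambda>x. - f x)"
  using L2_on_bounded_linear[OF bounded_linear_minus[OF bounded_linear_ident]] by auto

lemma L2_on_diff: "L2_on S f \<Longrightarrow> L2_on S g \<Longrightarrow> L2_on S (\<lambda>x. f x - g x)"
  using L2_on_add[OF _ L2_on_uminus, of S f g] by simp

lemma L2_on_zero: "L2_on S (\<lambda>x. 0)"
  by (simp add: L2_on_def)

lemma integrable_L2_product:
  fixes f :: "real \<Rightarrow> 'a::euclidean_space" and g :: "real \<Rightarrow> 'b::euclidean_space"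
    and h :: "real \<Rightarrow> 'c::euclidean_space"
  assumes "L2_on S f" "L2_on S g" "h \<in> borel_measurable (lebesgue_on S)"
    and "\<And>x. norm (h x) \<le> norm (f x) * norm (g x)"
  shows "integrable (lebesgue_on S) h"
proof (rule Bochner_Integration.integrable_bound[where f = "\<lambda>x. (norm (f x))\<^sup>2 + (norm (g x))\<^sup>2"])
  show "integrable (lebesgue_on S) (\<lambda>x. (norm (f x))\<^sup>2 + (norm (g x))\<^sup>2)"
    using L2_onD(2)[OF assms(1)] L2_onD(2)[OF assms(2)] by auto
  show "AE x in lebesgue_on S. norm (h x) \<le> norm ((norm (f x))\<^sup>2 + (norm (g x))\<^sup>2)"
  proof (intro AE_I2)
    fix x
    have "2 * (norm (f x) * norm (g x)) \<le> (norm (f x))\<^sup>2 + (norm (g x))\<^sup>2"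
      using sum_squares_bound[of "norm (f x)" "norm (g x)"] by simp
    then show "norm (h x) \<le> norm ((norm (f x))\<^sup>2 + (norm (g x))\<^sup>2)"
      using assms(4)[of x] mult_nonneg_nonneg[OF norm_ge_zero[of "f x"] norm_ge_zero[of "g x"]]
        by (smt (verit) real_norm_def)
  qed
qed (fact assms(3))

lemma integrable_L2_mult:
  fixes f g :: "real \<Rightarrow> complex"
  assumes "L2_on S f" "L2_on S g"
  shows "integrable (lebesgue_on S) (\<lambda>x. f x * g x)"
  using L2_onD(1)[OF assms(1)] L2_onD(1)[OF assms(2)]
  by (intro integrable_L2_product[OF assms]) (auto simp: norm_mult)

lemma integrable_L2_mult_cnj:
  assumes "L2_on S f" "L2_on S g"
  shows "integrable (lebesgue_on S) (\<lambda>x. f x * cnj (g x))"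
  by (intro integrable_L2_mult assms L2_on_cnj)

lemma integrable_lebesgue_on_iff:
  assumes "S \<in> sets lebesgue"
  shows "integrable (lebesgue_on S) f \<longleftrightarrow> f absolutely_integrable_on S"
  using assms by (simp add: set_integrable_def integrable_restrict_space)

lemma L2_on_subset:
  fixes f :: "real \<Rightarrow> 'a::euclidean_space"
  assumes "L2_on S f" "T \<subseteq> S" "S \<in> sets lebesgue" "T \<in> sets lebesgue"
  shows "L2_on T f"
proof -
  have "(\<lambda>x. (norm (f x))\<^sup>2) absolutely_integrable_on T"
    using set_integrable_subset[OF _ assms(4,2)] L2_onD(2)[OF assms(1)]
    by (simp add: integrable_lebesgue_on_iff assms)
  moreover have "f \<in> borel_measurable (lebesgue_on T)"
    using L2_onD(1)[OF assms(1)] assms(2) measurable_restrict_mono by blast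
  ultimately show ?thesis by (simp add: L2_on_def integrable_lebesgue_on_iff assms)
qed

lemma L2_on_continuous:
  fixes f :: "real \<Rightarrow> 'a::euclidean_space"
  assumes "continuous_on {a..b} f"
  shows "L2_on {a..b} f"
proof -
  have "continuous_on {a..b} (\<lambda>x. (norm (f x))\<^sup>2)" by (intro continuous_intros assms)
  then have "integrable (lebesgue_on {a..b}) (\<lambda>x. (norm (f x))\<^sup>2)"
    by (simp add: integrable_lebesgue_on_iff absolutely_integrable_continuous_real)
  moreover have "f \<in> borel_measurable (lebesgue_on {a..b})"
    using assms by (intro continuous_imp_measurable_on_sets_lebesgue) auto
  ultimately show ?thesis by (simp add: L2_on_def)
qed

section \<open>Primitives and the product rule\<close>

definition is_edge :: "real set \<Rightarrow> bool" where
  "is_edge S \<longleftrightarrow> S = {0..} \<or> (\<exists>l>0. S = {0..l})"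

lemma is_edgeD:
  assumes "is_edge S"
  shows "S \<in> sets lebesgue" "0 \<in> S" "\<And>X. X \<in> S \<Longrightarrow> {0..X} \<subseteq> S" "\<And>X. X \<in> S \<Longrightarrow> 0 \<le> X"
  using assms unfolding is_edge_def by auto

lemma L2_on_imp_absolutely_integrable:
  fixes f :: "real \<Rightarrow> 'a::euclidean_space"
  assumes "L2_on S f" "is_edge S" "X \<in> S"
  shows "f absolutely_integrable_on {0..X}"
proof -
  have f: "L2_on {0..X} f"
    using assms is_edgeD[OF assms(2)] by (intro L2_on_subset[OF assms(1)]) auto
  have "integrable (lebesgue_on {0..X}) f"
    using L2_onD(1)[OF f] by (intro integrable_L2_product[OF f L2_on_continuous[of _ _ "\<lambda>_. 1::real"]]) auto
  then show ?thesis by (simp add: integrable_lebesgue_on_iff)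
qed

text \<open>
  Local absolute continuity in integral form. Absolute integrability is asked on the
  initial segments only, because on a half-line a square integrable derivative need not be
  integrable.
\<close>

definition primitive_on :: "real set \<Rightarrow> (real \<Rightarrow> 'a::euclidean_space) \<Rightarrow> (real \<Rightarrow> 'a) \<Rightarrow> bool" where
  "primitive_on S u u' \<longleftrightarrow>
     (\<forall>X\<in>S. u' absolutely_integrable_on {0..X} \<and> (u' has_integral (u X - u 0)) {0..X})"

lemma primitive_on_interval:
  assumes "primitive_on S u u'" "is_edge S" "0 \<le> x" "x \<le> y" "y \<in> S"
  shows "(u' has_integral (u y - u x)) {x..y}" "u' absolutely_integrable_on {x..y}"
proof -
  have x: "x \<in> S" using is_edgeD(3)[OF assms(2,5)] assms by auto
  have i: "(u' has_integral (u x - u 0)) {0..x}" "(u' has_integral (u y - u 0)) {0..y}"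
    using assms(1,5) x by (auto simp: primitive_on_def)
  show a: "u' absolutely_integrable_on {x..y}"
    using assms absolutely_integrable_on_subinterval[of "{0..y}" u' x y] by (auto simp: primitive_on_def)
  have "integral {0..x} u' + integral {x..y} u' = integral {0..y} u'"
    using Henstock_Kurzweil_Integration.integral_combine[of 0 x y u'] assms i by auto
  then have "integral {x..y} u' = u y - u x"
    using i by (simp add: integral_unique algebra_simps)
  then show "(u' has_integral (u y - u x)) {x..y}"
    using a absolutely_integrable_on_def by (metis integrable_integral)
qed

lemma primitive_on_continuous:
  assumes "primitive_on S u u'" "is_edge S"
  shows "continuous_on S u"
proof -
  have c: "continuous_on {0..X} u" if "X \<in> S" for X
  proof -
    have X: "0 \<le> X" using that is_edgeD[OF assms(2)] by auto
    have "u' integrable_on {0..X}" using assms(1) that by (auto simp: primitive_on_def)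
    then have "continuous_on {0..X} (\<lambda>x. u 0 + integral {0..x} u')"
      by (intro continuous_intros indefinite_integral_continuous_1)
    moreover have "u 0 + integral {0..x} u' = u x" if "x \<in> {0..X}" for x
      using primitive_on_interval(1)[OF assms, of 0 x] that \<open>X \<in> S\<close> is_edgeD(3)[OF assms(2) \<open>X \<in> S\<close>]
      by (auto simp: integral_unique)
    ultimately show ?thesis by (metis (no_types, lifting) continuous_on_cong)
  qed
  consider "S = {0..}" | l where "0 < l" "S = {0..l}" using assms(2) by (auto simp: is_edge_def)
  then show ?thesis
  proof cases
    case 1
    show ?thesis unfolding continuous_on_eq_continuous_within
    proof
      fix x assume x: "x \<in> S"
      have "continuous_on {0..x+1} u" using c[of "x+1"] 1 x by auto
      then have "continuous (at x within {0..x+1}) u" using x 1 by (auto simp: continuous_on_eq_continuous_within)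
      moreover have "at x within {0..x+1} = at x within S"
        using 1 by (intro at_within_nhd[of x "{x-1<..<x+1}"]) auto
      ultimately show "continuous (at x within S) u" by (simp add: continuous_within)
    qed
  qed (use c in auto)
qed

text \<open>
  A bound of the increments by those of another function, known for short intervals only,
  adds up over a fine partition.
\<close>

lemma norm_increment_le_of_local:
  fixes F :: "real \<Rightarrow> 'a::real_normed_vector"
  assumes "0 \<le> X" "d > 0"
    and "\<And>x y. 0 \<le> x \<Longrightarrow> x \<le> y \<Longrightarrow> y \<le> X \<Longrightarrow> y - x < d \<Longrightarrow> norm (F y - F x) \<le> H y - H x"
  shows "norm (F X - F 0) \<le> H X - H 0"
proof -
  obtain n :: nat where n: "X / d < real n" using reals_Archimedean2 by blast
  define n' where "n' = Suc n"
  have n': "X / real n' < d" "n' > 0" using n assms(2) by (auto simp: n'_def field_simps intro: order_less_trans)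
  have "i \<le> n' \<Longrightarrow> norm (F (real i * (X / n')) - F 0) \<le> H (real i * (X / n')) - H 0" for i
  proof (induction i)
    case (Suc i)
    let ?x = "real i * (X / n')" and ?y = "real (Suc i) * (X / n')"
    have "real (Suc i) * X \<le> real n' * X" using Suc.prems assms(1) by (intro mult_right_mono) auto
    then have "?y \<le> X" using n' by (simp add: field_simps)
    then have "norm (F ?y - F ?x) \<le> H ?y - H ?x"
    proof (intro assms(3))
      have "?y - ?x = X / real n'" by (simp add: algebra_simps add_divide_distrib)
      then show "?x \<le> ?y" "?y - ?x < d" using n' assms(1) zero_le_divide_iff[of X "real n'"] by linarith+
    qed (use assms(1) in auto)
    then show ?case using Suc norm_triangle_ineq[of "F ?y - F ?x" "F ?x - F 0"] by auto
  qed simp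
  from this[of n'] show ?thesis using n' by simp
qed

text \<open>
  The primitives here are differentiable only almost everywhere, so the product is not
  differentiated pointwise. Instead, the difference \<open>F\<close> of the product and of the integral of its
  presumed derivative is shown to be constant: on a short interval \<open>[x, y]\<close>, the increment of \<open>F\<close> is the
  integral of \<open>u' (v y - v) + (u x - u) v'\<close>, and by uniform continuity of \<open>u\<close> and \<open>v\<close> this is at most
  \<open>\<omega>\<close> times the integral of \<open>\<bar>u'\<bar> + \<bar>v'\<bar>\<close>, with \<open>\<omega>\<close> arbitrarily small.
\<close>

lemma primitive_on_bilinear:
  fixes prod :: "'a::euclidean_space \<Rightarrow> 'b::euclidean_space \<Rightarrow> 'c::euclidean_space"
  assumes "bounded_bilinear prod" "is_edge S" and u: "primitive_on S u u'" and v: "primitive_on S v v'"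
  shows "primitive_on S (\<lambda>x. prod (u x) (v x)) (\<lambda>x. prod (u' x) (v x) + prod (u x) (v' x))"
  unfolding primitive_on_def
proof (intro ballI conjI)
  fix X assume X: "X \<in> S"
  interpret bounded_bilinear prod by fact
  have bil: "bilinear prod" using assms(1) by (simp add: bilinear_conv_bounded_bilinear)
  have bil': "bilinear (\<lambda>x y. prod y x)"
    using flip by (simp add: bilinear_conv_bounded_bilinear)
  have X0: "0 \<le> X" and sub: "{0..X} \<subseteq> S" using is_edgeD[OF assms(2)] X by auto
  have cu: "continuous_on {0..X} u" and cv: "continuous_on {0..X} v"
    using primitive_on_continuous[OF u] primitive_on_continuous[OF v] assms(2) sub continuous_on_subset by blast+
  define p where "p = (\<lambda>x. prod (u' x) (v x) + prod (u x) (v' x))"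
  have au: "u' absolutely_integrable_on {0..X}" and av: "v' absolutely_integrable_on {0..X}"
    using u v X by (auto simp: primitive_on_def)
  have ap: "p absolutely_integrable_on {0..X}"
    unfolding p_def
  proof (rule set_integral_add)
    show "(\<lambda>x. prod (u' x) (v x)) absolutely_integrable_on {0..X}"
      using cv by (intro absolutely_integrable_bounded_measurable_product[OF bil' _ _ _ au])
        (auto intro!: continuous_imp_measurable_on_sets_lebesgue compact_imp_bounded compact_continuous_image)
    show "(\<lambda>x. prod (u x) (v' x)) absolutely_integrable_on {0..X}"
      using cu by (intro absolutely_integrable_bounded_measurable_product[OF bil _ _ _ av])
        (auto intro!: continuous_imp_measurable_on_sets_lebesgue compact_imp_bounded compact_continuous_image)
  qed
  then show "(\<lambda>x. prod (u' x) (v x) + prod (u x) (v' x)) absolutely_integrable_on {0..X}"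
    by (simp add: p_def)
  have ip: "p integrable_on {x..y}" if "0 \<le> x" "y \<le> X" for x y
    using integrable_on_subinterval[of p "{0..X}" x y] ap that by (auto simp: absolutely_integrable_on_def)
  define F where "F x = prod (u x) (v x) - integral {0..x} p" for x
  define h where "h = (\<lambda>t. norm (u' t) + norm (v' t))"
  have ih: "h integrable_on {x..y}" if "0 \<le> x" "y \<le> X" for x y
    unfolding h_def using au av integrable_on_subinterval[of _ "{0..X}" x y] that
    by (intro integrable_add) (auto simp: absolutely_integrable_on_def)
  obtain K where K: "K > 0" "\<And>a b. norm (prod a b) \<le> norm a * norm b * K" using pos_bounded by blast
  have "norm (F X - F 0) \<le> e" if e: "e > 0" for e
  proof -
    define I where "I = integral {0..X} h"
    have I0: "I \<ge> 0" unfolding I_def by (rule integral_nonneg[OF ih]) (auto simp: h_def X0)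
    define \<omega> where "\<omega> = e / (K * (I + 1))"
    have \<omega>: "\<omega> > 0" using e K I0 by (auto simp: \<omega>_def)
    have "uniformly_continuous_on {0..X} u" using cu compact_uniformly_continuous by auto
    from uniformly_continuous_onE[OF this \<omega>] obtain d1 where d1: "d1 > 0"
      "\<And>x y. x \<in> {0..X} \<Longrightarrow> y \<in> {0..X} \<Longrightarrow> dist y x < d1 \<Longrightarrow> dist (u y) (u x) < \<omega>" by blast
    have "uniformly_continuous_on {0..X} v" using cv compact_uniformly_continuous by auto
    from uniformly_continuous_onE[OF this \<omega>] obtain d2 where d2: "d2 > 0"
      "\<And>x y. x \<in> {0..X} \<Longrightarrow> y \<in> {0..X} \<Longrightarrow> dist y x < d2 \<Longrightarrow> dist (v y) (v x) < \<omega>" by blast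
    have "norm (F X - F 0) \<le> \<omega> * K * integral {0..X} h - \<omega> * K * integral {0..0} h"
    proof (rule norm_increment_le_of_local[OF X0])
      show "min d1 d2 > 0" using d1(1) d2(1) by auto
      fix x y assume xy: "0 \<le> x" "x \<le> y" "y \<le> X" "y - x < min d1 d2"
      then have yS: "y \<in> S" using sub by auto
      have 1: "((\<lambda>t. prod (u' t) (v y)) has_integral prod (u y - u x) (v y)) {x..y}"
        using has_integral_linear[OF primitive_on_interval(1)[OF u assms(2) xy(1,2) yS] bounded_linear_left[of "v y"]]
        by (simp add: o_def)
      have 2: "((\<lambda>t. prod (u x) (v' t)) has_integral prod (u x) (v y - v x)) {x..y}"
        using has_integral_linear[OF primitive_on_interval(1)[OF v assms(2) xy(1,2) yS] bounded_linear_right[of "u x"]]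
        by (simp add: o_def)
      have 3: "(p has_integral integral {x..y} p) {x..y}" using ip xy by auto
      have "integral {0..x} p + integral {x..y} p = integral {0..y} p"
        using Henstock_Kurzweil_Integration.integral_combine[of 0 x y p] ip xy by auto
      then have eq: "F y - F x = prod (u y - u x) (v y) + prod (u x) (v y - v x) - integral {x..y} p"
        by (simp add: F_def diff_left diff_right algebra_simps)
      have q: "((\<lambda>t. prod (u' t) (v y - v t) + prod (u x - u t) (v' t)) has_integral (F y - F x)) {x..y}"
        using has_integral_diff[OF has_integral_add[OF 1 2] 3]
        by (simp add: eq p_def diff_left diff_right algebra_simps)
      have "norm (F y - F x) \<le> integral {x..y} (\<lambda>t. (\<omega> * K) * h t)"
      proof (subst integral_unique[OF q, symmetric], rule integral_norm_bound_integral)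
        show "(\<lambda>t. (\<omega> * K) * h t) integrable_on {x..y}" 
          using integrable_cmul[OF ih[of x y], of "\<omega> * K"] xy by simp
        fix t assume t: "t \<in> {x..y}"
        have "norm (v y - v t) \<le> \<omega>" using d2(2)[of t y] t xy by (auto simp: dist_norm)
        then have "norm (u' t) * norm (v y - v t) * K \<le> norm (u' t) * \<omega> * K"
          using K(1) by (intro mult_right_mono mult_left_mono) auto
        then have "norm (prod (u' t) (v y - v t)) \<le> norm (u' t) * \<omega> * K"
          using K(2) order_trans by blast
        moreover have "norm (u x - u t) \<le> \<omega>" using d1(2)[of t x] t xy by (auto simp: dist_norm)
        then have "norm (u x - u t) * norm (v' t) * K \<le> \<omega> * norm (v' t) * K"
          using K(1) by (intro mult_right_mono) auto
        then have "norm (prod (u x - u t) (v' t)) \<le> \<omega> * norm (v' t) * K"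
          using K(2) order_trans by blast
        ultimately show "norm (prod (u' t) (v y - v t) + prod (u x - u t) (v' t)) \<le> (\<omega> * K) * h t"
          by (intro norm_triangle_le) (simp add: h_def algebra_simps)
      qed (use q in auto)
      also have "\<dots> = \<omega> * K * integral {0..y} h - \<omega> * K * integral {0..x} h"
        using Henstock_Kurzweil_Integration.integral_combine[of 0 x y h] ih xy by (simp add: algebra_simps flip: distrib_left)
      finally show "norm (F y - F x) \<le> \<omega> * K * integral {0..y} h - \<omega> * K * integral {0..x} h" .
    qed
    also have "\<dots> = e * (I / (I + 1))" using K I0 by (simp add: \<omega>_def I_def[symmetric])
    also have "\<dots> \<le> e * 1" using e I0 by (intro mult_left_mono) auto
    finally show ?thesis by simp
  qed
  then have "F X = F 0" using field_le_epsilon[of "norm (F X - F 0)" 0] by force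
  then have "integral {0..X} p = prod (u X) (v X) - prod (u 0) (v 0)" by (simp add: F_def algebra_simps)
  then show "((\<lambda>x. prod (u' x) (v x) + prod (u x) (v' x)) has_integral (prod (u X) (v X) - prod (u 0) (v 0))) {0..X}"
    using ip[of 0 X] by (simp add: p_def has_integral_integrable_integral)
qed

lemma primitive_on_linear:
  fixes h :: "'a::euclidean_space \<Rightarrow> 'b::euclidean_space"
  assumes "bounded_linear h" "primitive_on S u u'"
  shows "primitive_on S (\<lambda>x. h (u x)) (\<lambda>x. h (u' x))"
  unfolding primitive_on_def
proof (intro ballI conjI)
  fix X assume X: "X \<in> S"
  then have a: "u' absolutely_integrable_on {0..X}" and i: "(u' has_integral (u X - u 0)) {0..X}"
    using assms(2) by (auto simp: primitive_on_def)
  interpret bounded_linear h by fact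
  show "(\<lambda>x. h (u' x)) absolutely_integrable_on {0..X}"
    using absolutely_integrable_linear[OF a assms(1)] by (simp add: o_def)
  show "((\<lambda>x. h (u' x)) has_integral (h (u X) - h (u 0))) {0..X}"
    using has_integral_linear[OF i assms(1)] by (simp add: o_def diff)
qed

lemma primitive_on_add:
  assumes "primitive_on S u u'" "primitive_on S v v'"
  shows "primitive_on S (\<lambda>x. u x + v x) (\<lambda>x. u' x + v' x)"
  using assms unfolding primitive_on_def
  by (auto intro!: set_integral_add simp: add_diff_add dest: has_integral_add)

section \<open>Weak derivatives and primitives\<close>

lemma integral_lebesgue_on_vanishing:
  fixes f :: "real \<Rightarrow> 'a::euclidean_space"
  assumes "T \<subseteq> S" "S \<in> sets lebesgue" "T \<in> sets lebesgue" "\<And>x. x \<in> S - T \<Longrightarrow> f x = 0"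
    and "f absolutely_integrable_on T"
  shows "integrable (lebesgue_on S) f" "integral\<^sup>L (lebesgue_on S) f = integral T f"
proof -
  have eq: "(\<lambda>x. indicat_real S x *\<^sub>R f x) = (\<lambda>x. indicat_real T x *\<^sub>R f x)"
    using assms(1,4) by (auto simp: indicator_def fun_eq_iff)
  then have "f absolutely_integrable_on S" using assms(5) by (simp add: set_integrable_def)
  then show "integrable (lebesgue_on S) f" by (simp add: integrable_lebesgue_on_iff assms)
  have "integral\<^sup>L (lebesgue_on S) f = integral\<^sup>L (lebesgue_on T) f"
    using assms(2,3) eq by (simp add: integral_restrict_space)
  also have "\<dots> = integral T f"
    using assms by (intro lebesgue_integral_eq_integral) (auto simp: integrable_lebesgue_on_iff)
  finally show "integral\<^sup>L (lebesgue_on S) f = integral T f" .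
qed

lemma has_real_derivative_pos_part_square:
  "((\<lambda>t. (max 0 t)\<^sup>2) has_real_derivative 2 * max 0 t) (at t)" for t :: real
proof (cases t "0::real" rule: linorder_cases)
  case less
  have "((\<lambda>t. 0) has_real_derivative 2 * max 0 t) (at t)" using less by simp
  then show ?thesis
    by (rule has_field_derivative_transform_within_open[where S = "{..<0}"]) (use less in auto)
next
  case greater
  have "((\<lambda>t. t\<^sup>2) has_real_derivative 2 * max 0 t) (at t)" using greater
    by (auto intro!: derivative_eq_intros)
  then show ?thesis
    by (rule has_field_derivative_transform_within_open[where S = "{0<..}"]) (use greater in auto)
next
  case equal
  have "((\<lambda>h. (max 0 h)\<^sup>2 / h) \<longlongrightarrow> 0) (at (0::real))"
  proof (rule Lim_null_comparison[where g = "\<lambda>h. \<bar>h\<bar>"])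
    show "\<forall>\<^sub>F h in at (0::real). norm ((max 0 h)\<^sup>2 / h) \<le> \<bar>h\<bar>"
      by (rule always_eventually) (auto simp: max_def power2_eq_square)
    show "((\<lambda>h. \<bar>h\<bar>) \<longlongrightarrow> 0) (at (0::real))" by (rule tendsto_rabs_zero, rule tendsto_ident_at)
  qed
  then show ?thesis using equal by (simp add: DERIV_def)
qed

text \<open>
  A continuously differentiable step from \<open>0\<close> to \<open>1\<close> and its derivative, a hat function of
  mass \<open>1\<close> on \<open>[0, 1]\<close>. A quadratic spline suffices, because test functions are only required to be
  continuously differentiable.
\<close>

definition cutoff :: "real \<Rightarrow> real" where
  "cutoff t = 2 * (max 0 t)\<^sup>2 - 4 * (max 0 (t - 1 / 2))\<^sup>2 + 2 * (max 0 (t - 1))\<^sup>2"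

definition hat :: "real \<Rightarrow> real" where
  "hat t = 4 * max 0 t - 8 * max 0 (t - 1 / 2) + 4 * max 0 (t - 1)"

lemma cutoff_deriv: "(cutoff has_real_derivative hat t) (at t)"
proof -
  have sh: "((\<lambda>t. (max 0 (t - a))\<^sup>2) has_real_derivative 2 * max 0 (t - a)) (at t)" for a
  proof -
    have "((\<lambda>t. t - a) has_real_derivative 1) (at t)" by (auto intro!: derivative_eq_intros)
    from DERIV_chain2[where f = "\<lambda>t. (max 0 t)\<^sup>2", OF has_real_derivative_pos_part_square this]
    show ?thesis by simp
  qed
  have "((\<lambda>t. 2 * (max 0 t)\<^sup>2 - 4 * (max 0 (t - 1 / 2))\<^sup>2 + 2 * (max 0 (t - 1))\<^sup>2)
      has_real_derivative 2 * (2 * max 0 t) - 4 * (2 * max 0 (t - 1/2)) + 2 * (2 * max 0 (t - 1))) (at t)"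
    by (intro DERIV_add DERIV_diff DERIV_cmult has_real_derivative_pos_part_square sh)
  then show ?thesis by (simp add: cutoff_def[abs_def] hat_def)
qed

lemma cutoff_vals: "t \<le> 0 \<Longrightarrow> cutoff t = 0" "t \<ge> 1 \<Longrightarrow> cutoff t = 1"
  by (auto simp: cutoff_def power2_eq_square algebra_simps)

lemma hat_vals: "t \<le> 0 \<Longrightarrow> hat t = 0" "t \<ge> 1 \<Longrightarrow> hat t = 0" "hat t \<ge> 0"
  by (auto simp: hat_def max_def)

lemma continuous_hat: "continuous_on A hat"
  unfolding hat_def[abs_def] by (intro continuous_intros)

lemma cutoff_bounds: "0 \<le> cutoff t" "cutoff t \<le> 1"
proof -
  have mono: "cutoff x \<le> cutoff y" if "x \<le> y" for x y
    using that by (rule DERIV_nonneg_imp_nondecreasing) (use cutoff_deriv hat_vals(3) in blast)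
  show "0 \<le> cutoff t" using mono[of "min t 0" t] cutoff_vals(1)[of "min t 0"] by simp
  show "cutoff t \<le> 1" using mono[of t "max t 1"] cutoff_vals(2)[of "max t 1"] by simp
qed

lemma scaled_cutoff_deriv:
  "((\<lambda>x. cutoff (n * (x - a))) has_real_derivative n * hat (n * (x - a))) (at x)"
proof -
  have "((\<lambda>x. n * (x - a)) has_real_derivative n) (at x)"
    by (auto intro!: derivative_eq_intros)
  from DERIV_chain2[where f = cutoff, OF cutoff_deriv this] show ?thesis by (simp add: mult.commute)
qed

lemma has_integral_scaled_hat:
  assumes "n > 0"
  shows "((\<lambda>x. n * hat (n * (x - a))) has_integral 1) {a..a + 1 / n}"
proof -
  have "((\<lambda>x. n * hat (n * (x - a))) has_integral (cutoff (n * (a + 1 / n - a)) - cutoff (n * (a - a)))) {a..a + 1 / n}"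
    using assms by (intro fundamental_theorem_of_calculus)
      (auto intro!: has_field_derivative_at_within[OF scaled_cutoff_deriv] simp flip: has_real_derivative_iff_has_vector_derivative)
  then show ?thesis using assms by (simp add: cutoff_vals)
qed

lemma tendsto_integral_scaled_hat:
  fixes u :: "real \<Rightarrow> 'a::euclidean_space"
  assumes "a < b" "continuous_on {a..b} u"
  shows "(\<lambda>n. integral {a..a + 1 / real (Suc n)} (\<lambda>x. (real (Suc n) * hat (real (Suc n) * (x - a))) *\<^sub>R u x)) \<longlonglongrightarrow> u a"
proof (rule LIMSEQ_I)
  fix e :: real assume e: "e > 0"
  have "\<exists>d>0. \<forall>x\<in>{a..b}. dist x a < d \<longrightarrow> dist (u x) (u a) < e / 2"
    using assms(2)[unfolded continuous_on_iff, rule_format, of a "e / 2"] assms(1) e by auto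
  then obtain d where d: "d > 0" "\<And>x. x \<in> {a..b} \<Longrightarrow> dist x a < d \<Longrightarrow> dist (u x) (u a) < e / 2" by blast
  obtain N :: nat where N: "1 / real (Suc N) < min d (b - a)"
    using nat_approx_posE[of "min d (b - a)"] assms d by auto
  show "\<exists>N. \<forall>n\<ge>N. norm (integral {a..a + 1 / real (Suc n)} (\<lambda>x. (real (Suc n) * hat (real (Suc n) * (x - a))) *\<^sub>R u x) - u a) < e"
  proof (intro exI allI impI)
    fix n assume n: "N \<le> n"
    define k where "k = real (Suc n)"
    have "1 / k \<le> 1 / real (Suc N)" using n by (auto simp: k_def intro!: divide_left_mono)
    then have k: "k > 0" "1 / k < d" "a + 1 / k \<le> b" using N by (auto simp: k_def)
    let ?w = "\<lambda>x. k * hat (k * (x - a))"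
    have w0: "?w x \<ge> 0" for x using k hat_vals(3) by auto
    have cw: "continuous_on {a..a + 1 / k} ?w"
      by (intro continuous_intros continuous_on_compose2[OF continuous_hat[of UNIV]]) auto
    have cu: "continuous_on {a..a + 1 / k} u" using assms(2) k by (auto intro: continuous_on_subset)
    have iw: "(?w has_integral 1) {a..a + 1 / k}" using has_integral_scaled_hat[OF k(1)] .
    have "((\<lambda>x. ?w x *\<^sub>R u a) has_integral 1 *\<^sub>R u a) {a..a + 1 / k}"
      using has_integral_linear[OF iw bounded_linear_scaleR_left[of "u a"]] by (simp add: o_def)
    moreover have iuw: "(\<lambda>x. ?w x *\<^sub>R u x) integrable_on {a..a + 1 / k}"
      by (intro integrable_continuous_real continuous_intros cw cu)
    ultimately have d1: "((\<lambda>x. ?w x *\<^sub>R (u x - u a)) has_integral (integral {a..a + 1 / k} (\<lambda>x. ?w x *\<^sub>R u x) - u a)) {a..a + 1 / k}"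
      using has_integral_diff[OF integrable_integral, of "\<lambda>x. ?w x *\<^sub>R u x" "{a..a + 1 / k}"] iuw
      by (simp add: scaleR_diff_right)
    have "norm (integral {a..a + 1 / k} (\<lambda>x. ?w x *\<^sub>R u x) - u a) \<le> integral {a..a + 1 / k} (\<lambda>x. (e / 2) * ?w x)"
    proof (subst integral_unique[OF d1, symmetric], rule integral_norm_bound_integral)
      fix x assume x: "x \<in> {a..a + 1 / k}"
      then have "norm (u x - u a) \<le> e / 2" using d(2)[of x] k by (auto simp: dist_norm)
      then show "norm (?w x *\<^sub>R (u x - u a)) \<le> (e / 2) * ?w x"
        using w0[of x] mult_left_mono[of "norm (u x - u a)" "e/2" "?w x"] by (simp add: mult.commute)
    qed (use d1 has_integral_mult_right[OF iw, of "e/2"] in auto)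
    also have "\<dots> = e / 2" using integral_unique[OF has_integral_mult_right[OF iw, of "e/2"]] by simp
    finally show "norm (integral {a..a + 1 / real (Suc n)} (\<lambda>x. (real (Suc n) * hat (real (Suc n) * (x - a))) *\<^sub>R u x) - u a) < e"
      using e by (simp add: k_def)
  qed
qed

lemma interior_is_edge:
  assumes "is_edge S"
  shows "S = {0..} \<and> interior S = {0<..} \<or> (\<exists>l>0. S = {0..l} \<and> interior S = {0<..<l})"
  using assms by (auto simp: is_edge_def interior_atLeastAtMost_real interior_real_atLeast)

lemma interior_interval:
  assumes "is_edge S" "a \<in> interior S" "b \<in> interior S"
  shows "{a..b} \<subseteq> interior S" "0 < a"
proof -
  have "(\<exists>l>0. interior S = {0<..<l}) \<or> interior S = {0<..}"
    using interior_is_edge[OF assms(1)] by blast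
  then show "0 < a" using assms(2) by (metis greaterThanLessThan_iff greaterThan_iff)
  have "convex S" using assms(1) by (auto simp: is_edge_def)
  then have "is_interval (interior S)" by (simp add: is_interval_convex_1 convex_interior)
  then show "{a..b} \<subseteq> interior S" using assms(2,3) by (meson atLeastAtMost_iff mem_is_interval_1_I subsetI)
qed

text \<open>
  The lemma of du Bois-Reymond. The test function \<open>p n\<close> is the difference of a step at \<open>a\<close> and one
  at \<open>b\<close>, of width \<open>1 / k n\<close>. As the steps get steeper it tends to the indicator function of
  \<open>(a, b]\<close>, which turns the right-hand side of the defining identity into the integral of \<open>u'\<close>, while
  its derivative is the difference of two approximate Dirac masses, which turn the left-hand side into
  \<open>u a - u b\<close>.
\<close>

lemma H1_on_increment_interior:
  fixes u :: "real \<Rightarrow> 'a::euclidean_space"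
  assumes S: "is_edge S" and H: "H1_on S u u'" and ab: "a \<in> interior S" "b \<in> interior S" "a < b"
  shows "integral {a..b} u' = u b - u a"
proof -
  have ms: "S \<in> sets lebesgue" using is_edgeD[OF S] by auto
  have cu: "continuous_on S u" and L: "L2_on S u'" and w: "weak_derivative S u u'"
    using H by (auto simp: H1_on_def)
  obtain c where c: "c \<in> interior S" "b < c"
  proof -
    obtain r where "r > 0" "ball b r \<subseteq> interior S" using open_contains_ball[of "interior S"] ab by auto
    then show ?thesis using that[of "b + r / 2"] by (auto simp: dist_real_def subset_iff)
  qed
  have sub: "{a..c} \<subseteq> interior S" "interior S \<subseteq> S" using interior_interval[OF S ab(1) c(1)] interior_subset by auto
  have au: "u' absolutely_integrable_on {0..c}" using L2_on_imp_absolutely_integrable[OF L S, of c] c(1) sub by auto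
  then have auc: "u' absolutely_integrable_on {a..c}" using absolutely_integrable_on_subinterval[OF au, of a c] interior_interval[OF S ab(1,2)] by auto
  obtain N :: nat where N: "1 / real (Suc N) < c - b" using nat_approx_posE[of "c - b"] c by auto
  define k where "k n = real (Suc (n + N))" for n
  have kc: "b + 1 / k n < c" and k0: "k n > 0" for n
  proof -
    have "1 / k n \<le> 1 / real (Suc N)" by (auto simp: k_def intro!: divide_left_mono)
    then show "b + 1 / k n < c" using N by auto
  qed (auto simp: k_def)
  define p where "p n x = cutoff (k n * (x - a)) - cutoff (k n * (x - b))" for n x
  define p' where "p' n x = k n * hat (k n * (x - a)) - k n * hat (k n * (x - b))" for n x
  have big: "1 \<le> k n * (x - y)" if "y + 1 / k n \<le> x" for n x y
  proof -
    have "1 / k n \<le> x - y" using that by simp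
    then show ?thesis using k0[of n] by (simp add: field_simps)
  qed
  have p0: "p n x = 0" "p' n x = 0" if "x \<le> a \<or> b + 1 / k n \<le> x" for n x
  proof -
    have "(k n * (x - a) \<le> 0 \<and> k n * (x - b) \<le> 0) \<or> (1 \<le> k n * (x - a) \<and> 1 \<le> k n * (x - b))"
      using that
    proof
      assume "x \<le> a" then show ?thesis using k0[of n] ab(3) by (auto simp: mult_le_0_iff)
    next
      assume "b + 1 / k n \<le> x" then show ?thesis using big[of b n x] big[of a n x] ab(3) by auto
    qed
    then show "p n x = 0" "p' n x = 0" by (auto simp: p_def p'_def cutoff_vals hat_vals)
  qed
  have test: "test_function S (p n) (p' n)" for n
    unfolding test_function_def
  proof (intro conjI allI)
    show "(p n has_real_derivative p' n x) (at x)" for x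
      unfolding p_def[abs_def] p'_def by (intro DERIV_diff scaled_cutoff_deriv)
    show "continuous_on UNIV (p' n)" unfolding p'_def[abs_def]
      by (intro continuous_intros continuous_on_compose2[OF continuous_hat[of UNIV]]) auto
    have "x \<in> {a..b + 1 / k n}" if "p n x \<noteq> 0" for x using p0(1)[of x n] that by force
    then have s: "closure {x. p n x \<noteq> 0} \<subseteq> {a..b + 1 / k n}" by (intro closure_minimal) auto
    then show "compact (closure {x. p n x \<noteq> 0})"
      by (metis bounded_closed_interval bounded_subset closed_closure compact_eq_bounded_closed)
    have "{a..b + 1 / k n} \<subseteq> interior S" using sub(1) kc[of n] by force
    then show "closure {x. p n x \<noteq> 0} \<subseteq> interior S" using s by blast
  qed
  have acS: "{a..c} \<subseteq> S" using sub by auto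
  have cu': "continuous_on {a..c} u" using cu acS continuous_on_subset by blast
  have chat: "continuous_on A (\<lambda>x. k n * hat (k n * (x - y)))" for A n y
    by (intro continuous_intros continuous_on_compose2[OF continuous_hat[of UNIV]]) auto
  have L1: "(\<integral>x. p' n x *\<^sub>R u x \<partial>lebesgue_on S) =
     integral {a..a + 1 / k n} (\<lambda>x. (k n * hat (k n * (x - a))) *\<^sub>R u x)
     - integral {b..b + 1 / k n} (\<lambda>x. (k n * hat (k n * (x - b))) *\<^sub>R u x)" if "a + 1 / k n \<le> b" for n
  proof -
    have ai: "(\<lambda>x. (k n * hat (k n * (x - y))) *\<^sub>R u x) absolutely_integrable_on {y..y + 1 / k n}" if "a \<le> y" "y \<le> b" for y
      using kc[of n] that by (intro absolutely_integrable_continuous_real continuous_intros chat continuous_on_subset[OF cu']) auto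
    have v: "integrable (lebesgue_on S) (\<lambda>x. (k n * hat (k n * (x - y))) *\<^sub>R u x)"
       "(\<integral>x. (k n * hat (k n * (x - y))) *\<^sub>R u x \<partial>lebesgue_on S) = integral {y..y + 1 / k n} (\<lambda>x. (k n * hat (k n * (x - y))) *\<^sub>R u x)"
      if y: "a \<le> y" "y \<le> b" for y
    proof -
      have "{y..y + 1 / k n} \<subseteq> S" using acS kc[of n] y by force
      moreover have "(k n * hat (k n * (x - y))) *\<^sub>R u x = 0" if "x \<in> S - {y..y + 1 / k n}" for x
      proof -
        have "k n * (x - y) \<le> 0 \<or> 1 \<le> k n * (x - y)"
          using that big[of y n x] k0[of n] by (auto simp: mult_le_0_iff not_le)
        then show ?thesis by (auto simp: hat_vals)
      qed
      ultimately show "integrable (lebesgue_on S) (\<lambda>x. (k n * hat (k n * (x - y))) *\<^sub>R u x)"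
       "(\<integral>x. (k n * hat (k n * (x - y))) *\<^sub>R u x \<partial>lebesgue_on S) = integral {y..y + 1 / k n} (\<lambda>x. (k n * hat (k n * (x - y))) *\<^sub>R u x)"
        using integral_lebesgue_on_vanishing[OF _ ms _ _ ai[OF y]] by auto
    qed
    show ?thesis unfolding p'_def
      using v[of a] v[of b] ab(3) by (simp add: scaleR_diff_left)
  qed
  have seq: "(\<lambda>n. integral {y..y + 1 / k n} (\<lambda>x. (k n * hat (k n * (x - y))) *\<^sub>R u x)) \<longlonglongrightarrow> u y"
    if "a \<le> y" "y \<le> b" for y
  proof -
    have "continuous_on {y..c} u" using that by (intro continuous_on_subset[OF cu']) auto
    with tendsto_integral_scaled_hat[of y c u] c(2) that
    have "(\<lambda>n. integral {y..y + 1 / real (Suc n)} (\<lambda>x. (real (Suc n) * hat (real (Suc n) * (x - y))) *\<^sub>R u x)) \<longlonglongrightarrow> u y"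
      by linarith
    from LIMSEQ_ignore_initial_segment[OF this, of N] show ?thesis by (simp only: k_def)
  qed
  have ev: "\<forall>\<^sub>F n in sequentially. y + 1 / k n \<le> x" if "y < x" for x y
  proof -
    from that have "0 < x - y" by simp
    from nat_approx_posE[OF this] obtain M :: nat where M: "1 / real (Suc M) < x - y" by blast
    show ?thesis
    proof (rule eventually_sequentiallyI)
      fix n assume "M \<le> n"
      then have "1 / k n \<le> 1 / real (Suc M)" by (auto simp: k_def intro!: divide_left_mono)
      then show "y + 1 / k n \<le> x" using M by linarith
    qed
  qed
  have lim1: "(\<lambda>n. \<integral>x. p' n x *\<^sub>R u x \<partial>lebesgue_on S) \<longlonglongrightarrow> u a - u b"
  proof (rule Lim_transform_eventually[OF tendsto_diff[OF seq[of a] seq[of b]]])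
    show "\<forall>\<^sub>F n in sequentially. integral {a..a + 1 / k n} (\<lambda>x. (k n * hat (k n * (x - a))) *\<^sub>R u x)
        - integral {b..b + 1 / k n} (\<lambda>x. (k n * hat (k n * (x - b))) *\<^sub>R u x) = (\<integral>x. p' n x *\<^sub>R u x \<partial>lebesgue_on S)"
      by (rule eventually_mono[OF ev[OF ab(3)]]) (simp only: L1)
  qed (use ab(3) in auto)
  have lim2: "(\<lambda>n. \<integral>x. p n x *\<^sub>R u' x \<partial>lebesgue_on S) \<longlonglongrightarrow> (\<integral>x. indicat_real {a<..b} x *\<^sub>R u' x \<partial>lebesgue_on S)"
  proof (rule integral_dominated_convergence[where w = "\<lambda>x. indicat_real {a..c} x * norm (u' x)"])
    have mu: "u' \<in> borel_measurable (lebesgue_on S)" using L2_onD(1)[OF L] .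
    have mi: "indicat_real A \<in> borel_measurable (lebesgue_on S)" if "A \<in> sets borel" for A
      using that by (intro measurable_restrict_space1 measurable_completion) auto
    show "(\<lambda>x. indicat_real {a<..b} x *\<^sub>R u' x) \<in> borel_measurable (lebesgue_on S)"
      using mu mi[of "{a<..b}"] by measurable
    have "continuous_on UNIV (p n)" for n
      using test[of n] by (auto simp: test_function_def intro!: continuous_at_imp_continuous_on DERIV_isCont)
    then have "p n \<in> borel_measurable (lebesgue_on S)" for n
      by (intro continuous_imp_measurable_on_sets_lebesgue ms) (auto intro: continuous_on_subset)
    then show "(\<lambda>x. p n x *\<^sub>R u' x) \<in> borel_measurable (lebesgue_on S)" for n using mu by measurable
    have "(\<lambda>x. norm (u' x)) absolutely_integrable_on {a..c}" using absolutely_integrable_norm[OF auc] by (simp add: o_def)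
    then have "(\<lambda>x. indicat_real {a..c} x * norm (u' x)) absolutely_integrable_on {a..c}"
      by (rule absolutely_integrable_spike[where S = "{}"]) auto
    from integral_lebesgue_on_vanishing(1)[OF acS ms _ _ this]
    show "integrable (lebesgue_on S) (\<lambda>x. indicat_real {a..c} x * norm (u' x))" by auto
    show "AE x in lebesgue_on S. norm (p n x *\<^sub>R u' x) \<le> indicat_real {a..c} x * norm (u' x)" for n
    proof (intro AE_I2)
      fix x
      show "norm (p n x *\<^sub>R u' x) \<le> indicat_real {a..c} x * norm (u' x)"
      proof (cases "x \<in> {a..c}")
        case True
        have "\<bar>p n x\<bar> \<le> 1" using cutoff_bounds[of "k n * (x - a)"] cutoff_bounds[of "k n * (x - b)"]
          by (simp add: p_def abs_le_iff)
        then show ?thesis using True mult_right_mono[of "\<bar>p n x\<bar>" 1 "norm (u' x)"] by simp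
      next
        case False
        then have "x \<le> a \<or> b + 1 / k n \<le> x" using kc[of n] by force
        then show ?thesis using p0(1) by simp
      qed
    qed
    show "AE x in lebesgue_on S. (\<lambda>n. p n x *\<^sub>R u' x) \<longlonglongrightarrow> indicat_real {a<..b} x *\<^sub>R u' x"
    proof (intro AE_I2)
      fix x
      have "\<forall>\<^sub>F n in sequentially. p n x = indicat_real {a<..b} x"
      proof -
        consider "x \<le> a" | "a < x" "x \<le> b" | "b < x" by linarith
        then show ?thesis
        proof cases
          case 2
          have "p n x = 1" if "a + 1 / k n \<le> x" for n
          proof -
            have "k n * (x - b) \<le> 0" using k0[of n] 2 by (auto simp: mult_le_0_iff)
            then show ?thesis using big[OF that] by (simp add: p_def cutoff_vals)
          qed
          then have "p n x = indicat_real {a<..b} x" if "a + 1 / k n \<le> x" for n using that 2 by simp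
          then show ?thesis by (rule eventually_mono[OF ev[OF 2(1)]])
        next
          case 3
          have "p n x = indicat_real {a<..b} x" if "b + 1 / k n \<le> x" for n using that 3 p0(1)[of x n] by simp
          then show ?thesis by (rule eventually_mono[OF ev[OF 3]])
        qed (use p0 in auto)
      qed
      then have "(\<lambda>n. p n x) \<longlonglongrightarrow> indicat_real {a<..b} x" by (rule tendsto_eventually)
      then show "(\<lambda>n. p n x *\<^sub>R u' x) \<longlonglongrightarrow> indicat_real {a<..b} x *\<^sub>R u' x" by (intro tendsto_intros)
    qed
  qed
  have "(\<integral>x. p' n x *\<^sub>R u x \<partial>lebesgue_on S) = - (\<integral>x. p n x *\<^sub>R u' x \<partial>lebesgue_on S)" for n
    using w test[of n] by (auto simp: weak_derivative_def)
  with lim1 have "(\<lambda>n. \<integral>x. p n x *\<^sub>R u' x \<partial>lebesgue_on S) \<longlonglongrightarrow> - (u a - u b)"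
    using tendsto_minus[OF lim1] by simp
  with lim2 have e1: "(\<integral>x. indicat_real {a<..b} x *\<^sub>R u' x \<partial>lebesgue_on S) = u b - u a"
    using LIMSEQ_unique by fastforce
  have aub: "u' absolutely_integrable_on {a..b}"
    using absolutely_integrable_on_subinterval[OF auc, of a b] c by auto
  have "(\<lambda>x. indicat_real {a<..b} x *\<^sub>R u' x) absolutely_integrable_on {a..b}"
    by (rule absolutely_integrable_spike[OF aub, where S = "{a}"]) auto
  from integral_lebesgue_on_vanishing(2)[OF _ ms _ _ this]
  have "(\<integral>x. indicat_real {a<..b} x *\<^sub>R u' x \<partial>lebesgue_on S) = integral {a..b} (\<lambda>x. indicat_real {a<..b} x *\<^sub>R u' x)"
    using order_trans[of "{a..b}" "{a..c}" S] acS c(2) by auto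
  also have "\<dots> = integral {a..b} u'"
    by (rule integral_spike[where S = "{a}"]) auto
  finally show ?thesis using e1 by simp
qed

text \<open>
  The increments are known in the interior; continuity of \<open>u\<close> and of the indefinite integral
  extends them to the endpoints.
\<close>

lemma H1_on_imp_primitive_on:
  fixes u :: "real \<Rightarrow> 'a::euclidean_space"
  assumes S: "is_edge S" and H: "H1_on S u u'"
  shows "primitive_on S u u'"
  unfolding primitive_on_def
proof (intro ballI conjI)
  fix X assume X: "X \<in> S"
  have L: "L2_on S u'" and cu: "continuous_on S u" using H by (auto simp: H1_on_def)
  show a: "u' absolutely_integrable_on {0..X}" by (rule L2_on_imp_absolutely_integrable[OF L S X])
  then have i: "u' integrable_on {0..X}" by (simp add: absolutely_integrable_on_def)
  have X0: "0 \<le> X" using is_edgeD(4)[OF S X] .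
  have "integral {0..X} u' = u X - u 0"
  proof (cases "X = 0")
    case False
    have ii: "x \<in> interior S" if "0 < x" "x < X" for x
      using interior_is_edge[OF S] that X by (elim disjE exE conjE) simp_all
    define g where "g x = u x - integral {0..x} u'" for x
    have cl: "closure {0<..<X} = {0..X}" using False X0 by (simp add: closure_greaterThanLessThan)
    have cg: "continuous_on (closure {0<..<X}) g"
      unfolding cl g_def
      by (intro continuous_intros indefinite_integral_continuous_1 i continuous_on_subset[OF cu] is_edgeD(3)[OF S X])
    have gc: "g x = g (X / 2)" if x: "x \<in> {0<..<X}" for x
    proof -
      have incr: "g y = g x" if "x < y" "0 < x" "y < X" for x y
      proof -
        have "integral {0..x} u' + integral {x..y} u' = integral {0..y} u'"
          using that integrable_on_subinterval[OF i, of 0 y]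
          by (intro Henstock_Kurzweil_Integration.integral_combine) auto
        moreover have "integral {x..y} u' = u y - u x"
          using H1_on_increment_interior[OF S H ii ii] that by auto
        ultimately show ?thesis by (simp add: g_def algebra_simps)
      qed
      show ?thesis
      proof (cases x "X / 2" rule: linorder_cases)
        case less then show ?thesis using incr[of x "X/2"] x by auto
      next
        case greater then show ?thesis using incr[of "X/2" x] x by auto
      next
        case equal show ?thesis by (simp only: equal)
      qed
    qed
    have "g x = g (X / 2)" if "x \<in> {0..X}" for x
      by (rule continuous_constant_on_closure[OF cg gc]) (use that cl in auto)
    from this[of X] this[of 0] have "g X = g (X / 2)" "g 0 = g (X / 2)" using X0 by simp_all
    then have "g X = g 0" by (simp only:)
    then show ?thesis by (simp add: g_def algebra_simps)
  qed simp
  then show "(u' has_integral (u X - u 0)) {0..X}"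
    using i by (simp add: has_integral_integrable_integral)
qed

lemma primitive_on_C1:
  fixes f :: "real \<Rightarrow> 'a::euclidean_space"
  assumes "\<And>x. (f has_vector_derivative f' x) (at x)" "continuous_on UNIV f'" "is_edge S"
  shows "primitive_on S f f'"
  unfolding primitive_on_def
proof (intro ballI conjI)
  fix X assume X: "X \<in> S"
  show "f' absolutely_integrable_on {0..X}"
    using assms(2) by (intro absolutely_integrable_continuous_real) (auto intro: continuous_on_subset)
  show "(f' has_integral f X - f 0) {0..X}"
    using is_edgeD(4)[OF assms(3) X] by (intro fundamental_theorem_of_calculus)
      (auto intro: has_vector_derivative_at_within[OF assms(1)])
qed

lemma is_edge_cover:
  assumes S: "is_edge S" and K: "compact K" "K \<subseteq> interior S"
  obtains X where "X \<in> S" "K \<subseteq> {0<..<X}"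
proof -
  consider "interior S = {0<..}" "S = {0..}" | l where "l > 0" "interior S = {0<..<l}" "S = {0..l}"
    using interior_is_edge[OF S] by blast
  then show ?thesis
  proof cases
    case 1
    obtain B where B: "\<And>x. x \<in> K \<Longrightarrow> norm x \<le> B" using K(1) compact_imp_bounded bounded_iff by meson
    have "K \<subseteq> {0<..<\<bar>B\<bar> + 1}" using B K(2) 1 by force
    then show ?thesis using that[of "\<bar>B\<bar> + 1"] 1 by simp
  next
    case 2 then show ?thesis using that[of l] K by auto
  qed
qed

text \<open>
  The converse is the product rule for a test function and \<open>u\<close> on an initial segment that
  contains the support of the test function, where the boundary terms vanish.
\<close>

lemma primitive_on_imp_weak_derivative:
  fixes u :: "real \<Rightarrow> 'a::euclidean_space"
  assumes S: "is_edge S" and P: "primitive_on S u u'"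
  shows "weak_derivative S u u'"
  unfolding weak_derivative_def
proof (intro allI impI)
  fix \<phi> \<phi>' assume t: "test_function S \<phi> \<phi>'"
  define K where "K = closure {x. \<phi> x \<noteq> 0}"
  have d: "\<And>x. (\<phi> has_real_derivative \<phi>' x) (at x)" and c: "continuous_on UNIV \<phi>'"
    and K: "compact K" "K \<subseteq> interior S"
    using t by (auto simp: test_function_def K_def)
  obtain X where X: "X \<in> S" "K \<subseteq> {0<..<X}" using is_edge_cover[OF S K] .
  have z: "\<phi> x = 0" "\<phi>' x = 0" if "x \<notin> K" for x
  proof -
    show "\<phi> x = 0" using that closure_subset[of "{x. \<phi> x \<noteq> 0}"] by (auto simp: K_def)
    have "open (- K)" using K(1) by (simp add: compact_imp_closed open_Compl)
    moreover have "\<phi> y = 0" if "y \<in> - K" for y using that closure_subset[of "{x. \<phi> x \<noteq> 0}"] by (auto simp: K_def)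
    ultimately have "((\<lambda>_. 0) has_real_derivative \<phi>' x) (at x)"
      using has_field_derivative_transform_within_open[OF d[of x], of "- K" "\<lambda>_. 0"] that by auto
    then show "\<phi>' x = 0" using DERIV_unique DERIV_const by blast
  qed
  have cphi: "continuous_on A \<phi>" for A
    using d by (auto intro!: continuous_at_imp_continuous_on DERIV_isCont)
  have pphi: "primitive_on S \<phi> \<phi>'"
    using primitive_on_C1[OF _ c S] d by (simp add: has_real_derivative_iff_has_vector_derivative)
  have au: "u' absolutely_integrable_on {0..X}" using P X by (auto simp: primitive_on_def)
  have cu: "continuous_on {0..X} u"
    using primitive_on_continuous[OF P S] is_edgeD(3)[OF S X(1)] continuous_on_subset by blast
  have a1: "(\<lambda>x. \<phi>' x *\<^sub>R u x) absolutely_integrable_on {0..X}"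
    by (intro absolutely_integrable_continuous_real continuous_intros cu continuous_on_subset[OF c]) auto
  have a2: "(\<lambda>x. \<phi> x *\<^sub>R u' x) absolutely_integrable_on {0..X}"
    by (intro absolutely_integrable_bounded_measurable_product[where h = "(*\<^sub>R)", OF _ _ _ _ au]
          continuous_imp_measurable_on_sets_lebesgue cphi compact_imp_bounded compact_continuous_image)
       (auto simp: bilinear_conv_bounded_bilinear bounded_bilinear_scaleR)
  have "((\<lambda>x. \<phi>' x *\<^sub>R u x + \<phi> x *\<^sub>R u' x) has_integral (\<phi> X *\<^sub>R u X - \<phi> 0 *\<^sub>R u 0)) {0..X}"
    using primitive_on_bilinear[OF bounded_bilinear_scaleR S pphi P] X by (auto simp: primitive_on_def)
  moreover have "\<phi> X = 0" "\<phi> 0 = 0" using X(2) by (auto intro!: z(1))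
  ultimately have "integral {0..X} (\<lambda>x. \<phi>' x *\<^sub>R u x + \<phi> x *\<^sub>R u' x) = 0"
    by (simp add: integral_unique)
  then have eq: "integral {0..X} (\<lambda>x. \<phi>' x *\<^sub>R u x) = - integral {0..X} (\<lambda>x. \<phi> x *\<^sub>R u' x)"
    using a1 a2 by (simp add: absolutely_integrable_on_def Henstock_Kurzweil_Integration.integral_add eq_neg_iff_add_eq_0)
  have zX: "\<phi> x = 0" "\<phi>' x = 0" if "x \<in> S - {0..X}" for x using that X(2) by (auto intro!: z)
  have "(\<integral>x. \<phi>' x *\<^sub>R u x \<partial>lebesgue_on S) = integral {0..X} (\<lambda>x. \<phi>' x *\<^sub>R u x)"
    using zX is_edgeD[OF S] X(1) by (intro integral_lebesgue_on_vanishing a1) auto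
  moreover have "(\<integral>x. \<phi> x *\<^sub>R u' x \<partial>lebesgue_on S) = integral {0..X} (\<lambda>x. \<phi> x *\<^sub>R u' x)"
    using zX is_edgeD[OF S] X(1) by (intro integral_lebesgue_on_vanishing a2) auto
  ultimately show "(\<integral>x. \<phi>' x *\<^sub>R u x \<partial>lebesgue_on S) = - (\<integral>x. \<phi> x *\<^sub>R u' x \<partial>lebesgue_on S)"
    using eq by simp
qed

text \<open>
  This characterisation replaces weak derivatives in all that follows: algebraic
  operations, the passage to components of spinors and the product rule are immediate for primitives.
\<close>

lemma H1_on_iff_primitive_on:
  fixes u :: "real \<Rightarrow> 'a::euclidean_space"
  assumes "is_edge S"
  shows "H1_on S u u' \<longleftrightarrow> L2_on S u \<and> L2_on S u' \<and> primitive_on S u u'"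
  using H1_on_imp_primitive_on[OF assms] primitive_on_imp_weak_derivative[OF assms]
    primitive_on_continuous[OF _ assms]
  by (auto simp: H1_on_def)

lemma H1_on_add:
  fixes u :: "real \<Rightarrow> 'a::euclidean_space"
  assumes "is_edge S" "H1_on S u u'" "H1_on S v v'"
  shows "H1_on S (\<lambda>x. u x + v x) (\<lambda>x. u' x + v' x)"
  using assms by (auto simp: H1_on_iff_primitive_on L2_on_add primitive_on_add)

lemma H1_on_linear:
  fixes u :: "real \<Rightarrow> 'a::euclidean_space" and h :: "'a \<Rightarrow> 'b::euclidean_space"
  assumes "is_edge S" "bounded_linear h" "H1_on S u u'"
  shows "H1_on S (\<lambda>x. h (u x)) (\<lambda>x. h (u' x))"
  using assms by (auto simp: H1_on_iff_primitive_on L2_on_bounded_linear primitive_on_linear)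

lemma H1_on_cmult:
  fixes u :: "real \<Rightarrow> complex"
  assumes "is_edge S" "H1_on S u u'"
  shows "H1_on S (\<lambda>x. c * u x) (\<lambda>x. c * u' x)"
  using H1_on_linear[OF assms(1) bounded_linear_mult_right assms(2)] .

lemma H1_on_diff:
  fixes u :: "real \<Rightarrow> complex"
  assumes "is_edge S" "H1_on S u u'" "H1_on S v v'"
  shows "H1_on S (\<lambda>x. u x - v x) (\<lambda>x. u' x - v' x)"
  using H1_on_add[OF assms(1,2) H1_on_cmult[OF assms(1,3), of "-1"]] by simp

lemma primitive_on_mult:
  fixes u v :: "real \<Rightarrow> complex"
  assumes "is_edge S" "primitive_on S u u'" "primitive_on S v v'"
  shows "primitive_on S (\<lambda>x. u x * v x) (\<lambda>x. u' x * v x + u x * v' x)"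
  using primitive_on_bilinear[OF bounded_bilinear_mult assms] .

section \<open>Integration by parts on an edge\<close>

lemma integral_H1_product_bounded:
  fixes u v :: "real \<Rightarrow> complex"
  assumes S: "S = {0..l}" "0 < l" and u: "H1_on S u u'" and v: "H1_on S v v'"
  shows "(\<integral>x. u' x * v x + u x * v' x \<partial>lebesgue_on S) = u l * v l - u 0 * v 0"
proof -
  have e: "is_edge S" using S by (auto simp: is_edge_def)
  have p: "primitive_on S (\<lambda>x. u x * v x) (\<lambda>x. u' x * v x + u x * v' x)"
    using u v e by (intro primitive_on_mult) (auto simp: H1_on_iff_primitive_on)
  then have i: "((\<lambda>x. u' x * v x + u x * v' x) has_integral (u l * v l - u 0 * v 0)) {0..l}"
    and a: "(\<lambda>x. u' x * v x + u x * v' x) absolutely_integrable_on {0..l}"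
    using S by (auto simp: primitive_on_def)
  from a have "integrable (lebesgue_on S) (\<lambda>x. u' x * v x + u x * v' x)"
    using S by (simp add: integrable_lebesgue_on_iff)
  then show ?thesis using lebesgue_integral_eq_integral[of S "\<lambda>x. u' x * v x + u x * v' x"] i S
    by (simp add: integral_unique)
qed

lemma integral_lebesgue_on_half_line_tendsto:
  fixes f :: "real \<Rightarrow> 'a::euclidean_space"
  assumes "integrable (lebesgue_on {0..}) f"
  shows "((\<lambda>X. integral {0..X} f) \<longlongrightarrow> integral\<^sup>L (lebesgue_on {0..}) f) at_top"
proof -
  have mf: "f \<in> borel_measurable (lebesgue_on {0..})" using assms by auto
  have mi: "indicat_real {0..X} \<in> borel_measurable (lebesgue_on {0..})" for X :: real
    by (intro measurable_restrict_space1 measurable_completion) auto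
  have "((\<lambda>X. integral\<^sup>L (lebesgue_on {0..}) (\<lambda>x. indicat_real {0..X} x *\<^sub>R f x)) \<longlongrightarrow> integral\<^sup>L (lebesgue_on {0..}) f) at_top"
  proof (rule integral_dominated_convergence_at_top[where w = "\<lambda>x. norm (f x)"])
    show "(\<lambda>x. indicat_real {0..X} x *\<^sub>R f x) \<in> borel_measurable (lebesgue_on {0..})" for X
      using mf mi[of X] by measurable
    show "integrable (lebesgue_on {0..}) (\<lambda>x. norm (f x))" using assms by auto
    show "AE x in lebesgue_on {0..}. ((\<lambda>X. indicat_real {0..X} x *\<^sub>R f x) \<longlongrightarrow> f x) at_top"
    proof (intro AE_I2)
      fix x :: real assume "x \<in> space (lebesgue_on {0..})"
      then have "\<forall>\<^sub>F X in at_top. indicat_real {0..X} x *\<^sub>R f x = f x"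
        by (intro eventually_mono[OF eventually_ge_at_top[of x]]) auto
      then show "((\<lambda>X. indicat_real {0..X} x *\<^sub>R f x) \<longlongrightarrow> f x) at_top" by (rule tendsto_eventually)
    qed
    show "\<forall>\<^sub>F X in at_top. AE x in lebesgue_on {0..}. norm (indicat_real {0..X} x *\<^sub>R f x) \<le> norm (f x)"
      by (intro always_eventually allI AE_I2) (auto simp: indicator_def)
  qed (fact mf)
  moreover have "integral\<^sup>L (lebesgue_on {0..}) (\<lambda>x. indicat_real {0..X} x *\<^sub>R f x) = integral {0..X} f" for X :: real
  proof -
    have a: "f absolutely_integrable_on {0..X}"
      using set_integrable_subset[of lebesgue "{0..}" f "{0..X}"] assms by (simp add: integrable_lebesgue_on_iff)
    have "(\<lambda>x. indicat_real {0..X} x *\<^sub>R f x) absolutely_integrable_on {0..X}"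
      by (rule absolutely_integrable_spike[OF a, where S = "{}"]) auto
    then have "integral\<^sup>L (lebesgue_on {0..}) (\<lambda>x. indicat_real {0..X} x *\<^sub>R f x) = integral {0..X} (\<lambda>x. indicat_real {0..X} x *\<^sub>R f x)"
      by (intro integral_lebesgue_on_vanishing) auto
    also have "\<dots> = integral {0..X} f"
      by (rule integral_spike[where S = "{}"]) auto
    finally show ?thesis .
  qed
  ultimately show ?thesis by simp
qed

lemma integrable_half_line_limit_zero:
  fixes f :: "real \<Rightarrow> 'a::euclidean_space"
  assumes f: "integrable (lebesgue_on {0..}) f" and L: "(f \<longlongrightarrow> L) at_top"
  shows "L = 0"
proof (rule ccontr)
  assume "L \<noteq> 0"
  then have "\<forall>\<^sub>F x in at_top. norm L / 2 < norm (f x)"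
    using order_tendstoD(1)[OF tendsto_norm[OF L], of "norm L / 2"] by simp
  then obtain N where N: "\<And>x. x \<ge> N \<Longrightarrow> norm L / 2 < norm (f x)"
    by (auto simp: eventually_at_top_linorder)
  define N' where "N' = max N 0"
  have nf: "integrable (lebesgue_on {0..}) (\<lambda>x. norm (f x))" using f by auto
  then have af: "(\<lambda>x. norm (f x)) absolutely_integrable_on {0..}" by (simp add: integrable_lebesgue_on_iff)
  have i: "(\<lambda>x. norm (f x)) integrable_on {0..X}" for X
    using integrable_on_subinterval[of "\<lambda>x. norm (f x)" "{0..}" 0 X] af by (auto simp: absolutely_integrable_on_def)
  have lb: "norm L / 2 * (X - N') \<le> integral {0..X} (\<lambda>x. norm (f x))" if "X \<ge> N'" for X
  proof -
    have "norm L / 2 * (X - N') = integral {N'..X} (\<lambda>x. norm L / 2)" using that by simp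
    also have "\<dots> \<le> integral {N'..X} (\<lambda>x. norm (f x))"
      using N i[of X] integrable_on_subinterval[OF i[of X], of N' X]
      by (intro integral_le) (auto simp: N'_def intro: less_imp_le)
    also have "\<dots> \<le> integral {0..X} (\<lambda>x. norm (f x))"
      using i[of X] integrable_on_subinterval[OF i[of X], of N' X]
      by (intro integral_subset_le) (auto simp: N'_def)
    finally show ?thesis .
  qed
  have "filterlim (\<lambda>X. norm L / 2 * (X - N')) at_top at_top"
    using \<open>L \<noteq> 0\<close> by (intro filterlim_tendsto_pos_mult_at_top[OF tendsto_const]
        filterlim_tendsto_add_at_top[of "\<lambda>_. - N'", simplified, OF tendsto_const] filterlim_ident) auto
  then have "filterlim (\<lambda>X. integral {0..X} (\<lambda>x. norm (f x))) at_top at_top"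
    using lb by (rule filterlim_at_top_mono[OF _ eventually_mono[OF eventually_ge_at_top[of N']]])
  then show False
    using integral_lebesgue_on_half_line_tendsto[OF nf] not_tendsto_and_filterlim_at_infinity
      filterlim_at_top_imp_at_infinity trivial_limit_at_top_linorder by blast
qed

text \<open>
  The product \<open>u v\<close> has an integrable derivative, so it has a limit at infinity; being
  integrable itself, it can only tend to \<open>0\<close>.
\<close>

lemma integral_H1_product_half_line:
  fixes u v :: "real \<Rightarrow> complex"
  assumes S: "S = {0..}" and u: "H1_on S u u'" and v: "H1_on S v v'"
  shows "(\<integral>x. u' x * v x + u x * v' x \<partial>lebesgue_on S) = - (u 0 * v 0)"
proof -
  have e: "is_edge S" using S by (auto simp: is_edge_def)
  let ?p = "\<lambda>x. u' x * v x + u x * v' x"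
  have p: "primitive_on S (\<lambda>x. u x * v x) ?p"
    using u v e by (intro primitive_on_mult) (auto simp: H1_on_iff_primitive_on)
  have L: "L2_on S u" "L2_on S u'" "L2_on S v" "L2_on S v'" using u v by (auto simp: H1_on_def)
  have ip: "integrable (lebesgue_on {0..}) ?p"
    using L S by (auto intro!: integrable_L2_mult)
  have "((\<lambda>X. u 0 * v 0 + integral {0..X} ?p) \<longlongrightarrow> u 0 * v 0 + integral\<^sup>L (lebesgue_on {0..}) ?p) at_top"
    by (intro tendsto_intros integral_lebesgue_on_half_line_tendsto[OF ip])
  moreover have "\<forall>\<^sub>F X in at_top. u 0 * v 0 + integral {0..X} ?p = u X * v X"
  proof (rule eventually_mono[OF eventually_ge_at_top[of 0]])
    fix X :: real assume "0 \<le> X"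
    then have "(?p has_integral (u X * v X - u 0 * v 0)) {0..X}" using p S by (simp add: primitive_on_def)
    then show "u 0 * v 0 + integral {0..X} ?p = u X * v X" by (simp only: integral_unique) simp
  qed
  ultimately have "((\<lambda>X. u X * v X) \<longlongrightarrow> u 0 * v 0 + integral\<^sup>L (lebesgue_on {0..}) ?p) at_top"
    by (rule Lim_transform_eventually)
  moreover have "integrable (lebesgue_on {0..}) (\<lambda>x. u x * v x)"
    using L S by (auto intro!: integrable_L2_mult)
  ultimately have "u 0 * v 0 + integral\<^sup>L (lebesgue_on {0..}) ?p = 0"
    using integrable_half_line_limit_zero by blast
  then show ?thesis using S by (simp add: add_eq_0_iff)
qed

section \<open>Square integrable solutions of first-order equations\<close>

lemma has_vector_derivative_exp_mult:
  "((\<lambda>x. exp (\<mu> * of_real x)) has_vector_derivative \<mu> * exp (\<mu> * of_real x)) (at x)" for \<mu> :: complex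
proof -
  have "((\<lambda>z. exp (\<mu> * z)) has_field_derivative \<mu> * exp (\<mu> * of_real x)) (at (of_real x))"
    by (auto intro!: derivative_eq_intros simp: mult.commute)
  from has_vector_derivative_real_field[OF this] show ?thesis .
qed

lemma primitive_on_exp:
  "is_edge S \<Longrightarrow> primitive_on S (\<lambda>x. exp (\<mu> * of_real x)) (\<lambda>x. \<mu> * exp (\<mu> * of_real x))" for \<mu> :: complex
  by (intro primitive_on_C1 has_vector_derivative_exp_mult continuous_intros)

text \<open>
  Variation of constants, differentiated by the product rule for primitives.
\<close>

lemma primitive_on_first_order_solution:
  fixes \<mu> c :: complex
  assumes S: "is_edge S" and h: "L2_on S h"
  defines "w \<equiv> \<lambda>x. exp (\<mu> * of_real x) * (c + integral {0..x} (\<lambda>t. exp (- \<mu> * of_real t) * h t))"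
  shows "primitive_on S w (\<lambda>x. \<mu> * w x + h x)"
proof -
  define q where "q = (\<lambda>t. exp (- \<mu> * of_real t) * h t)"
  have q: "primitive_on S (\<lambda>x. c + integral {0..x} q) q"
    unfolding primitive_on_def
  proof (intro ballI conjI)
    fix X assume X: "X \<in> S"
    show a: "q absolutely_integrable_on {0..X}" unfolding q_def
      by (intro absolutely_integrable_bounded_measurable_product[where h = "(*)", OF _ _ _ _ L2_on_imp_absolutely_integrable[OF h S X]]
            continuous_imp_measurable_on_sets_lebesgue compact_imp_bounded compact_continuous_image continuous_intros)
         (auto simp: bilinear_conv_bounded_bilinear bounded_bilinear_mult)
    then show "(q has_integral c + integral {0..X} q - (c + integral {0..0} q)) {0..X}"
      by (simp add: absolutely_integrable_on_def integrable_integral)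
  qed
  have "primitive_on S w (\<lambda>x. (\<mu> * exp (\<mu> * of_real x)) * (c + integral {0..x} q) + exp (\<mu> * of_real x) * q x)"
    unfolding w_def q_def[symmetric] by (rule primitive_on_mult[OF S primitive_on_exp[OF S] q])
  moreover have "exp (\<mu> * of_real x) * q x = h x" for x
    by (simp add: q_def flip: mult.assoc exp_add)
  moreover have "w x = exp (\<mu> * of_real x) * (c + integral {0..x} q)" for x by (simp only: w_def q_def)
  ultimately show ?thesis by (simp only: mult.assoc)
qed

text \<open>
  The derivative of \<open>\<bar>w\<bar>\<^sup>2\<close> is \<open>2 Re \<mu> \<bar>w\<bar>\<^sup>2 + 2 Re (h cnj w)\<close>; the last term is absorbed with the
  inequality \<open>2 \<bar>h\<bar> \<bar>w\<bar> \<le> a \<bar>w\<bar>\<^sup>2 + \<bar>h\<bar>\<^sup>2 / a\<close>. So \<open>w\<close> is square integrable on a half-line as soon as the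
  boundary term stays bounded: this holds for every initial value if \<open>Re \<mu> < 0\<close>, and for bounded \<open>w\<close>
  if \<open>Re \<mu> > 0\<close>.
\<close>

lemma first_order_energy:
  fixes \<mu> :: complex and w :: "real \<Rightarrow> complex"
  assumes S: "is_edge S" and M: "M \<in> S" and h: "L2_on S h" and mu: "Re \<mu> \<noteq> 0"
    and w: "primitive_on S w (\<lambda>x. \<mu> * w x + h x)"
  defines "a \<equiv> \<bar>Re \<mu>\<bar>"
  shows "a * integral {0..M} (\<lambda>x. (norm (w x))\<^sup>2)
    \<le> sgn (Re \<mu>) * ((norm (w M))\<^sup>2 - (norm (w 0))\<^sup>2) + integral {0..M} (\<lambda>x. (norm (h x))\<^sup>2) / a"
proof -
  let ?s = "sgn (Re \<mu>)"
  have a: "a > 0" using mu by (simp add: a_def)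
  have sub: "{0..M} \<subseteq> S" using is_edgeD(3)[OF S M] .
  have cw: "continuous_on {0..M} w" using primitive_on_continuous[OF w S] sub continuous_on_subset by blast
  have iw: "(\<lambda>x. (norm (w x))\<^sup>2) integrable_on {0..M}"
    by (intro integrable_continuous_real continuous_intros cw)
  have "L2_on {0..M} h" using L2_on_subset[OF h sub] is_edgeD(1)[OF S] by auto
  then have "(\<lambda>x. (norm (h x))\<^sup>2) absolutely_integrable_on {0..M}"
    using L2_onD(2) by (simp flip: integrable_lebesgue_on_iff)
  then have ih: "(\<lambda>x. (norm (h x))\<^sup>2) integrable_on {0..M}" by (simp add: absolutely_integrable_on_def)
  have "primitive_on S (\<lambda>x. w x \<bullet> w x) (\<lambda>x. (\<mu> * w x + h x) \<bullet> w x + w x \<bullet> (\<mu> * w x + h x))"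
    by (rule primitive_on_bilinear[OF bounded_bilinear_inner S w w])
  then have "((\<lambda>x. (\<mu> * w x + h x) \<bullet> w x + w x \<bullet> (\<mu> * w x + h x)) has_integral (w M \<bullet> w M - w 0 \<bullet> w 0)) {0..M}"
    using M by (simp add: primitive_on_def)
  from has_integral_mult_right[OF this, of ?s]
  have e: "((\<lambda>x. ?s * ((\<mu> * w x + h x) \<bullet> w x + w x \<bullet> (\<mu> * w x + h x))) has_integral
      ?s * ((norm (w M))\<^sup>2 - (norm (w 0))\<^sup>2)) {0..M}"
    by (simp only: dot_square_norm)
  have "((\<lambda>x. a * (norm (w x))\<^sup>2 - (norm (h x))\<^sup>2 / a) has_integral
      (a * integral {0..M} (\<lambda>x. (norm (w x))\<^sup>2) - integral {0..M} (\<lambda>x. (norm (h x))\<^sup>2) / a)) {0..M}"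
    by (intro has_integral_diff has_integral_mult_right has_integral_divide integrable_integral iw ih)
  then have "a * integral {0..M} (\<lambda>x. (norm (w x))\<^sup>2) - integral {0..M} (\<lambda>x. (norm (h x))\<^sup>2) / a
      \<le> ?s * ((norm (w M))\<^sup>2 - (norm (w 0))\<^sup>2)"
  proof (rule has_integral_le[OF _ e])
    fix x
    have 1: "(\<mu> * w x) \<bullet> w x = Re \<mu> * (norm (w x))\<^sup>2"
      by (simp add: inner_complex_def cmod_power2 algebra_simps) (simp add: power2_eq_square algebra_simps)
    have "- (norm (h x) * norm (w x)) \<le> ?s * (h x \<bullet> w x)"
      using Cauchy_Schwarz_ineq2[of "h x" "w x"] mu by (auto simp: sgn_if abs_le_iff)
    moreover have "2 * (norm (h x) * norm (w x)) \<le> a * (norm (w x))\<^sup>2 + (norm (h x))\<^sup>2 / a"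
    proof -
      have "0 \<le> (a * norm (w x) - norm (h x))\<^sup>2 / a" using a by simp
      also have "\<dots> = a * (norm (w x))\<^sup>2 + (norm (h x))\<^sup>2 / a - 2 * (norm (h x) * norm (w x))"
        using a by (simp add: power2_eq_square field_simps)
      finally show ?thesis by simp
    qed
    moreover have "?s * ((\<mu> * w x + h x) \<bullet> w x + w x \<bullet> (\<mu> * w x + h x)) = 2 * a * (norm (w x))\<^sup>2 + 2 * (?s * (h x \<bullet> w x))"
      by (simp add: inner_add_left inner_add_right inner_commute[of "w x"] 1 a_def algebra_simps abs_sgn)
    ultimately show "a * (norm (w x))\<^sup>2 - (norm (h x))\<^sup>2 / a
        \<le> ?s * ((\<mu> * w x + h x) \<bullet> w x + w x \<bullet> (\<mu> * w x + h x))"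
      by linarith
  qed
  then show ?thesis by simp
qed

lemma L2_on_half_line_of_bounded:
  fixes w :: "real \<Rightarrow> complex"
  assumes c: "continuous_on {0..} w" and B: "\<And>M. 0 \<le> M \<Longrightarrow> integral {0..M} (\<lambda>x. (norm (w x))\<^sup>2) \<le> B"
  shows "L2_on {0..} w"
  unfolding L2_on_def
proof (intro conjI)
  show mw: "w \<in> borel_measurable (lebesgue_on {0..})"
    using c by (intro continuous_imp_measurable_on_sets_lebesgue) auto
  let ?f = "\<lambda>n x. indicat_real {0..real n} x * (norm (w x))\<^sup>2"
  have i: "integrable (lebesgue_on {0..}) (?f n)" "integral\<^sup>L (lebesgue_on {0..}) (?f n) = integral {0..real n} (\<lambda>x. (norm (w x))\<^sup>2)" for n
  proof -
    have "continuous_on {0..real n} w" using c by (rule continuous_on_subset) auto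
    then have a: "(\<lambda>x. (norm (w x))\<^sup>2) absolutely_integrable_on {0..real n}"
      by (intro absolutely_integrable_continuous_real continuous_intros)
    have a': "?f n absolutely_integrable_on {0..real n}"
      by (rule absolutely_integrable_spike[OF a, where S = "{}"]) auto
    show "integrable (lebesgue_on {0..}) (?f n)"
      by (rule integral_lebesgue_on_vanishing(1)[OF _ _ _ _ a']) auto
    have "integral\<^sup>L (lebesgue_on {0..}) (?f n) = integral {0..real n} (?f n)"
      by (rule integral_lebesgue_on_vanishing(2)[OF _ _ _ _ a']) auto
    also have "\<dots> = integral {0..real n} (\<lambda>x. (norm (w x))\<^sup>2)"
      by (rule integral_spike[where S = "{}"]) auto
    finally show "integral\<^sup>L (lebesgue_on {0..}) (?f n) = integral {0..real n} (\<lambda>x. (norm (w x))\<^sup>2)" .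
  qed
  have mono: "?f m x \<le> ?f n x" if "m \<le> n" for m n x using that by (auto simp: indicator_def)
  have "incseq (\<lambda>n. integral\<^sup>L (lebesgue_on {0..}) (?f n))"
    by (intro incseq_SucI integral_mono i(1) mono) auto
  moreover have "\<forall>n. integral\<^sup>L (lebesgue_on {0..}) (?f n) \<le> B" using i(2) B by auto
  ultimately obtain L where L: "(\<lambda>n. integral\<^sup>L (lebesgue_on {0..}) (?f n)) \<longlonglongrightarrow> L"
    using incseq_convergent by blast
  show "integrable (lebesgue_on {0..}) (\<lambda>x. (norm (w x))\<^sup>2)"
  proof (rule integrable_monotone_convergence[OF i(1) _ _ L])
    show "AE x in lebesgue_on {0..}. incseq (\<lambda>n. ?f n x)" by (intro AE_I2 monoI mono)
    show "AE x in lebesgue_on {0..}. (\<lambda>n. ?f n x) \<longlonglongrightarrow> (norm (w x))\<^sup>2"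
    proof (intro AE_I2)
      fix x :: real assume x: "x \<in> space (lebesgue_on {0..})"
      obtain N :: nat where N: "x \<le> real N" using real_arch_simple by blast
      have "\<forall>\<^sub>F n in sequentially. ?f n x = (norm (w x))\<^sup>2"
        using x N by (intro eventually_sequentiallyI[of N]) (auto simp: indicator_def)
      then show "(\<lambda>n. ?f n x) \<longlonglongrightarrow> (norm (w x))\<^sup>2" by (rule tendsto_eventually)
    qed
    show "(\<lambda>x. (norm (w x))\<^sup>2) \<in> borel_measurable (lebesgue_on {0..})" using mw by measurable
  qed
qed

lemma H1_on_of_primitive_bounded:
  fixes w :: "real \<Rightarrow> complex"
  assumes "S = {0..l}" "0 < l" "L2_on S h" "primitive_on S w (\<lambda>x. \<mu> * w x + h x)"
  shows "H1_on S w (\<lambda>x. \<mu> * w x + h x)"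
proof -
  have S: "is_edge S" using assms by (auto simp: is_edge_def)
  have "L2_on S w" using primitive_on_continuous[OF assms(4) S] assms(1) L2_on_continuous by blast
  then show ?thesis using assms(3,4) by (simp add: H1_on_iff_primitive_on[OF S] L2_on_add L2_on_cmult)
qed

text \<open>
  The left-hand side is the solution of \<open>w' = \<mu> w + h\<close> that does not grow. It equals minus the integral
  over \<open>[M, \<infinity>)\<close> of \<open>exp (\<mu> (M - t)) h t\<close>, whose modulus is at most
  \<open>(exp (2 Re \<mu> (M - t)) + \<bar>h t\<bar>\<^sup>2) / 2\<close>; the integral of this is bounded uniformly in \<open>M\<close>.
\<close>

lemma growing_tail_bound:
  fixes \<mu> :: complex and h :: "real \<Rightarrow> complex"
  assumes mu: "Re \<mu> > 0" and h: "L2_on {0..} h" and M: "0 \<le> M"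
  defines "q \<equiv> \<lambda>t. exp (- \<mu> * of_real t) * h t"
  shows "norm (exp (\<mu> * of_real M) * (integral {0..M} q - integral {0..} q))
      \<le> 1 / (4 * Re \<mu>) + integral {0..} (\<lambda>x. (norm (h x))\<^sup>2) / 2"
proof -
  define a where "a = Re \<mu>"
  have a: "a > 0" using mu by (simp add: a_def)
  have "(\<lambda>x. (norm (h x))\<^sup>2) absolutely_integrable_on {0..}"
    using L2_onD(2)[OF h] by (simp add: integrable_lebesgue_on_iff)
  then have ih0: "(\<lambda>x. (norm (h x))\<^sup>2) absolutely_integrable_on {M..}" if "0 \<le> M" for M
    using that by (auto intro: set_integrable_subset)
  have ih: "(\<lambda>x. (norm (h x))\<^sup>2) integrable_on {M..}" if "0 \<le> M" for M
    using ih0[OF that] by (simp add: absolutely_integrable_on_def)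
  have mh: "h \<in> borel_measurable (lebesgue_on {M..})" if "0 \<le> M" for M
    by (rule measurable_restrict_mono[OF L2_onD(1)[OF h]]) (use that in simp)
  have me: "(\<lambda>t. exp (\<mu> * of_real (M - t))) \<in> borel_measurable (lebesgue_on A)" if "A \<in> sets lebesgue" for A M
    using that by (intro continuous_imp_measurable_on_sets_lebesgue continuous_intros)
  let ?b = "\<lambda>M t. exp (2 * a * M) / 2 * exp (- (2 * a) * t) + (norm (h t))\<^sup>2 / 2"
  have ie: "((\<lambda>t. exp (2 * a * M) / 2 * exp (- (2 * a) * t)) has_integral
      exp (2 * a * M) / 2 * (exp (- (2 * a) * M) / (2 * a))) {M..}" for M
    by (intro has_integral_mult_right has_integral_exp_minus_to_infinity) (use a in auto)
  have ib: "(?b M has_integral (1 / (4 * a) + integral {M..} (\<lambda>x. (norm (h x))\<^sup>2) / 2)) {M..}" if "0 \<le> M" for M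
    using has_integral_add[OF ie[of M] has_integral_divide[OF integrable_integral[OF ih[OF that]], of 2]]
    by (simp flip: exp_add)
  have le: "norm (exp (\<mu> * of_real (M - t)) * h t) \<le> ?b M t" for M t
  proof -
    have n: "norm (exp (\<mu> * of_real (M - t))) = exp (a * (M - t))" by (simp add: norm_exp_eq_Re a_def)
    have "2 * (exp (a * (M - t)) * norm (h t)) \<le> (exp (a * (M - t)))\<^sup>2 + (norm (h t))\<^sup>2"
      using sum_squares_bound[of "exp (a * (M - t))" "norm (h t)"] by simp
    also have "(exp (a * (M - t)))\<^sup>2 = exp (2 * a * M) * exp (- (2 * a) * t)"
      by (simp add: power2_eq_square algebra_simps flip: exp_add)
    finally show ?thesis unfolding norm_mult n by linarith
  qed
  have iq: "(\<lambda>t. exp (\<mu> * of_real (M - t)) * h t) integrable_on {M..}" if "0 \<le> M" for M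
  proof (rule measurable_bounded_by_integrable_imp_integrable[where g = "?b M"])
    show "(\<lambda>t. exp (\<mu> * of_real (M - t)) * h t) \<in> borel_measurable (lebesgue_on {M..})"
      by (intro borel_measurable_times me mh that) simp
    show "?b M integrable_on {M..}" using ib[OF that] by auto
    show "norm (exp (\<mu> * of_real (M - t)) * h t) \<le> ?b M t" for t by (rule le)
  qed auto
  have qeq: "exp (\<mu> * of_real M) * q t = exp (\<mu> * of_real (M - t)) * h t" for M t
    by (simp add: q_def algebra_simps flip: exp_add)
  from iq[of 0] have q0: "q integrable_on {0..}" by (simp add: q_def)
  show "norm (exp (\<mu> * of_real M) * (integral {0..M} q - integral {0..} q))
      \<le> 1 / (4 * Re \<mu>) + integral {0..} (\<lambda>x. (norm (h x))\<^sup>2) / 2"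
  proof -
    have i1: "(q has_integral integral {0..M} q) {0..M}"
      using integrable_on_subinterval[OF q0, of 0 M] by (auto simp: integrable_integral)
    have "(\<lambda>t. exp (- (\<mu> * of_real M)) * (exp (\<mu> * of_real (M - t)) * h t)) integrable_on {M..}"
      by (rule integrable_on_mult_right[OF iq[OF M]])
    moreover have "exp (- (\<mu> * of_real M)) * (exp (\<mu> * of_real (M - t)) * h t) = q t" for t
      unfolding qeq[symmetric] by (simp flip: mult.assoc exp_add)
    ultimately have qM: "q integrable_on {M..}" by (simp only:)
    have "(q has_integral (integral {0..M} q + integral {M..} q)) ({0..M} \<union> {M..})"
      by (rule has_integral_Un[OF i1 integrable_integral[OF qM]]) (use M in \<open>simp add: Int_atLeastAtMost\<close>)
    moreover have "{0..M} \<union> {M..} = {0..}" using M by auto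
    ultimately have "integral {0..} q = integral {0..M} q + integral {M..} q" by (simp add: integral_unique)
    then have "exp (\<mu> * of_real M) * (integral {0..M} q - integral {0..} q) = - (exp (\<mu> * of_real M) * integral {M..} q)"
      by (simp add: algebra_simps)
    also have "exp (\<mu> * of_real M) * integral {M..} q = integral {M..} (\<lambda>t. exp (\<mu> * of_real (M - t)) * h t)"
      unfolding qeq[symmetric] by (rule integral_mult_right[symmetric])
    finally have "norm (exp (\<mu> * of_real M) * (integral {0..M} q - integral {0..} q))
        = norm (integral {M..} (\<lambda>t. exp (\<mu> * of_real (M - t)) * h t))" by simp
    also have "\<dots> \<le> integral {M..} (?b M)"
      using ib[OF M] by (intro integral_norm_bound_integral iq[OF M] le) auto
    also have "\<dots> = 1 / (4 * a) + integral {M..} (\<lambda>x. (norm (h x))\<^sup>2) / 2"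
      using ib[OF M] by (rule integral_unique)
    also have "\<dots> \<le> 1 / (4 * a) + integral {0..} (\<lambda>x. (norm (h x))\<^sup>2) / 2"
      using M ih[of 0] ih[OF M] integral_subset_le[of "{M..}" "{0..}" "\<lambda>x. (norm (h x))\<^sup>2"] by auto
    finally show ?thesis by (simp add: a_def)
  qed
qed

lemma exists_H1_first_order_solution:
  fixes \<mu> :: complex and h :: "real \<Rightarrow> complex"
  assumes S: "is_edge S" and mu: "Re \<mu> \<noteq> 0" and h: "L2_on S h"
  obtains w where "H1_on S w (\<lambda>x. \<mu> * w x + h x)"
proof -
  consider l where "S = {0..l}" "0 < l" | "S = {0..}" using S by (auto simp: is_edge_def)
  then show ?thesis
  proof cases
    case 1
    show ?thesis
      by (rule that, rule H1_on_of_primitive_bounded[OF 1 h primitive_on_first_order_solution[OF S h, where c = 0]])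
  next
    case 2
    define q where "q = (\<lambda>t. exp (- \<mu> * of_real t) * h t)"
    \<comment> \<open>A growing exponential leaves one admissible initial value: the one for which \<open>w\<close> is minus the
      weighted integral of \<open>h\<close> over the tail \<open>[x, \<infinity>)\<close>.\<close>
    define c where "c = (if Re \<mu> > 0 then - integral {0..} q else 0)"
    define w where "w x = exp (\<mu> * of_real x) * (c + integral {0..x} q)" for x
    have w: "primitive_on S w (\<lambda>x. \<mu> * w x + h x)"
      using primitive_on_first_order_solution[OF S h, where c = c and \<mu> = \<mu>] by (simp add: w_def[abs_def] q_def)
    define H where "H = integral {0..} (\<lambda>x. (norm (h x))\<^sup>2)"
    have "(\<lambda>x. (norm (h x))\<^sup>2) absolutely_integrable_on {0..}"
      using L2_onD(2)[OF h] 2 by (simp add: integrable_lebesgue_on_iff)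
    then have ih: "(\<lambda>x. (norm (h x))\<^sup>2) integrable_on {0..}" by (simp add: absolutely_integrable_on_def)
    have hM: "integral {0..M} (\<lambda>x. (norm (h x))\<^sup>2) \<le> H" for M
      unfolding H_def using integrable_on_subinterval[OF ih, of 0 M] by (intro integral_subset_le ih) auto
    obtain C where C: "\<And>M. 0 \<le> M \<Longrightarrow> sgn (Re \<mu>) * ((norm (w M))\<^sup>2 - (norm (w 0))\<^sup>2) \<le> C"
    proof (cases "Re \<mu> > 0")
      case True
      define K where "K = 1 / (4 * Re \<mu>) + H / 2"
      have "norm (w M) \<le> K" if "0 \<le> M" for M
        using growing_tail_bound[OF True, of h M] h 2 that True
        by (simp add: w_def c_def q_def K_def H_def)
      then have sq: "(norm (w M))\<^sup>2 \<le> K\<^sup>2" if "0 \<le> M" for M using that by (intro power_mono) auto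
      have "(norm (w M))\<^sup>2 - (norm (w 0))\<^sup>2 \<le> K\<^sup>2" if "0 \<le> M" for M
        using sq[OF that] zero_le_power2[of "norm (w 0)"] by linarith
      then show ?thesis using True by (intro that[of "K\<^sup>2"]) (simp only: sgn_pos mult_1_left)
    next
      case False
      then have "sgn (Re \<mu>) = -1" using mu by (simp add: sgn_if)
      then show ?thesis by (intro that[of "(norm (w 0))\<^sup>2"]) auto
    qed
    define a where "a = \<bar>Re \<mu>\<bar>"
    have a: "a > 0" using mu by (simp add: a_def)
    have "integral {0..M} (\<lambda>x. (norm (w x))\<^sup>2) \<le> (C + H / a) / a" if M: "0 \<le> M" for M
    proof -
      have "a * integral {0..M} (\<lambda>x. (norm (w x))\<^sup>2) \<le> C + H / a"
        using first_order_energy[OF S _ h mu w, of M] C[OF M] divide_right_mono[OF hM, of a M] a M 2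
        unfolding a_def[symmetric] by auto
      then show ?thesis using a by (simp add: pos_le_divide_eq mult.commute)
    qed
    then have "L2_on S w"
      using L2_on_half_line_of_bounded[of w] primitive_on_continuous[OF w S] 2 by blast
    then show ?thesis
      using w h by (intro that[of w]) (simp add: H1_on_iff_primitive_on[OF S] L2_on_add L2_on_cmult)
  qed
qed

text \<open>
  The combinations \<open>u = \<phi> + (\<alpha> / \<kappa>) \<eta>\<close> and \<open>w = \<phi> - (\<alpha> / \<kappa>) \<eta>\<close> decouple the system into
  \<open>u' = \<kappa> u + g + (\<alpha> / \<kappa>) f\<close> and \<open>w' = - \<kappa> w + g - (\<alpha> / \<kappa>) f\<close>.
\<close>

lemma exists_H1_system_solution:
  fixes \<alpha> \<beta> \<kappa> :: complex and f g :: "real \<Rightarrow> complex"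
  assumes S: "is_edge S" and k: "Re \<kappa> \<noteq> 0" "\<kappa>\<^sup>2 = \<alpha> * \<beta>" and f: "L2_on S f" and g: "L2_on S g"
  obtains \<phi> \<eta> where "H1_on S \<phi> (\<lambda>x. \<alpha> * \<eta> x + g x)" "H1_on S \<eta> (\<lambda>x. \<beta> * \<phi> x + f x)"
proof -
  have k0: "\<kappa> \<noteq> 0" using k(1) by auto
  then have a0: "\<alpha> \<noteq> 0" using k(2) by auto
  have L: "L2_on S (\<lambda>x. g x + (\<alpha> / \<kappa>) * f x)" "L2_on S (\<lambda>x. g x + (- (\<alpha> / \<kappa>)) * f x)"
    by (intro L2_on_add L2_on_cmult f g)+
  obtain u where u: "H1_on S u (\<lambda>x. \<kappa> * u x + (g x + (\<alpha> / \<kappa>) * f x))"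
    using exists_H1_first_order_solution[OF S k(1) L(1)] .
  have k': "Re (- \<kappa>) \<noteq> 0" using k(1) by simp
  obtain w where w: "H1_on S w (\<lambda>x. (- \<kappa>) * w x + (g x + (- (\<alpha> / \<kappa>)) * f x))"
    using exists_H1_first_order_solution[OF S k' L(2)] .
  define \<phi> where "\<phi> x = 1 / 2 * (u x + w x)" for x
  define \<eta> where "\<eta> x = \<kappa> / (2 * \<alpha>) * (u x - w x)" for x
  have "H1_on S \<phi> (\<lambda>x. 1 / 2 * ((\<kappa> * u x + (g x + (\<alpha> / \<kappa>) * f x)) + ((- \<kappa>) * w x + (g x + (- (\<alpha> / \<kappa>)) * f x))))"
    unfolding \<phi>_def[abs_def] by (intro H1_on_cmult[OF S] H1_on_add[OF S] u w)
  moreover have "1 / 2 * ((\<kappa> * u x + (g x + (\<alpha> / \<kappa>) * f x)) + ((- \<kappa>) * w x + (g x + (- (\<alpha> / \<kappa>)) * f x))) = \<alpha> * \<eta> x + g x" for x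
    using a0 by (simp add: \<eta>_def field_simps)
  ultimately have 1: "H1_on S \<phi> (\<lambda>x. \<alpha> * \<eta> x + g x)" by (simp only:)
  have "H1_on S \<eta> (\<lambda>x. \<kappa> / (2 * \<alpha>) * ((\<kappa> * u x + (g x + (\<alpha> / \<kappa>) * f x)) - ((- \<kappa>) * w x + (g x + (- (\<alpha> / \<kappa>)) * f x))))"
    unfolding \<eta>_def[abs_def] by (intro H1_on_cmult[OF S] H1_on_diff[OF S] u w)
  moreover have "\<kappa> / (2 * \<alpha>) * ((\<kappa> * u x + (g x + (\<alpha> / \<kappa>) * f x)) - ((- \<kappa>) * w x + (g x + (- (\<alpha> / \<kappa>)) * f x))) = \<beta> * \<phi> x + f x" for x
  proof -
    have "\<kappa> / (2 * \<alpha>) * ((\<kappa> * u x + (g x + (\<alpha> / \<kappa>) * f x)) - ((- \<kappa>) * w x + (g x + (- (\<alpha> / \<kappa>)) * f x)))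
      = \<kappa>\<^sup>2 / \<alpha> * \<phi> x + f x"
      using a0 k0 by (simp add: \<phi>_def field_simps power2_eq_square)
    then show ?thesis using a0 k(2) by simp
  qed
  ultimately have 2: "H1_on S \<eta> (\<lambda>x. \<beta> * \<phi> x + f x)" by (simp only:)
  show ?thesis by (rule that[OF 1 2])
qed

lemma H1_on_exp:
  assumes "is_edge S" "S = {0..} \<Longrightarrow> Re \<mu> < 0"
  shows "H1_on S (\<lambda>x. exp (\<mu> * of_real x)) (\<lambda>x. \<mu> * exp (\<mu> * of_real x))"
proof -
  have p: "primitive_on S (\<lambda>x. exp (\<mu> * of_real x)) (\<lambda>x. \<mu> * exp (\<mu> * of_real x) + 0)"
    using primitive_on_exp[OF assms(1)] by simp
  consider l where "S = {0..l}" "0 < l" | "S = {0..}" using assms(1) by (auto simp: is_edge_def)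
  then show ?thesis
  proof cases
    case 1
    from H1_on_of_primitive_bounded[OF 1 L2_on_zero p] show ?thesis by simp
  next
    case 2
    have mu: "Re \<mu> < 0" using assms(2) 2 by simp
    have "((\<lambda>x. exp (- (- 2 * Re \<mu>) * x)) has_integral exp (- (- 2 * Re \<mu>) * 0) / (- 2 * Re \<mu>)) {0..}"
      by (rule has_integral_exp_minus_to_infinity) (use mu in auto)
    moreover have "(norm (exp (\<mu> * of_real x)))\<^sup>2 = exp (- (- 2 * Re \<mu>) * x)" for x
      by (simp add: norm_exp_eq_Re power2_eq_square flip: exp_add)
    ultimately have i: "(\<lambda>x. (norm (exp (\<mu> * of_real x)))\<^sup>2) integrable_on {0..}" by auto
    have "L2_on S (\<lambda>x. exp (\<mu> * of_real x))"
      unfolding 2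
    proof (rule L2_on_half_line_of_bounded)
      show "continuous_on {0..} (\<lambda>x. exp (\<mu> * of_real x))" by (intro continuous_intros)
      show "integral {0..M} (\<lambda>x. (norm (exp (\<mu> * of_real x)))\<^sup>2) \<le> integral {0..} (\<lambda>x. (norm (exp (\<mu> * of_real x)))\<^sup>2)" for M
        using integrable_on_subinterval[OF i, of 0 M] by (intro integral_subset_le i) auto
    qed
    then show ?thesis using p by (simp add: H1_on_iff_primitive_on[OF assms(1)] L2_on_cmult)
  qed
qed

section \<open>Square linear systems\<close>

text \<open>
  The unknowns and the equations are indexed by the same finite set \<open>P\<close>. The functions supported in
  \<open>P\<close> form a space of dimension \<open>card P\<close>; injectivity makes the images of a basis independent, and
  an independent set of that size spans the space.
\<close>

lemma square_linear_system_solvable: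
  fixes T :: "('p \<Rightarrow> complex) \<Rightarrow> 'p \<Rightarrow> complex"
  assumes P: "finite P"
    and add: "\<And>x y p. T (\<lambda>i. x i + y i) p = T x p + T y p"
    and scale: "\<And>c x p. T (\<lambda>i. c * x i) p = c * T x p"
    and inj: "\<And>x. (\<And>p. p \<notin> P \<Longrightarrow> x p = 0) \<Longrightarrow> (\<And>p. p \<in> P \<Longrightarrow> T x p = 0) \<Longrightarrow> (\<And>p. p \<in> P \<Longrightarrow> x p = 0)"
  shows "\<exists>x. \<forall>p\<in>P. T x p = b p"
proof -
  define s where "s = (\<lambda>c (x::'p \<Rightarrow> complex) i. c * x i)"
  interpret V: vector_space s
    by unfold_locales (auto simp: s_def fun_eq_iff algebra_simps)
  interpret VV: vector_space_pair s s by unfold_locales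
  define R where "R x = (\<lambda>p. if p \<in> P then T x p else 0)" for x
  have R: "Vector_Spaces.linear s s R"
  proof unfold_locales
    show "R (x + y) = R x + R y" for x y
      using add[of x y] by (auto simp: R_def fun_eq_iff plus_fun_def)
    show "R (s c x) = s c (R x)" for c x
      using scale[of c x] by (auto simp: R_def s_def fun_eq_iff)
  qed
  define d where "d p = (\<lambda>i. if i = p then 1 else (0::complex))" for p :: 'p
  define W where "W = {x :: 'p \<Rightarrow> complex. \<forall>p. p \<notin> P \<longrightarrow> x p = 0}"
  have span: "V.span (d ` P) = W"
  proof
    have "V.subspace W" unfolding V.subspace_def by (auto simp: W_def s_def)
    moreover have "d ` P \<subseteq> W" by (auto simp: W_def d_def)
    ultimately show "V.span (d ` P) \<subseteq> W" by (rule V.span_minimal[rotated])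
    show "W \<subseteq> V.span (d ` P)"
    proof
      fix x assume x: "x \<in> W"
      have "x = (\<Sum>p\<in>P. s (x p) (d p))"
      proof
        fix i
        have "(\<Sum>p\<in>P. s (x p) (d p)) i = (\<Sum>p\<in>P. x p * d p i)" 
          using P by (induction P rule: finite_induct) (auto simp: s_def)
        also have "\<dots> = (\<Sum>p\<in>P. if p = i then x p else 0)" by (intro sum.cong) (auto simp: d_def)
        also have "\<dots> = x i" using x P by (auto simp: W_def sum.delta')
        finally show "x i = (\<Sum>p\<in>P. s (x p) (d p)) i" by simp
      qed
      also have "\<dots> \<in> V.span (d ` P)"
        by (intro V.span_sum V.span_scale V.span_base) auto
      finally show "x \<in> V.span (d ` P)" .
    qed
  qed
  have injd: "inj_on d P" by (auto simp: inj_on_def d_def fun_eq_iff split: if_splits) 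
  have indep: "V.independent (d ` P)"
  proof (rule V.independent_if_scalars_zero)
    show "finite (d ` P)" using P by simp
    fix f x assume f: "(\<Sum>x\<in>d ` P. s (f x) x) = 0" and x: "x \<in> d ` P"
    then obtain p where p: "p \<in> P" "x = d p" by auto
    have "(\<Sum>x\<in>d ` P. s (f x) x) = (\<Sum>q\<in>P. s (f (d q)) (d q))" by (simp add: sum.reindex[OF injd] o_def)
    then have "0 = (\<Sum>q\<in>P. s (f (d q)) (d q)) p" using f by simp
    also have "\<dots> = (\<Sum>q\<in>P. f (d q) * d q p)"
      using P by (induction P rule: finite_induct) (auto simp: s_def)
    also have "\<dots> = (\<Sum>q\<in>P. if q = p then f (d q) else 0)" by (intro sum.cong) (auto simp: d_def)
    also have "\<dots> = f x" using p P by simp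
    finally show "f x = 0" by simp
  qed
  have injR: "inj_on R W"
  proof (rule inj_onI)
    fix x y assume xy: "x \<in> W" "y \<in> W" "R x = R y"
    define z where "z i = x i + (-1) * y i" for i
    have "T z p = T x p - T y p" for p using add[of x "\<lambda>i. (-1) * y i" p] scale[of "-1" y p] by (simp add: z_def[abs_def])
    moreover have "T x p = T y p" if "p \<in> P" for p using xy(3) that by (auto simp: R_def fun_eq_iff split: if_splits)
    ultimately have Tz: "T z p = 0" if "p \<in> P" for p using that by simp
    have z0: "z p = 0" if "p \<notin> P" for p using that xy(1,2) by (simp add: z_def W_def)
    have "z p = 0" if "p \<in> P" for p by (rule inj[OF z0 Tz that])
    then have "x i = y i" for i using xy(1,2) by (cases "i \<in> P") (auto simp: z_def W_def)
    then show "x = y" by (rule ext)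
  qed
  have sub: "d ` P \<subseteq> W" by (auto simp: W_def d_def)
  have RW: "R x \<in> W" for x by (auto simp: R_def W_def)
  have indR: "V.independent (R ` d ` P)"
    using VV.linear_independent_injective_image[OF R indep] injR span by simp
  have cardR: "card (R ` d ` P) = card P"
    using card_image[OF inj_on_subset[OF injR sub]] card_image[OF injd] by simp
  define b' where "b' = (\<lambda>p. if p \<in> P then b p else 0)"
  have b'W: "b' \<in> W" by (auto simp: b'_def W_def)
  have "b' \<in> V.span (R ` d ` P)"
  proof (rule ccontr)
    assume n: "b' \<notin> V.span (R ` d ` P)"
    then have "V.independent (insert b' (R ` d ` P))" using indR by (simp add: V.independent_insert)
    moreover have "insert b' (R ` d ` P) \<subseteq> V.span (d ` P)" using b'W RW span by auto
    ultimately have "card (insert b' (R ` d ` P)) \<le> card (d ` P)"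
      using V.independent_span_bound[of "d ` P"] P by blast
    moreover have "b' \<notin> R ` d ` P" using n by (rule contrapos_nn) (rule V.span_base)
    ultimately show False using P cardR card_image[OF injd] by simp
  qed
  then obtain x where "b' = R x" using VV.linear_span_image[OF R, of "d ` P"] by auto
  then have "T x p = b p" if "p \<in> P" for p using that by (auto simp: R_def b'_def fun_eq_iff split: if_splits)
  then show ?thesis by blast
qed

section \<open>Inner products and integration by parts on a metric graph\<close>

lemma L2_zero_imp_zero_at_0:
  fixes u :: "real \<Rightarrow> complex"
  assumes S: "is_edge S" and u: "H1_on S u u'" and z: "(\<integral>x. (norm (u x))\<^sup>2 \<partial>lebesgue_on S) = 0"
  shows "u 0 = 0"
proof -
  have "1 \<in> S \<or> (\<exists>l>0. l \<in> S)" using S by (auto simp: is_edge_def)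
  then obtain X where X: "X \<in> S" "0 < X" using zero_less_one by blast
  have c: "continuous_on {0..X} (\<lambda>x. (norm (u x))\<^sup>2)"
    using u is_edgeD(3)[OF S X(1)] by (auto simp: H1_on_def intro!: continuous_intros intro: continuous_on_subset)
  have i: "integrable (lebesgue_on S) (\<lambda>x. (norm (u x))\<^sup>2)" using u by (auto simp: H1_on_def L2_on_def)
  then have "(\<lambda>x. (norm (u x))\<^sup>2) integrable_on S"
    using is_edgeD(1)[OF S] integrable_on_lebesgue_on by blast
  then have "integral {0..X} (\<lambda>x. (norm (u x))\<^sup>2) \<le> integral S (\<lambda>x. (norm (u x))\<^sup>2)"
    using is_edgeD(3)[OF S X(1)] c by (intro integral_subset_le integrable_continuous_real) auto
  also have "\<dots> = 0" using lebesgue_integral_eq_integral[OF i is_edgeD(1)[OF S]] z by simp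
  finally have "integral {0..X} (\<lambda>x. (norm (u x))\<^sup>2) = 0"
    using integral_nonneg[OF integrable_continuous_real[OF c]] by (intro antisym) auto
  then have "(norm (u 0))\<^sup>2 = 0" using integral_eq_0_iff[OF c X(2)] X(2) by auto
  then show ?thesis by simp
qed

locale finite_metric_graph = metric_graph G len
  for G :: "('v, 'e) pre_digraph" and len :: "'e \<Rightarrow> ereal" +
  assumes finite_arcs: "finite (arcs G)"
begin

lemma edge_cases:
  assumes "e \<in> arcs G"
  obtains "len e = \<infinity>" "edge_interval len e = {0..}"
  | l where "0 < l" "len e = ereal l" "edge_interval len e = {0..l}"
proof (cases "len e")
  case (real l)
  then have "edge_interval len e = {0..l}" by (auto simp: edge_interval_def)
  then show ?thesis using that(2)[of l] len_pos[OF assms] real by simp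
next
  case PInf
  then show ?thesis using that(1) by (auto simp: edge_interval_def)
next
  case MInf
  then show ?thesis using len_pos[OF assms] by simp
qed

abbreviation edge_measure :: "'e \<Rightarrow> real measure" where
  "edge_measure e \<equiv> lebesgue_on (edge_interval len e)"

lemma is_edge_interval: "e \<in> arcs G \<Longrightarrow> is_edge (edge_interval len e)"
  by (erule edge_cases) (auto simp: is_edge_def)

fun vertex_of :: "'e \<times> endpt \<Rightarrow> 'v" where
  "vertex_of (e, Init) = tail G e"
| "vertex_of (e, Term) = head G e"

text \<open>
  The edge ends at the vertices of the core: all but the ends of the half-lines at
  infinity. These ends index both the coefficients and the equations of the linear system below.
\<close>

definition core_ends :: "('e \<times> endpt) set" where
  "core_ends = arcs G \<times> {Init} \<union> {e \<in> arcs G. len e \<noteq> \<infinity>} \<times> {Term}"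

lemma finite_core_ends: "finite core_ends"
  using finite_arcs by (auto simp: core_ends_def)

lemma core_ends_iff: "(e, Init) \<in> core_ends \<longleftrightarrow> e \<in> arcs G" "(e, Term) \<in> core_ends \<longleftrightarrow> e \<in> arcs G \<and> len e \<noteq> \<infinity>"
  by (auto simp: core_ends_def)

lemma vertex_of_core_end: "p \<in> core_ends \<Longrightarrow> vertex_of p \<in> core_verts G len"
  using infinity_not_tail infinity_head_unique
  by (cases p; cases "snd p") (fastforce simp: core_ends_def core_verts_def)+

lemma ends_at_core: "v \<in> core_verts G len \<Longrightarrow> ends_at G v = {p \<in> core_ends. vertex_of p = v}"
  by (auto simp: ends_at_def core_ends_def core_verts_def)

definition ip :: "('e \<Rightarrow> real \<Rightarrow> complex) \<Rightarrow> ('e \<Rightarrow> real \<Rightarrow> complex) \<Rightarrow> complex" where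
  "ip u v = (\<Sum>e\<in>arcs G. \<integral>x. u e x * cnj (v e x) \<partial>edge_measure e)"

definition nsq :: "('e \<Rightarrow> real \<Rightarrow> 'a::euclidean_space) \<Rightarrow> real" where
  "nsq u = (\<Sum>e\<in>arcs G. \<integral>x. (norm (u e x))\<^sup>2 \<partial>edge_measure e)"

lemma L2D: "u \<in> L2 G len \<Longrightarrow> e \<in> arcs G \<Longrightarrow> L2_on (edge_interval len e) (u e)"
  by (simp add: L2_def)

lemma H1D: "H1 G len u u' \<Longrightarrow> e \<in> arcs G \<Longrightarrow> H1_on (edge_interval len e) (u e) (u' e)"
  by (simp add: H1_def)

lemma H1_imp_L2: "H1 G len u u' \<Longrightarrow> u \<in> L2 G len" "H1 G len u u' \<Longrightarrow> u' \<in> L2 G len"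
  by (auto simp: H1_def L2_def H1_on_def)

lemma nsq_nonneg: "nsq u \<ge> 0"
  by (auto simp: nsq_def intro!: sum_nonneg)

lemma ip_cnj: "cnj (ip u v) = ip v u"
proof -
  have "cnj (\<integral>x. u e x * cnj (v e x) \<partial>M) = (\<integral>x. v e x * cnj (u e x) \<partial>M)" for e and M :: "real measure"
    by (subst Bochner_Integration.integral_cnj[symmetric]) (simp add: mult.commute)
  then show ?thesis by (simp add: ip_def)
qed

lemma ip_self: "ip u u = of_real (nsq u)"
  by (simp add: ip_def nsq_def complex_norm_square[symmetric] flip: of_real_power)

lemma ip_cmult_left: "ip (\<lambda>e x. c * u e x) v = c * ip u v"
  by (simp add: ip_def sum_distrib_left mult.assoc)

lemma ip_cmult_right: "ip u (\<lambda>e x. c * v e x) = cnj c * ip u v"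
  using ip_cnj[of "\<lambda>e x. c * v e x" u] ip_cnj[of v u] by (simp add: ip_cmult_left flip: ip_cnj[of "\<lambda>e x. c * v e x" u])

lemma ip_add_left:
  assumes "u \<in> L2 G len" "v \<in> L2 G len" "w \<in> L2 G len"
  shows "ip (\<lambda>e x. u e x + v e x) w = ip u w + ip v w"
  unfolding ip_def sum.distrib[symmetric]
  by (intro sum.cong refl)
    (simp add: distrib_right integrable_L2_mult_cnj L2D[OF assms(1)] L2D[OF assms(2)] L2D[OF assms(3)])

lemma nsq_ae_cong:
  fixes u v :: "'e \<Rightarrow> real \<Rightarrow> 'a::euclidean_space"
  assumes "u \<in> L2 G len" "v \<in> L2 G len" "ae_eq G len u v"
  shows "nsq u = nsq v"
  unfolding nsq_def
proof (intro sum.cong refl integral_cong_AE)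
  fix e assume e: "e \<in> arcs G"
  show "(\<lambda>x. (norm (u e x))\<^sup>2) \<in> borel_measurable (edge_measure e)"
    "(\<lambda>x. (norm (v e x))\<^sup>2) \<in> borel_measurable (edge_measure e)"
    using L2_onD(1)[OF L2D[OF assms(1) e]] L2_onD(1)[OF L2D[OF assms(2) e]] by measurable
  have "AE x in edge_measure e. u e x = v e x" using assms(3) e by (auto simp: ae_eq_def)
  then show "AE x in edge_measure e. (norm (u e x))\<^sup>2 = (norm (v e x))\<^sup>2" by eventually_elim simp
qed

text \<open>
  The weighted form of the Cauchy-Schwarz inequality, in which the estimates below absorb
  terms by a choice of \<open>\<epsilon>\<close>.
\<close>

lemma norm_ip_le:
  assumes u: "u \<in> L2 G len" and v: "v \<in> L2 G len" and \<epsilon>: "\<epsilon> > 0"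
  shows "2 * norm (ip u v) \<le> nsq u / \<epsilon> + \<epsilon> * nsq v"
proof -
  have "norm (ip u v) \<le> (\<Sum>e\<in>arcs G. norm (\<integral>x. u e x * cnj (v e x) \<partial>edge_measure e))"
    unfolding ip_def by (rule norm_sum)
  also have "\<dots> \<le> (\<Sum>e\<in>arcs G. (\<integral>x. (norm (u e x))\<^sup>2 \<partial>edge_measure e) / \<epsilon> / 2
       + \<epsilon> * (\<integral>x. (norm (v e x))\<^sup>2 \<partial>edge_measure e) / 2)"
  proof (rule sum_mono)
    fix e assume e: "e \<in> arcs G"
    note iu = L2_onD(2)[OF L2D[OF u e]] and iv = L2_onD(2)[OF L2D[OF v e]]
    have "norm (\<integral>x. u e x * cnj (v e x) \<partial>edge_measure e)
       \<le> (\<integral>x. (norm (u e x))\<^sup>2 / \<epsilon> / 2 + \<epsilon> * (norm (v e x))\<^sup>2 / 2 \<partial>edge_measure e)"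
    proof (rule order_trans[OF Bochner_Integration.integral_norm_bound integral_mono])
      show "integrable (edge_measure e) (\<lambda>x. norm (u e x * cnj (v e x)))"
        by (intro integrable_norm integrable_L2_mult_cnj L2D u v e)
      show "integrable (edge_measure e) (\<lambda>x. (norm (u e x))\<^sup>2 / \<epsilon> / 2 + \<epsilon> * (norm (v e x))\<^sup>2 / 2)"
        using iu iv by auto
      show "norm (u e x * cnj (v e x)) \<le> (norm (u e x))\<^sup>2 / \<epsilon> / 2 + \<epsilon> * (norm (v e x))\<^sup>2 / 2" for x
      proof -
        have "0 \<le> (norm (u e x) - \<epsilon> * norm (v e x))\<^sup>2 / \<epsilon>" using \<epsilon> by simp
        also have "\<dots> = (norm (u e x))\<^sup>2 / \<epsilon> + \<epsilon> * (norm (v e x))\<^sup>2 - 2 * (norm (u e x) * norm (v e x))"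
          using \<epsilon> by (simp add: power2_eq_square field_simps)
        finally show ?thesis by (simp add: norm_mult)
      qed
    qed
    also have "\<dots> = (\<integral>x. (norm (u e x))\<^sup>2 \<partial>edge_measure e) / \<epsilon> / 2
       + \<epsilon> * (\<integral>x. (norm (v e x))\<^sup>2 \<partial>edge_measure e) / 2"
      using iu iv by simp
    finally show "norm (\<integral>x. u e x * cnj (v e x) \<partial>edge_measure e) \<le> \<dots>" .
  qed
  also have "\<dots> = (nsq u / \<epsilon> + \<epsilon> * nsq v) / 2"
    by (simp add: nsq_def sum.distrib add_divide_distrib flip: sum_divide_distrib sum_distrib_left)
  finally show ?thesis by (simp add: mult.commute)
qed

lemma ip_edge_by_parts:
  assumes e: "e \<in> arcs G" and u: "H1_on (edge_interval len e) (u e) (u' e)" and v: "H1_on (edge_interval len e) (v e) (v' e)"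
  shows "(\<integral>x. u' e x * cnj (v e x) \<partial>edge_measure e)
      + (\<integral>x. u e x * cnj (v' e x) \<partial>edge_measure e)
    = - (\<Sum>p\<in>{p \<in> core_ends. fst p = e}. end_value len u p * cnj (signed_end_value len v p))"
proof -
  let ?S = "edge_interval len e"
  note L = u[unfolded H1_on_def] v[unfolded H1_on_def]
  have cv: "H1_on ?S (\<lambda>x. cnj (v e x)) (\<lambda>x. cnj (v' e x))"
    by (rule H1_on_linear[OF is_edge_interval[OF e] bounded_linear_cnj v])
  have sum: "(\<integral>x. u' e x * cnj (v e x) \<partial>lebesgue_on ?S) + (\<integral>x. u e x * cnj (v' e x) \<partial>lebesgue_on ?S)
    = (\<integral>x. u' e x * cnj (v e x) + u e x * cnj (v' e x) \<partial>lebesgue_on ?S)"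
    using L by (intro Bochner_Integration.integral_add[symmetric] integrable_L2_mult_cnj) auto
  show ?thesis
  proof (rule edge_cases[OF e])
    assume 1: "len e = \<infinity>" "?S = {0..}"
    have "{p \<in> core_ends. fst p = e} = {(e, Init)}" using e 1 by (auto simp: core_ends_def)
    then show ?thesis using integral_H1_product_half_line[OF 1(2) u cv] sum by simp
  next
    fix l assume 1: "0 < l" "len e = ereal l" "?S = {0..l}"
    have "{p \<in> core_ends. fst p = e} = {(e, Init), (e, Term)}" using e 1 by (auto simp: core_ends_def)
    then show ?thesis using integral_H1_product_bounded[OF 1(3,1) u cv] sum 1(2) by simp
  qed
qed

text \<open>
  The boundary terms of the edges are regrouped by vertices. At each vertex \<open>u\<close> has a single
  value, which factors out of the sum of the signed values of \<open>v\<close>, and this sum vanishes.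
\<close>

lemma ip_by_parts:
  assumes u: "H1 G len u u'" and v: "H1 G len v v'"
    and c: "continuous_at_verts G len u" and b: "balanced_at_verts G len v"
  shows "ip u' v = - ip u v'"
proof -
  let ?t = "\<lambda>p. end_value len u p * cnj (signed_end_value len v p)"
  have "ip u' v + ip u v' = (\<Sum>e\<in>arcs G. - (\<Sum>p\<in>{p \<in> core_ends. fst p = e}. ?t p))"
    unfolding ip_def sum.distrib[symmetric]
    by (intro sum.cong refl ip_edge_by_parts) (auto intro: H1D u v)
  also have "\<dots> = - (\<Sum>p\<in>core_ends. ?t p)"
    unfolding sum_negf using finite_core_ends finite_arcs
    by (subst sum.group) (auto simp: core_ends_def)
  also have "(\<Sum>p\<in>core_ends. ?t p) = (\<Sum>w\<in>vertex_of ` core_ends. \<Sum>p\<in>{p \<in> core_ends. vertex_of p = w}. ?t p)"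
    using finite_core_ends by (subst sum.group) auto
  also have "\<dots> = 0"
  proof (rule sum.neutral, rule ballI)
    fix w assume "w \<in> vertex_of ` core_ends"
    then obtain p0 where p0: "p0 \<in> core_ends" "vertex_of p0 = w" by auto
    then have w: "w \<in> core_verts G len" using vertex_of_core_end[OF p0(1)] by simp
    have p0': "p0 \<in> ends_at G w" using p0 ends_at_core[OF w] by auto
    have "(\<Sum>p\<in>ends_at G w. ?t p) = (\<Sum>p\<in>ends_at G w. end_value len u p0 * cnj (signed_end_value len v p))"
    proof (rule sum.cong[OF refl])
      fix p assume "p \<in> ends_at G w"
      then have "end_value len u p = end_value len u p0" using c w p0' unfolding continuous_at_verts_def by blast
      then show "?t p = end_value len u p0 * cnj (signed_end_value len v p)" by simp
    qed
    also have "\<dots> = end_value len u p0 * cnj (\<Sum>p\<in>ends_at G w. signed_end_value len v p)"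
      by (simp add: sum_distrib_left)
    also have "\<dots> = 0" using b w by (simp add: balanced_at_verts_def)
    finally show "(\<Sum>p\<in>{p \<in> core_ends. vertex_of p = w}. ?t p) = 0" using ends_at_core[OF w] by simp
  qed
  finally show ?thesis by (simp add: eq_neg_iff_add_eq_0)
qed

end

section \<open>Solvability of the coupled system\<close>

lemma not_nonpos_real_sqrt:
  fixes z :: complex
  assumes "z \<notin> \<real>\<^sub>\<le>\<^sub>0"
  obtains \<kappa> where "Re \<kappa> > 0" "\<kappa>\<^sup>2 = z"
proof -
  have "Re (csqrt z) \<noteq> 0"
  proof
    assume "Re (csqrt z) = 0"
    then have "csqrt z = \<i> * of_real (Im (csqrt z))" by (simp add: complex_eq_iff)
    then have "(csqrt z)\<^sup>2 = - of_real ((Im (csqrt z))\<^sup>2)"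
      by (metis i_squared mult_minus1 of_real_power power_mult_distrib power2_i)
    then have "z = of_real (- (Im (csqrt z))\<^sup>2)" by simp
    then have "z \<in> \<real>\<^sub>\<le>\<^sub>0" by (metis nonpos_Reals_of_real_iff neg_le_0_iff_le zero_le_power2)
    then show False using assms by simp
  qed
  then have "Re (csqrt z) > 0" using csqrt_principal[of z] by auto
  then show ?thesis using that[of "csqrt z"] by simp
qed

context finite_metric_graph
begin

lemma H1_add: "H1 G len u u' \<Longrightarrow> H1 G len v v' \<Longrightarrow> H1 G len (\<lambda>e x. u e x + v e x) (\<lambda>e x. u' e x + v' e x)"
  for u v :: "'e \<Rightarrow> real \<Rightarrow> 'a::euclidean_space"
  by (simp add: H1_def H1_on_add is_edge_interval)

lemma H1_cmult: "H1 G len u u' \<Longrightarrow> H1 G len (\<lambda>e x. c * u e x) (\<lambda>e x. c * u' e x)"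
  for u :: "'e \<Rightarrow> real \<Rightarrow> complex"
  by (simp add: H1_def H1_on_cmult is_edge_interval)

lemma H1_diff: "H1 G len u u' \<Longrightarrow> H1 G len v v' \<Longrightarrow> H1 G len (\<lambda>e x. u e x - v e x) (\<lambda>e x. u' e x - v' e x)"
  for u v :: "'e \<Rightarrow> real \<Rightarrow> complex"
  by (simp add: H1_def H1_on_diff is_edge_interval)

lemma end_value_add: "end_value len (\<lambda>e x. u e x + v e x) p = end_value len u p + end_value len v p"
  by (cases "(len, u, p)" rule: end_value.cases) auto

lemma end_value_diff: "end_value len (\<lambda>e x. u e x - v e x) p = end_value len u p - end_value len v p"
  by (cases "(len, u, p)" rule: end_value.cases) auto

lemma end_value_cmult: "end_value len (\<lambda>e x. c * u e x) p = c * end_value len u p"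
  by (cases "(len, u, p)" rule: end_value.cases) auto

lemma signed_end_value_add: "signed_end_value len (\<lambda>e x. u e x + v e x) p = signed_end_value len u p + signed_end_value len v p"
  for u v :: "'e \<Rightarrow> real \<Rightarrow> complex"
  by (cases "(len, u, p)" rule: signed_end_value.cases) auto

lemma signed_end_value_diff: "signed_end_value len (\<lambda>e x. u e x - v e x) p = signed_end_value len u p - signed_end_value len v p"
  for u v :: "'e \<Rightarrow> real \<Rightarrow> complex"
  by (cases "(len, u, p)" rule: signed_end_value.cases) auto

lemma signed_end_value_cmult: "signed_end_value len (\<lambda>e x. c * u e x) p = c * signed_end_value len u p"
  for u :: "'e \<Rightarrow> real \<Rightarrow> complex"
  by (cases "(len, u, p)" rule: signed_end_value.cases) auto

text \<open>
  The domain of the Dirac operator, written in components together with the derivatives.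
  With \<open>\<phi>' = \<eta>\<close> or \<open>\<eta>' = \<phi>\<close> it also describes the domains of the two Laplacians.
\<close>

definition vertex_pair ::
  "('e \<Rightarrow> real \<Rightarrow> complex) \<Rightarrow> ('e \<Rightarrow> real \<Rightarrow> complex) \<Rightarrow> ('e \<Rightarrow> real \<Rightarrow> complex) \<Rightarrow> ('e \<Rightarrow> real \<Rightarrow> complex) \<Rightarrow> bool" where
  "vertex_pair \<phi> \<phi>' \<eta> \<eta>' \<longleftrightarrow> H1 G len \<phi> \<phi>' \<and> continuous_at_verts G len \<phi> \<and> H1 G len \<eta> \<eta>' \<and> balanced_at_verts G len \<eta>"

lemma vertex_pair_by_parts: "vertex_pair \<phi> \<phi>' \<eta> \<eta>' \<Longrightarrow> ip \<phi>' \<eta> = - ip \<phi> \<eta>'"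
  by (auto simp: vertex_pair_def intro: ip_by_parts)

lemma continuous_at_verts_diff:
  "continuous_at_verts G len u \<Longrightarrow> continuous_at_verts G len v \<Longrightarrow> continuous_at_verts G len (\<lambda>e x. u e x - v e x)"
  unfolding continuous_at_verts_def end_value_diff by metis

lemma continuous_at_verts_cmult:
  "continuous_at_verts G len u \<Longrightarrow> continuous_at_verts G len (\<lambda>e x. c * u e x)"
  unfolding continuous_at_verts_def end_value_cmult by metis

lemma balanced_at_verts_diff:
  "balanced_at_verts G len u \<Longrightarrow> balanced_at_verts G len v \<Longrightarrow> balanced_at_verts G len (\<lambda>e x. u e x - v e x)"
  unfolding balanced_at_verts_def signed_end_value_diff sum_subtractf by auto

lemma balanced_at_verts_cmult:
  "balanced_at_verts G len u \<Longrightarrow> balanced_at_verts G len (\<lambda>e x. c * u e x)"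
  unfolding balanced_at_verts_def signed_end_value_cmult sum_distrib_left[symmetric] by auto

text \<open>
  Both vertex conditions as one equation for each edge end. At a vertex of degree \<open>d\<close>, one chosen
  end \<open>r\<close> carries the balance condition and each of the \<open>d - 1\<close> others the comparison of its value
  with that at \<open>r\<close>. So the number of equations is the number of ends.
\<close>

definition defect :: "('e \<Rightarrow> real \<Rightarrow> complex) \<Rightarrow> ('e \<Rightarrow> real \<Rightarrow> complex) \<Rightarrow> 'e \<times> endpt \<Rightarrow> complex" where
  "defect \<phi> \<eta> p = (let v = vertex_of p; r = (SOME q. q \<in> ends_at G v) in
     if p = r then \<Sum>q\<in>ends_at G v. signed_end_value len \<eta> q else end_value len \<phi> p - end_value len \<phi> r)"

lemma defect_add:
  "defect (\<lambda>e x. \<phi> e x + \<phi>2 e x) (\<lambda>e x. \<eta> e x + \<eta>2 e x) p = defect \<phi> \<eta> p + defect \<phi>2 \<eta>2 p"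
  by (simp add: defect_def Let_def end_value_add signed_end_value_add sum.distrib)

lemma defect_cmult:
  "defect (\<lambda>e x. c * \<phi> e x) (\<lambda>e x. c * \<eta> e x) p = c * defect \<phi> \<eta> p"
  by (simp add: defect_def Let_def end_value_cmult signed_end_value_cmult sum_distrib_left right_diff_distrib)

lemma vertex_conditions_of_defect:
  assumes z: "\<And>p. p \<in> core_ends \<Longrightarrow> defect \<phi> \<eta> p = 0"
  shows "continuous_at_verts G len \<phi>" "balanced_at_verts G len \<eta>"
proof -
  have main: "(\<Sum>q\<in>ends_at G v. signed_end_value len \<eta> q) = 0 \<and>
      (\<exists>c. \<forall>p\<in>ends_at G v. end_value len \<phi> p = c)" if v: "v \<in> core_verts G len" for v
  proof (cases "ends_at G v = {}")
    case False
    define r where "r = (SOME q. q \<in> ends_at G v)"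
    have r: "r \<in> ends_at G v" using False by (auto simp: r_def some_in_eq)
    have E: "p \<in> core_ends \<and> vertex_of p = v" if "p \<in> ends_at G v" for p using that ends_at_core[OF v] by auto
    have "(\<Sum>q\<in>ends_at G v. signed_end_value len \<eta> q) = 0"
      using z[of r] E[OF r] by (simp add: defect_def Let_def r_def[symmetric])
    moreover have "end_value len \<phi> p = end_value len \<phi> r" if p: "p \<in> ends_at G v" for p
      using z[of p] E[OF p] by (simp add: defect_def Let_def r_def[symmetric] split: if_splits)
    ultimately show ?thesis by blast
  qed simp
  show "continuous_at_verts G len \<phi>" unfolding continuous_at_verts_def
    using main by metis
  show "balanced_at_verts G len \<eta>" unfolding balanced_at_verts_def using main by blast
qed

text \<open>
  Integration by parts gives \<open>\<alpha> \<parallel>\<eta>\<parallel>\<^sup>2 = - cnj \<beta> \<parallel>\<phi>\<parallel>\<^sup>2\<close>. Multiplied by \<open>\<beta>\<close>, this makes \<open>\<alpha> \<beta>\<close> a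
  nonpositive real number unless both norms vanish. The values at \<open>0\<close> are what determines the
  coefficients of the exponentials.
\<close>

lemma vertex_pair_homogeneous_zero:
  assumes ab: "\<alpha> * \<beta> \<notin> \<real>\<^sub>\<le>\<^sub>0"
    and vp: "vertex_pair \<phi> (\<lambda>e x. \<alpha> * \<eta> e x) \<eta> (\<lambda>e x. \<beta> * \<phi> e x)"
    and e: "e \<in> arcs G"
  shows "\<phi> e 0 = 0" "\<eta> e 0 = 0"
proof -
  have b0: "\<beta> \<noteq> 0" using ab by auto
  have "\<alpha> * ip \<eta> \<eta> = - (cnj \<beta> * ip \<phi> \<phi>)"
    using vertex_pair_by_parts[OF vp] by (simp only: ip_cmult_left ip_cmult_right)
  then have "\<beta> * (\<alpha> * of_real (nsq \<eta>)) = \<beta> * - (cnj \<beta> * of_real (nsq \<phi>))" by (simp only: ip_self)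
  then have eq: "\<alpha> * \<beta> * of_real (nsq \<eta>) = of_real (- ((norm \<beta>)\<^sup>2 * nsq \<phi>))"
    using complex_norm_square[of \<beta>] by (simp add: algebra_simps)
  have Q: "nsq \<eta> = 0"
  proof (rule ccontr)
    assume n: "nsq \<eta> \<noteq> 0"
    then have "\<alpha> * \<beta> = of_real (- ((norm \<beta>)\<^sup>2 * nsq \<phi>)) / of_real (nsq \<eta>)" 
      by (subst nonzero_eq_divide_eq) (use eq n in \<open>simp_all only: of_real_eq_0_iff not_False_eq_True\<close>)
    also have "\<dots> = of_real (- ((norm \<beta>)\<^sup>2 * nsq \<phi> / nsq \<eta>))" by simp
    also have "\<dots> \<in> \<real>\<^sub>\<le>\<^sub>0" using nsq_nonneg[of \<phi>] nsq_nonneg[of \<eta>] by (simp only: nonpos_Reals_of_real_iff) simp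
    finally show False using ab by simp
  qed
  then have "of_real (- ((norm \<beta>)\<^sup>2 * nsq \<phi>)) = (0::complex)" using eq by simp
  then have P: "nsq \<phi> = 0" using b0 by (simp only: of_real_eq_0_iff) simp
  have *: "u e 0 = 0" if "nsq u = 0" "H1 G len u u'" for u u' :: "'e \<Rightarrow> real \<Rightarrow> complex"
  proof (rule L2_zero_imp_zero_at_0[OF is_edge_interval[OF e] H1D[OF that(2) e]])
    have "\<forall>e\<in>arcs G. (\<integral>x. (norm (u e x))\<^sup>2 \<partial>edge_measure e) = 0"
      using that(1) unfolding nsq_def by (subst (asm) sum_nonneg_eq_0_iff) (auto simp: finite_arcs)
    then show "(\<integral>x. (norm (u e x))\<^sup>2 \<partial>edge_measure e) = 0" using e by blast
  qed
  show "\<phi> e 0 = 0" "\<eta> e 0 = 0" using *[OF P] *[OF Q] vp by (auto simp: vertex_pair_def)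
qed

text \<open>
  On every edge, the sum of a particular solution \<open>(\<phi>p, \<eta>p)\<close> and of the homogeneous solution
  \<open>(\<Phi> a, E a)\<close> with a coefficient \<open>a p\<close> for each edge end \<open>p\<close>: the initial end carries the decaying
  exponential and the terminal end, if at finite distance, the growing one. The coefficients are
  found by solving the vertex conditions.
\<close>

lemma exists_vertex_pair_solution:
  assumes ab: "\<alpha> * \<beta> \<notin> \<real>\<^sub>\<le>\<^sub>0" and f: "f \<in> L2 G len" and g: "g \<in> L2 G len"
  obtains \<phi> \<eta> where "vertex_pair \<phi> (\<lambda>e x. \<alpha> * \<eta> e x + g e x) \<eta> (\<lambda>e x. \<beta> * \<phi> e x + f e x)"
proof -
  obtain \<kappa> where k: "Re \<kappa> > 0" "\<kappa>\<^sup>2 = \<alpha> * \<beta>" using not_nonpos_real_sqrt[OF ab] .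
  have k0: "\<kappa> \<noteq> 0" using k(1) by auto
  have a0: "\<alpha> \<noteq> 0" using ab by auto
  have "\<exists>\<phi> \<eta>. H1_on (edge_interval len e) \<phi> (\<lambda>x. \<alpha> * \<eta> x + g e x) \<and>
      H1_on (edge_interval len e) \<eta> (\<lambda>x. \<beta> * \<phi> x + f e x)" if e: "e \<in> arcs G" for e
  proof -
    have "Re \<kappa> \<noteq> 0" using k(1) by simp
    from exists_H1_system_solution[OF is_edge_interval[OF e] this k(2) L2D[OF f e] L2D[OF g e]]
    show ?thesis by blast
  qed
  then obtain \<phi>p \<eta>p where p: "\<And>e. e \<in> arcs G \<Longrightarrow> H1_on (edge_interval len e) (\<phi>p e) (\<lambda>x. \<alpha> * \<eta>p e x + g e x)"
    "\<And>e. e \<in> arcs G \<Longrightarrow> H1_on (edge_interval len e) (\<eta>p e) (\<lambda>x. \<beta> * \<phi>p e x + f e x)"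
    by metis
  define t where "t a e = (if len e = \<infinity> then 0 else a (e, Term))" for a :: "'e \<times> endpt \<Rightarrow> complex" and e
  define \<Phi> where "\<Phi> a e x = a (e, Init) * exp (- \<kappa> * of_real x) + t a e * exp (\<kappa> * of_real x)" for a and e :: 'e and x
  define E where "E a e x = (\<kappa> / \<alpha>) * (t a e * exp (\<kappa> * of_real x) - a (e, Init) * exp (- \<kappa> * of_real x))" for a and e :: 'e and x
  have H: "H1 G len (\<Phi> a) (\<lambda>e x. \<alpha> * E a e x)" "H1 G len (E a) (\<lambda>e x. \<beta> * \<Phi> a e x)" for a
  proof -
    have 1: "H1_on (edge_interval len e) (\<lambda>x. a (e, Init) * exp (- \<kappa> * of_real x)) (\<lambda>x. a (e, Init) * (- \<kappa> * exp (- \<kappa> * of_real x)))"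
      if e: "e \<in> arcs G" for e
      using is_edge_interval[OF e] k(1) by (intro H1_on_cmult H1_on_exp) auto
    have 2: "H1_on (edge_interval len e) (\<lambda>x. t a e * exp (\<kappa> * of_real x)) (\<lambda>x. t a e * (\<kappa> * exp (\<kappa> * of_real x)))"
      if e: "e \<in> arcs G" for e
    proof (rule edge_cases[OF e])
      assume "len e = \<infinity>"
      then have "t a e = 0" by (simp add: t_def)
      then show ?thesis
        using is_edge_interval[OF e] H1_on_cmult[OF is_edge_interval[OF e] H1_on_exp[OF is_edge_interval[OF e], of "-1"], of 0] by simp
    next
      fix l assume l: "0 < l" "edge_interval len e = {0..l}"
      then have "l + 1 \<in> {0..}" "l + 1 \<notin> edge_interval len e" by simp_all
      then have "edge_interval len e \<noteq> {0..}" by metis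
      then show ?thesis using is_edge_interval[OF e] by (intro H1_on_cmult H1_on_exp) auto
    qed
    show "H1 G len (\<Phi> a) (\<lambda>e x. \<alpha> * E a e x)"
      unfolding H1_def
    proof
      fix e assume e: "e \<in> arcs G"
      have "H1_on (edge_interval len e) (\<Phi> a e) (\<lambda>x. a (e, Init) * (- \<kappa> * exp (- \<kappa> * of_real x)) + t a e * (\<kappa> * exp (\<kappa> * of_real x)))"
        unfolding \<Phi>_def[abs_def] by (rule H1_on_add[OF is_edge_interval[OF e] 1[OF e] 2[OF e]])
      moreover have "a (e, Init) * (- \<kappa> * exp (- \<kappa> * of_real x)) + t a e * (\<kappa> * exp (\<kappa> * of_real x)) = \<alpha> * E a e x" for x
        using a0 by (simp add: E_def algebra_simps)
      ultimately show "H1_on (edge_interval len e) (\<Phi> a e) (\<lambda>x. \<alpha> * E a e x)" by (simp only:)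
    qed
    show "H1 G len (E a) (\<lambda>e x. \<beta> * \<Phi> a e x)"
      unfolding H1_def
    proof
      fix e assume e: "e \<in> arcs G"
      have "H1_on (edge_interval len e) (E a e) (\<lambda>x. (\<kappa> / \<alpha>) * (t a e * (\<kappa> * exp (\<kappa> * of_real x)) - a (e, Init) * (- \<kappa> * exp (- \<kappa> * of_real x))))"
        unfolding E_def[abs_def] by (intro H1_on_cmult[OF is_edge_interval[OF e]] H1_on_diff[OF is_edge_interval[OF e]] 1[OF e] 2[OF e])
      moreover have "(\<kappa> / \<alpha>) * (t a e * (\<kappa> * exp (\<kappa> * of_real x)) - a (e, Init) * (- \<kappa> * exp (- \<kappa> * of_real x))) = \<beta> * \<Phi> a e x" for x
      proof -
        have "(\<kappa> / \<alpha>) * (t a e * (\<kappa> * exp (\<kappa> * of_real x)) - a (e, Init) * (- \<kappa> * exp (- \<kappa> * of_real x)))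
          = (\<kappa>\<^sup>2 / \<alpha>) * \<Phi> a e x"
          by (simp add: \<Phi>_def algebra_simps power2_eq_square)
        then show ?thesis using k(2) a0 by simp
      qed
      ultimately show "H1_on (edge_interval len e) (E a e) (\<lambda>x. \<beta> * \<Phi> a e x)" by (simp only:)
    qed
  qed
  have t_add: "t (\<lambda>i. x i + y i) e = t x e + t y e" and t_cmult: "t (\<lambda>i. c * x i) e = c * t x e" for x y c e
    by (auto simp: t_def)
  have "\<exists>a. \<forall>p\<in>core_ends. defect (\<Phi> a) (E a) p = - defect \<phi>p \<eta>p p"
  proof (rule square_linear_system_solvable[OF finite_core_ends])
    fix x y :: "'e \<times> endpt \<Rightarrow> complex" and p
    have "\<Phi> (\<lambda>i. x i + y i) = (\<lambda>e s. \<Phi> x e s + \<Phi> y e s)" "E (\<lambda>i. x i + y i) = (\<lambda>e s. E x e s + E y e s)"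
      by (auto simp: \<Phi>_def E_def t_add algebra_simps fun_eq_iff add_divide_distrib diff_divide_distrib)
    then show "defect (\<Phi> (\<lambda>i. x i + y i)) (E (\<lambda>i. x i + y i)) p = defect (\<Phi> x) (E x) p + defect (\<Phi> y) (E y) p"
      by (simp only: defect_add)
  next
    fix c and x :: "'e \<times> endpt \<Rightarrow> complex" and p
    have "\<Phi> (\<lambda>i. c * x i) = (\<lambda>e s. c * \<Phi> x e s)" "E (\<lambda>i. c * x i) = (\<lambda>e s. c * E x e s)"
      by (auto simp: \<Phi>_def E_def t_cmult algebra_simps fun_eq_iff)
    then show "defect (\<Phi> (\<lambda>i. c * x i)) (E (\<lambda>i. c * x i)) p = c * defect (\<Phi> x) (E x) p"
      by (simp only: defect_cmult)
  next
    fix x :: "'e \<times> endpt \<Rightarrow> complex" and p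
    assume z: "\<And>p. p \<in> core_ends \<Longrightarrow> defect (\<Phi> x) (E x) p = 0" and p: "p \<in> core_ends"
    have vp: "vertex_pair (\<Phi> x) (\<lambda>e s. \<alpha> * E x e s) (E x) (\<lambda>e s. \<beta> * \<Phi> x e s)"
      using H vertex_conditions_of_defect[OF z] by (simp add: vertex_pair_def)
    obtain e s where es: "p = (e, s)" by (cases p)
    then have e: "e \<in> arcs G" using p by (auto simp: core_ends_def)
    have "\<Phi> x e 0 = 0" "E x e 0 = 0" using vertex_pair_homogeneous_zero[OF ab vp e] by auto
    then have "x (e, Init) + t x e = 0" "t x e - x (e, Init) = 0" using k0 a0 by (auto simp: \<Phi>_def E_def)
    then have "x (e, Init) = 0" "t x e = 0" by (auto simp: complex_eq_iff)
    then show "x p = 0" using p es by (cases s) (auto simp: t_def core_ends_iff)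
  qed
  then obtain a where a: "\<And>p. p \<in> core_ends \<Longrightarrow> defect (\<Phi> a) (E a) p = - defect \<phi>p \<eta>p p" by blast
  define \<phi> where "\<phi> e x = \<phi>p e x + \<Phi> a e x" for e x
  define \<eta> where "\<eta> e x = \<eta>p e x + E a e x" for e x
  have "defect \<phi> \<eta> p = 0" if "p \<in> core_ends" for p
    using a[OF that] unfolding \<phi>_def[abs_def] \<eta>_def[abs_def] defect_add by simp
  note vc = vertex_conditions_of_defect[OF this]
  have "H1 G len \<phi>p (\<lambda>e x. \<alpha> * \<eta>p e x + g e x)" "H1 G len \<eta>p (\<lambda>e x. \<beta> * \<phi>p e x + f e x)"
    using p by (auto simp: H1_def)
  from H1_add[OF this(1) H(1)[of a]] H1_add[OF this(2) H(2)[of a]]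
  have "H1 G len \<phi> (\<lambda>e x. (\<alpha> * \<eta>p e x + g e x) + \<alpha> * E a e x)" "H1 G len \<eta> (\<lambda>e x. (\<beta> * \<phi>p e x + f e x) + \<beta> * \<Phi> a e x)"
    unfolding \<phi>_def[abs_def] \<eta>_def[abs_def] .
  moreover have "(\<alpha> * \<eta>p e x + g e x) + \<alpha> * E a e x = \<alpha> * \<eta> e x + g e x"
    "(\<beta> * \<phi>p e x + f e x) + \<beta> * \<Phi> a e x = \<beta> * \<phi> e x + f e x" for e x
    by (simp_all add: \<phi>_def \<eta>_def algebra_simps)
  ultimately have "H1 G len \<phi> (\<lambda>e x. \<alpha> * \<eta> e x + g e x)" "H1 G len \<eta> (\<lambda>e x. \<beta> * \<phi> e x + f e x)" by (simp_all only:)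
  with vc show ?thesis by (intro that[of \<phi> \<eta>]) (simp add: vertex_pair_def)
qed

end

section \<open>Spinors and their components\<close>

lemma sigma1_vec_nth: "(sigma1 *v x) $ 1 = x $ 2" "(sigma1 *v x) $ 2 = x $ 1"
  by (simp_all add: sigma1_def matrix_vector_mult_def sum_2)

lemma sigma3_vec_nth: "(sigma3 *v x) $ 1 = x $ 1" "(sigma3 *v x) $ 2 = - x $ 2"
  by (simp_all add: sigma3_def matrix_vector_mult_def sum_2)

lemma P_plus_vec_nth: "(P_plus *v x) $ 1 = x $ 1" "(P_plus *v x) $ 2 = 0"
  by (simp_all add: P_plus_def matrix_vector_mult_def sum_2)

lemma P_minus_vec_nth: "(P_minus *v x) $ 1 = 0" "(P_minus *v x) $ 2 = x $ 2"
  by (simp_all add: P_minus_def matrix_vector_mult_def sum_2)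

lemma spinor_eq_axis: "x = axis 1 (x $ 1) + axis 2 (x $ 2)" for x :: "complex^2"
  by (simp add: vec_eq_iff forall_2 axis_def)

lemma bounded_linear_axis: "bounded_linear (axis i :: complex \<Rightarrow> complex^2)"
  unfolding linear_conv_bounded_linear[symmetric]
  by (rule linearI) (auto simp: axis_def vec_eq_iff)

lemma norm_spinor_square: "(norm x)\<^sup>2 = (norm (x $ 1))\<^sup>2 + (norm (x $ 2))\<^sup>2" for x :: "complex^2"
  by (simp add: norm_vec_def L2_set_def sum_2)

lemma L2_on_spinor_iff:
  fixes f :: "real \<Rightarrow> complex^2"
  shows "L2_on S f \<longleftrightarrow> L2_on S (\<lambda>x. f x $ 1) \<and> L2_on S (\<lambda>x. f x $ 2)"
proof
  assume "L2_on S (\<lambda>x. f x $ 1) \<and> L2_on S (\<lambda>x. f x $ 2)"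
  then have "L2_on S (\<lambda>x. axis 1 (f x $ 1) + axis 2 (f x $ 2) :: complex^2)"
    by (intro L2_on_add L2_on_bounded_linear[OF bounded_linear_axis]) auto
  then show "L2_on S f" by (simp flip: spinor_eq_axis)
qed (auto intro: L2_on_component)

lemma H1_on_spinor_iff:
  fixes u u' :: "real \<Rightarrow> complex^2"
  assumes "is_edge S"
  shows "H1_on S u u' \<longleftrightarrow> H1_on S (\<lambda>x. u x $ 1) (\<lambda>x. u' x $ 1) \<and> H1_on S (\<lambda>x. u x $ 2) (\<lambda>x. u' x $ 2)"
proof
  assume "H1_on S (\<lambda>x. u x $ 1) (\<lambda>x. u' x $ 1) \<and> H1_on S (\<lambda>x. u x $ 2) (\<lambda>x. u' x $ 2)"
  then have "H1_on S (\<lambda>x. axis 1 (u x $ 1) + axis 2 (u x $ 2) :: complex^2) (\<lambda>x. axis 1 (u' x $ 1) + axis 2 (u' x $ 2))"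
    by (intro H1_on_add[OF assms] H1_on_linear[OF assms bounded_linear_axis]) auto
  then show "H1_on S u u'" by (simp flip: spinor_eq_axis)
qed (auto intro: H1_on_linear[OF assms bounded_linear_vec_nth])

text \<open>
  This allows an equation that holds almost everywhere to be taken as the definition of the
  derivative, so that below it holds everywhere.
\<close>

lemma H1_on_derivative_ae_cong:
  fixes u u' w :: "real \<Rightarrow> complex"
  assumes S: "is_edge S" and u: "H1_on S u u'" and w: "L2_on S w" and ae: "AE x in lebesgue_on S. u' x = w x"
  shows "H1_on S u w"
  unfolding H1_on_def weak_derivative_def
proof (intro conjI allI impI)
  show "L2_on S u" "continuous_on S u" using u by (auto simp: H1_on_def)
  show "L2_on S w" by fact
  fix \<phi> \<phi>' assume t: "test_function S \<phi> \<phi>'"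
  then have "continuous_on S \<phi>"
    by (auto simp: test_function_def intro!: continuous_at_imp_continuous_on DERIV_isCont)
  then have m: "\<phi> \<in> borel_measurable (lebesgue_on S)"
    using is_edgeD(1)[OF S] by (rule continuous_imp_measurable_on_sets_lebesgue)
  have "(\<integral>x. \<phi> x *\<^sub>R u' x \<partial>lebesgue_on S) = (\<integral>x. \<phi> x *\<^sub>R w x \<partial>lebesgue_on S)"
  proof (rule integral_cong_AE)
    have "u' \<in> borel_measurable (lebesgue_on S)" "w \<in> borel_measurable (lebesgue_on S)"
      using u w by (auto simp: H1_on_def L2_on_def)
    then show "(\<lambda>x. \<phi> x *\<^sub>R u' x) \<in> borel_measurable (lebesgue_on S)"
      "(\<lambda>x. \<phi> x *\<^sub>R w x) \<in> borel_measurable (lebesgue_on S)"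
      using m by (auto intro: borel_measurable_scaleR)
    show "AE x in lebesgue_on S. \<phi> x *\<^sub>R u' x = \<phi> x *\<^sub>R w x" using ae by eventually_elim simp
  qed
  then show "(\<integral>x. \<phi>' x *\<^sub>R u x \<partial>lebesgue_on S) = - (\<integral>x. \<phi> x *\<^sub>R w x \<partial>lebesgue_on S)"
    using u t by (simp add: H1_on_def weak_derivative_def)
qed

section \<open>Numerical form of the energy estimates\<close>

lemma nonreal_square:
  fixes z :: complex
  assumes "z \<notin> \<real>" "0 \<le> s"
  shows "z\<^sup>2 \<noteq> of_real s"
proof
  assume "z\<^sup>2 = of_real s"
  then have "z\<^sup>2 = (of_real (sqrt s))\<^sup>2" using assms(2) by (simp flip: of_real_power)
  then have "z = of_real (sqrt s) \<or> z = - of_real (sqrt s)" by (simp only: power2_eq_iff)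
  then show False using assms(1) by (metis Reals_of_real Reals_minus)
qed

lemma nonreal_Im: "z \<notin> \<real> \<longleftrightarrow> Im z \<noteq> 0"
  by (simp add: complex_is_Real_iff)

lemma absorb_half:
  fixes x y n a :: real
  assumes "x \<le> n" "2 * n \<le> a + y" "y \<le> x"
  shows "x \<le> a" "n \<le> a"
  using assms by linarith+

text \<open>
  The imaginary part of the identity bounds \<open>\<bar>Im k\<bar> (P + Q)\<close> by \<open>\<bar>w\<bar>\<close>, hence everything by \<open>N\<close>. Then the
  real part gives \<open>M Q = O(N)\<close>, and the bound of \<open>w\<close> with \<open>\<epsilon> = sqrt M\<close>, inserted into the imaginary part
  once more, gains the factor \<open>1 / sqrt M\<close>.
\<close>

lemma energy_bound:
  fixes w k :: complex and N P Q M :: real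
  assumes k: "Im k \<noteq> 0" and nn: "0 \<le> P" "0 \<le> Q" "0 \<le> N" and M: "M > 0"
    and eq: "cnj k * of_real P = (of_real M + k) * of_real Q + w"
    and w: "\<And>\<epsilon>. \<epsilon> > 0 \<Longrightarrow> 2 * norm w \<le> N / \<epsilon> + \<epsilon> * Q"
  shows "P + Q \<le> (1 + (\<bar>Re k\<bar> / (Im k)\<^sup>2 + 1 / \<bar>Im k\<bar>)) / (2 * \<bar>Im k\<bar>) * (N / sqrt M)"
proof -
  define \<kappa> where "\<kappa> = \<bar>Im k\<bar>"
  define C where "C = \<bar>Re k\<bar> / \<kappa>\<^sup>2 + 1 / \<kappa>"
  have kp: "\<kappa> > 0" using k by (simp add: \<kappa>_def)
  have "- (Im k * (P + Q)) = Im w" using arg_cong[OF eq, of Im] by (simp add: algebra_simps)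
  then have "\<bar>Im k * (P + Q)\<bar> = \<bar>Im w\<bar>" by linarith
  then have im: "\<kappa> * (P + Q) \<le> norm w"
    using abs_Im_le_cmod[of w] nn by (simp add: abs_mult \<kappa>_def)
  have "\<kappa> * Q \<le> \<kappa> * (P + Q)" using kp nn by simp
  note PQ' = absorb_half(1)[OF im w[OF kp] this] and wN = absorb_half(2)[OF im w[OF kp] this]
  then have PQ: "P + Q \<le> N / \<kappa>\<^sup>2" using kp by (simp add: pos_le_divide_eq power2_eq_square mult_ac)
  have "M * Q = Re k * (P - Q) - Re w" using arg_cong[OF eq, of Re] by (simp add: algebra_simps)
  also have "\<dots> \<le> \<bar>Re k\<bar> * (P + Q) + norm w"
  proof -
    have "\<bar>Re k * (P - Q)\<bar> \<le> \<bar>Re k\<bar> * (P + Q)" unfolding abs_mult using nn by (intro mult_left_mono) auto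
    then show ?thesis using abs_Re_le_cmod[of w] by linarith
  qed
  also have "\<dots> \<le> \<bar>Re k\<bar> * (N / \<kappa>\<^sup>2) + N / \<kappa>" using PQ wN by (intro add_mono mult_left_mono) auto
  also have "\<dots> = C * N" by (simp add: C_def algebra_simps)
  finally have MQ: "M * Q \<le> C * N" .
  have s: "sqrt M > 0" using M by simp
  have "sqrt M * Q = M * Q / sqrt M" using M by (simp add: real_div_sqrt mult.commute flip: times_divide_eq_left)
  also have "\<dots> \<le> C * N / sqrt M" using MQ s by (intro divide_right_mono) auto
  finally have "sqrt M * Q \<le> C * N / sqrt M" .
  then have "2 * (\<kappa> * (P + Q)) \<le> N / sqrt M + C * N / sqrt M" using im w[OF s] by linarith
  also have "\<dots> = (1 + C) * (N / sqrt M)" by (simp add: algebra_simps add_divide_distrib)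
  finally have "\<kappa> * (P + Q) \<le> (1 + C) / 2 * (N / sqrt M)" by simp
  then have "(P + Q) \<le> (1 + C) / 2 * (N / sqrt M) / \<kappa>"
    using mult.commute[of \<kappa> "P + Q"] by (simp only: pos_le_divide_eq[OF kp])
  then show ?thesis by (simp add: C_def \<kappa>_def field_simps)
qed

lemma laplacian_energy_bound:
  fixes w k :: complex and a U V N :: real
  assumes k: "Im k \<noteq> 0" and nn: "0 \<le> U" "0 \<le> V" "0 \<le> N"
    and eq: "of_real (a * V) = w + k * of_real U"
    and w: "\<And>\<epsilon>. \<epsilon> > 0 \<Longrightarrow> 2 * norm w \<le> N / \<epsilon> + \<epsilon> * U"
  shows "U \<le> N / (Im k)\<^sup>2" "\<bar>a\<bar> * V \<le> (1 / \<bar>Im k\<bar> + norm k / (Im k)\<^sup>2) * N"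
proof -
  define \<kappa> where "\<kappa> = \<bar>Im k\<bar>"
  have kp: "\<kappa> > 0" using k by (simp add: \<kappa>_def)
  have "Im w = - (Im k * U)" using arg_cong[OF eq, of Im] by simp
  then have "\<bar>Im k * U\<bar> = \<bar>Im w\<bar>" by linarith
  then have "\<kappa> * U \<le> norm w" using abs_Im_le_cmod[of w] nn by (simp add: abs_mult \<kappa>_def)
  note 1 = absorb_half(1)[OF this w[OF kp] order_refl] and 2 = absorb_half(2)[OF this w[OF kp] order_refl]
  from 1 have U: "U \<le> N / \<kappa>\<^sup>2" using kp by (simp add: pos_le_divide_eq power2_eq_square mult_ac)
  then show "U \<le> N / (Im k)\<^sup>2" by (simp add: \<kappa>_def)
  have "\<bar>a\<bar> * V = norm (complex_of_real (a * V))" using nn by (simp add: norm_mult)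
  also have "\<dots> \<le> norm w + norm (k * complex_of_real U)" unfolding eq by (rule norm_triangle_ineq)
  also have "\<dots> \<le> N / \<kappa> + norm k * (N / \<kappa>\<^sup>2)" 
    using 2 mult_left_mono[OF U norm_ge_zero[of k]] nn by (intro add_mono) (simp_all add: norm_mult)
  finally show "\<bar>a\<bar> * V \<le> (1 / \<bar>Im k\<bar> + norm k / (Im k)\<^sup>2) * N" by (simp add: \<kappa>_def algebra_simps)
qed

text \<open>
  An explicit bound, of order \<open>1 / c\<close>, for the square of the norm of the difference of the
  resolvents.
\<close>

definition resolvent_rate :: "real \<Rightarrow> complex \<Rightarrow> real \<Rightarrow> real" where
  "resolvent_rate m k c =
     2 * ((1 + (\<bar>Re k\<bar> / (Im k)\<^sup>2 + 1 / \<bar>Im k\<bar>)) / (2 * \<bar>Im k\<bar>)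
       * ((2 + 2 * (norm k)\<^sup>2 * (2 * m * (1 / \<bar>Im k\<bar> + norm k / (Im k)\<^sup>2)) / (4 * m\<^sup>2 * c\<^sup>2)) / sqrt (2 * m * c\<^sup>2)))
     + 2 * (2 * m * (1 / \<bar>Im k\<bar> + norm k / (Im k)\<^sup>2)) / (4 * m\<^sup>2 * c\<^sup>2)"

lemma resolvent_rate_tendsto: "m > 0 \<Longrightarrow> ((\<lambda>c. resolvent_rate m k c) \<longlongrightarrow> 0) at_top"
proof -
  assume m: "m > 0"
  define A where "A = (1 + (\<bar>Re k\<bar> / (Im k)\<^sup>2 + 1 / \<bar>Im k\<bar>)) / (2 * \<bar>Im k\<bar>)"
  define B where "B = 2 * m * (1 / \<bar>Im k\<bar> + norm k / (Im k)\<^sup>2)"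
  have sq: "filterlim (\<lambda>c::real. c\<^sup>2) at_top at_top"
    by (rule filterlim_pow_at_top) (auto intro: filterlim_ident)
  have 1: "filterlim (\<lambda>c::real. 4 * m\<^sup>2 * c\<^sup>2) at_top at_top"
    using m by (intro filterlim_tendsto_pos_mult_at_top[OF tendsto_const] sq) auto
  have 2: "filterlim (\<lambda>c::real. sqrt (2 * m * c\<^sup>2)) at_top at_top"
    using m by (intro filterlim_compose[OF sqrt_at_top] filterlim_tendsto_pos_mult_at_top[OF tendsto_const] sq) auto
  have d: "((\<lambda>c::real. x / (4 * m\<^sup>2 * c\<^sup>2)) \<longlongrightarrow> 0) at_top" for x
    by (intro tendsto_divide_0[OF tendsto_const] filterlim_at_top_imp_at_infinity 1)
  have "((\<lambda>c. 2 * (A * ((2 + 2 * (norm k)\<^sup>2 * B / (4 * m\<^sup>2 * c\<^sup>2)) / sqrt (2 * m * c\<^sup>2))) + 2 * B / (4 * m\<^sup>2 * c\<^sup>2))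
      \<longlongrightarrow> 2 * (A * 0) + 0) at_top"
    by (intro tendsto_add tendsto_mult tendsto_const d tendsto_divide_0[OF tendsto_add[OF tendsto_const d]]
         filterlim_at_top_imp_at_infinity 2)
  then show ?thesis by (simp add: resolvent_rate_def A_def B_def)
qed

text \<open>
  In the application, \<open>P\<close> and \<open>Q\<close> are the squared norms of the two components of the difference
  after the correction of order \<open>1 / c\<close> has been split off, \<open>V / (4 m\<^sup>2 c\<^sup>2)\<close> is that of the
  correction, \<open>N\<close> that of the source \<open>F\<close>, and \<open>N1\<close>, \<open>N2\<close> are those of the components of \<open>f\<close>.
\<close>

lemma resolvent_difference_bound:
  fixes w k K :: complex and N P Q V :: real
  assumes k: "Im k \<noteq> 0" and m: "m > 0" and c: "c > 0" and nn: "0 \<le> P" "0 \<le> Q" "0 \<le> N" "0 \<le> N1" "0 \<le> N2" "0 \<le> V"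
    and eq: "cnj k * of_real P = (of_real (2 * m * c\<^sup>2) + k) * of_real Q + w"
    and w: "\<And>\<epsilon>. \<epsilon> > 0 \<Longrightarrow> 2 * norm w \<le> N / \<epsilon> + \<epsilon> * Q"
    and N: "N \<le> 2 * N2 + 2 * ((norm k)\<^sup>2 / (4 * m\<^sup>2 * c\<^sup>2) * V)"
    and V: "1 / (2 * m) * V \<le> (1 / \<bar>Im k\<bar> + norm k / (Im k)\<^sup>2) * N1"
  shows "P + 2 * Q + 2 * (V / (4 * m\<^sup>2 * c\<^sup>2)) \<le> resolvent_rate m k c * (N1 + N2)"
proof -
  define A where "A = (1 + (\<bar>Re k\<bar> / (Im k)\<^sup>2 + 1 / \<bar>Im k\<bar>)) / (2 * \<bar>Im k\<bar>)"
  define B where "B = 2 * m * (1 / \<bar>Im k\<bar> + norm k / (Im k)\<^sup>2)"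
  define D where "D = 4 * m\<^sup>2 * c\<^sup>2"
  define s where "s = sqrt (2 * m * c\<^sup>2)"
  have A0: "A \<ge> 0" and B0: "B \<ge> 0" and D0: "D > 0" and s0: "s > 0" using m c k by (auto simp: A_def B_def D_def s_def)
  have VB: "V \<le> B * N1" using V m by (simp add: B_def pos_divide_le_eq mult_ac)
  have "2 * m * c\<^sup>2 > 0" using m c by simp
  from energy_bound[OF k nn(1,2,3) this eq w]
  have PQ: "P + Q \<le> A * (N / s)" by (simp add: A_def s_def)
  have "N \<le> 2 * N2 + 2 * (norm k)\<^sup>2 * B / D * N1"
  proof -
    have "2 * ((norm k)\<^sup>2 / D * V) \<le> 2 * ((norm k)\<^sup>2 / D * (B * N1))"
      using D0 by (intro mult_left_mono VB) auto
    then show ?thesis using N by (simp add: D_def mult_ac)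
  qed
  also have "\<dots> \<le> (2 + 2 * (norm k)\<^sup>2 * B / D) * (N1 + N2)"
  proof -
    have "0 \<le> 2 * (norm k)\<^sup>2 * B / D * N2" "0 \<le> 2 * N1" using B0 D0 nn by auto
    then show ?thesis by (simp add: distrib_left distrib_right)
  qed
  finally have "N / s \<le> (2 + 2 * (norm k)\<^sup>2 * B / D) * (N1 + N2) / s" using s0 by (intro divide_right_mono) auto
  from mult_left_mono[OF this A0] PQ
  have PQ': "P + Q \<le> A * ((2 + 2 * (norm k)\<^sup>2 * B / D) / s) * (N1 + N2)" by (simp add: mult_ac)
  have "V / D \<le> B / D * (N1 + N2)"
  proof -
    have "V \<le> B * (N1 + N2)" using VB mult_nonneg_nonneg[OF B0 nn(5)] by (simp add: distrib_left)
    then show ?thesis using D0 by (simp add: divide_right_mono)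
  qed
  then have "P + 2 * Q + 2 * (V / D) \<le> 2 * (A * ((2 + 2 * (norm k)\<^sup>2 * B / D) / s) * (N1 + N2)) + 2 * (B / D * (N1 + N2))"
    using PQ' nn(1,2) by linarith
  also have "\<dots> = resolvent_rate m k c * (N1 + N2)"
    by (simp add: resolvent_rate_def A_def B_def D_def s_def algebra_simps)
  finally show ?thesis by (simp add: D_def)
qed

section \<open>The resolvent equations as first-order systems\<close>

lemma shift_opI: "(\<psi>, \<eta>) \<in> A \<Longrightarrow> f = (\<lambda>e x. \<eta> e x - z *s \<psi> e x) \<Longrightarrow> (\<psi>, f) \<in> shift_op A z"
  by (auto simp: shift_op_def)

context finite_metric_graph
begin

abbreviation up :: "'e spinor \<Rightarrow> 'e \<Rightarrow> real \<Rightarrow> complex" where "up \<psi> \<equiv> \<lambda>e x. \<psi> e x $ 1"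
abbreviation down :: "'e spinor \<Rightarrow> 'e \<Rightarrow> real \<Rightarrow> complex" where "down \<psi> \<equiv> \<lambda>e x. \<psi> e x $ 2"

lemma L2_add: "u \<in> L2 G len \<Longrightarrow> v \<in> L2 G len \<Longrightarrow> (\<lambda>e x. u e x + v e x) \<in> L2 G len"
  by (simp add: L2_def L2_on_add)

lemma L2_diff: "u \<in> L2 G len \<Longrightarrow> v \<in> L2 G len \<Longrightarrow> (\<lambda>e x. u e x - v e x) \<in> L2 G len"
  by (simp add: L2_def L2_on_diff)

lemma L2_cmult: "u \<in> L2 G len \<Longrightarrow> (\<lambda>e x. c * u e x) \<in> L2 G len" for u :: "'e \<Rightarrow> real \<Rightarrow> complex"
  by (simp add: L2_def L2_on_cmult)

lemma L2_spinor_iff: "\<psi> \<in> L2 G len \<longleftrightarrow> up \<psi> \<in> L2 G len \<and> down \<psi> \<in> L2 G len"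
  by (auto simp: L2_def L2_on_spinor_iff)

lemma H1_spinor_iff: "H1 G len \<psi> \<psi>' \<longleftrightarrow> H1 G len (up \<psi>) (up \<psi>') \<and> H1 G len (down \<psi>) (down \<psi>')"
  by (auto simp: H1_def H1_on_spinor_iff is_edge_interval)

lemma nsq_spinor: "\<psi> \<in> L2 G len \<Longrightarrow> nsq \<psi> = nsq (up \<psi>) + nsq (down \<psi>)"
  unfolding nsq_def sum.distrib[symmetric]
  by (intro sum.cong refl) (simp add: norm_spinor_square L2_onD(2) L2_on_component L2D)

lemma L2_norm_eq: "L2_norm G len \<psi> = sqrt (nsq \<psi>)"
  by (simp add: L2_norm_def nsq_def)

lemma ae_eq_spinor_iff: "ae_eq G len \<psi> \<xi> \<longleftrightarrow> ae_eq G len (up \<psi>) (up \<xi>) \<and> ae_eq G len (down \<psi>) (down \<xi>)"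
  by (auto simp: ae_eq_def vec_eq_iff forall_2)

lemma ae_eq_refl: "ae_eq G len u u"
  by (simp add: ae_eq_def)

lemma modulo_aeI: "f \<in> L2 G len \<Longrightarrow> g \<in> L2 G len \<Longrightarrow> (f, g) \<in> A \<Longrightarrow> (f, g) \<in> modulo_ae G len A"
  unfolding modulo_ae_def using ae_eq_refl by blast

lemma ae_eq_diff: "ae_eq G len u u' \<Longrightarrow> ae_eq G len v v' \<Longrightarrow> ae_eq G len (\<lambda>e x. u e x - v e x) (\<lambda>e x. u' e x - v' e x)"
  unfolding ae_eq_def by fastforce

lemma H1_derivative_ae_cong:
  fixes u u' w :: "'e \<Rightarrow> real \<Rightarrow> complex"
  assumes "H1 G len u u'" "w \<in> L2 G len" "ae_eq G len u' w"
  shows "H1 G len u w"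
  unfolding H1_def
proof
  fix e assume e: "e \<in> arcs G"
  have "AE x in edge_measure e. u' e x = w e x" using assms(3) e by (auto simp: ae_eq_def)
  then show "H1_on (edge_interval len e) (u e) (w e)"
    by (rule H1_on_derivative_ae_cong[OF is_edge_interval[OF e] H1D[OF assms(1) e] L2D[OF assms(2) e]])
qed

lemma nsq_cmult: "nsq (\<lambda>e x. c * u e x) = (norm c)\<^sup>2 * nsq u" for u :: "'e \<Rightarrow> real \<Rightarrow> complex"
  by (simp add: nsq_def norm_mult power_mult_distrib sum_distrib_left)

lemma nsq_add_le:
  fixes u v :: "'e \<Rightarrow> real \<Rightarrow> complex"
  assumes u: "u \<in> L2 G len" and v: "v \<in> L2 G len"
  shows "nsq (\<lambda>e x. u e x + v e x) \<le> 2 * nsq u + 2 * nsq v"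
proof -
  have "nsq (\<lambda>e x. u e x + v e x) \<le> (\<Sum>e\<in>arcs G. 2 * (\<integral>x. (norm (u e x))\<^sup>2 \<partial>edge_measure e)
      + 2 * (\<integral>x. (norm (v e x))\<^sup>2 \<partial>edge_measure e))"
    unfolding nsq_def
  proof (rule sum_mono)
    fix e assume e: "e \<in> arcs G"
    note i = L2_onD(2)[OF L2D[OF u e]] L2_onD(2)[OF L2D[OF v e]]
    have "(\<integral>x. (norm (u e x + v e x))\<^sup>2 \<partial>edge_measure e)
      \<le> (\<integral>x. 2 * (norm (u e x))\<^sup>2 + 2 * (norm (v e x))\<^sup>2 \<partial>edge_measure e)"
    proof (rule integral_mono)
      show "integrable (edge_measure e) (\<lambda>x. (norm (u e x + v e x))\<^sup>2)"
        by (intro L2_onD(2) L2_on_add L2D u v e)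
      show "integrable (edge_measure e) (\<lambda>x. 2 * (norm (u e x))\<^sup>2 + 2 * (norm (v e x))\<^sup>2)"
        using i by auto
    qed (rule norm_add_square_le)
    then show "(\<integral>x. (norm (u e x + v e x))\<^sup>2 \<partial>edge_measure e)
      \<le> 2 * (\<integral>x. (norm (u e x))\<^sup>2 \<partial>edge_measure e) + 2 * (\<integral>x. (norm (v e x))\<^sup>2 \<partial>edge_measure e)"
      using i by simp
  qed
  then show ?thesis by (simp add: nsq_def sum.distrib sum_distrib_left)
qed

lemma ip_add_cmult_left:
  assumes "u \<in> L2 G len" "v \<in> L2 G len" "w \<in> L2 G len"
  shows "ip (\<lambda>e x. a * (u e x + b * v e x)) w = a * (ip u w + b * ip v w)"
  by (simp only: ip_cmult_left ip_add_left[OF assms(1) L2_cmult[OF assms(2)] assms(3)])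

lemma vertex_pair_L2:
  assumes "vertex_pair \<phi> \<phi>' \<eta> \<eta>'"
  shows "\<phi> \<in> L2 G len" "\<phi>' \<in> L2 G len" "\<eta> \<in> L2 G len" "\<eta>' \<in> L2 G len"
  using assms H1_imp_L2 by (auto simp: vertex_pair_def)

lemma vertex_pair_diff:
  assumes "vertex_pair \<phi> \<phi>' \<eta> \<eta>'" "vertex_pair u u' v v'"
  shows "vertex_pair (\<lambda>e x. \<phi> e x - u e x) (\<lambda>e x. \<phi>' e x - u' e x) (\<lambda>e x. \<eta> e x - v e x) (\<lambda>e x. \<eta>' e x - v' e x)"
  using assms by (auto simp: vertex_pair_def intro: H1_diff continuous_at_verts_diff balanced_at_verts_diff)

lemma vertex_pair_cmult:
  assumes "vertex_pair \<phi> \<phi>' \<eta> \<eta>'"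
  shows "vertex_pair (\<lambda>e x. a * \<phi> e x) (\<lambda>e x. a * \<phi>' e x) (\<lambda>e x. b * \<eta> e x) (\<lambda>e x. b * \<eta>' e x)"
  using assms by (auto simp: vertex_pair_def intro: H1_cmult continuous_at_verts_cmult balanced_at_verts_cmult)

text \<open>
  Integration by parts applied to a resolvent equation of the Dirac operator; in the
  application \<open>a = m c\<^sup>2 - z\<close> and \<open>b = m c\<^sup>2 + z\<close>.
\<close>

lemma dirac_energy_identity:
  fixes c :: real
  assumes vp: "vertex_pair \<phi> (\<lambda>e x. \<i> / of_real c * (g e x + b * \<eta> e x)) \<eta> (\<lambda>e x. \<i> / of_real c * (f e x + (- a) * \<phi> e x))"
    and fg: "f \<in> L2 G len" "g \<in> L2 G len" and c: "c \<noteq> 0"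
  shows "ip g \<eta> + b * of_real (nsq \<eta>) = cnj (ip f \<phi>) - cnj a * of_real (nsq \<phi>)"
proof -
  note L = vertex_pair_L2[OF vp]
  let ?r = "\<i> / of_real c :: complex"
  have "?r * (ip g \<eta> + b * ip \<eta> \<eta>) = - cnj (?r * (ip f \<phi> + (- a) * ip \<phi> \<phi>))"
    using vertex_pair_by_parts[OF vp] ip_cnj[of "\<lambda>e x. ?r * (f e x + (- a) * \<phi> e x)" \<phi>]
      ip_add_cmult_left[OF fg(2) L(3,3)] ip_add_cmult_left[OF fg(1) L(1,1)] by metis
  also have "\<dots> = ?r * (cnj (ip f \<phi>) - cnj a * ip \<phi> \<phi>)"
    using ip_cnj[of \<phi> \<phi>] by simp
  finally have "?r * (ip g \<eta> + b * ip \<eta> \<eta>) = ?r * (cnj (ip f \<phi>) - cnj a * ip \<phi> \<phi>)" .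
  then show ?thesis using c by (simp add: ip_self)
qed

text \<open>
  An element of the resolvent relation is a spinor up to null sets; here it is replaced by its
  continuous representative, and the equation, solved for the derivatives, holds everywhere.
\<close>

lemma dirac_shiftD:
  assumes c: "c \<noteq> 0" and h: "(\<psi>, f) \<in> shift_op (dirac G len m c) z"
  obtains \<phi> \<eta> where "\<psi> \<in> L2 G len" "f \<in> L2 G len" "ae_eq G len (up \<psi>) \<phi>" "ae_eq G len (down \<psi>) \<eta>"
    "vertex_pair \<phi> (\<lambda>e x. \<i> / of_real c * (down f e x + (of_real (m * c\<^sup>2) + z) * \<eta> e x))
       \<eta> (\<lambda>e x. \<i> / of_real c * (up f e x + (- (of_real (m * c\<^sup>2) - z)) * \<phi> e x))"
proof -
  let ?M = "of_real (m * c\<^sup>2) :: complex"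
  from h obtain \<eta>h where fh: "f = (\<lambda>e x. \<eta>h e x - z *s \<psi> e x)" and d: "(\<psi>, \<eta>h) \<in> dirac G len m c"
    by (auto simp: shift_op_def)
  from d obtain \<psi>0 \<psi>0' where L: "\<psi> \<in> L2 G len" "\<eta>h \<in> L2 G len" and ae: "ae_eq G len \<psi> \<psi>0"
    "ae_eq G len \<eta>h (\<lambda>e x. (- \<i> * of_real c) *s (sigma1 *v \<psi>0' e x) + ?M *s (sigma3 *v \<psi>0 e x))"
    and H: "H1 G len \<psi>0 \<psi>0'" and vc: "continuous_at_verts G len (up \<psi>0)" "balanced_at_verts G len (down \<psi>0)"
    unfolding dirac_def modulo_ae_def by auto
  have fL: "f \<in> L2 G len"
  proof -
    have "up f \<in> L2 G len" "down f \<in> L2 G len"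
      using L unfolding fh L2_spinor_iff by (auto intro!: L2_diff L2_cmult)
    then show ?thesis by (simp add: L2_spinor_iff)
  qed
  have a1: "ae_eq G len (up \<psi>) (up \<psi>0)" "ae_eq G len (down \<psi>) (down \<psi>0)" using ae(1) by (auto simp: ae_eq_spinor_iff)
  have v: "((- \<i> * of_real c) *s (sigma1 *v p) + ?M *s (sigma3 *v q)) $ 1 = (- \<i> * of_real c) * p $ 2 + ?M * q $ 1"
    "((- \<i> * of_real c) *s (sigma1 *v p) + ?M *s (sigma3 *v q)) $ 2 = (- \<i> * of_real c) * p $ 1 - ?M * q $ 2" for p q
    by (simp_all add: sigma1_vec_nth sigma3_vec_nth)
  have a2: "ae_eq G len (up \<eta>h) (\<lambda>e x. (- \<i> * of_real c) * \<psi>0' e x $ 2 + ?M * \<psi>0 e x $ 1)"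
    "ae_eq G len (down \<eta>h) (\<lambda>e x. (- \<i> * of_real c) * \<psi>0' e x $ 1 - ?M * \<psi>0 e x $ 2)"
    using ae(2) by (simp_all only: ae_eq_spinor_iff v)
  have HL: "H1 G len (up \<psi>0) (up \<psi>0')" "H1 G len (down \<psi>0) (down \<psi>0')" using H by (auto simp: H1_spinor_iff)
  have L0: "up \<psi>0 \<in> L2 G len" "down \<psi>0 \<in> L2 G len" using HL H1_imp_L2 by blast+
  have fc: "up f \<in> L2 G len" "down f \<in> L2 G len" using fL L2_spinor_iff by blast+
  have ic: "\<i> / of_real c * ((- \<i> * of_real c) * y) = y" for y :: complex using c by simp
  have e1: "ae_eq G len (up \<psi>0') (\<lambda>e x. \<i> / of_real c * (down f e x + (?M + z) * down \<psi>0 e x))"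
    unfolding ae_eq_def
  proof
    fix e assume e: "e \<in> arcs G"
    have "AE x in edge_measure e. \<psi> e x $ 2 = \<psi>0 e x $ 2"
      "AE x in edge_measure e. \<eta>h e x $ 2 = (- \<i> * of_real c) * \<psi>0' e x $ 1 - ?M * \<psi>0 e x $ 2"
      using a1(2) a2(2) e by (auto simp: ae_eq_def)
    then show "AE x in edge_measure e. up \<psi>0' e x = \<i> / of_real c * (down f e x + (?M + z) * down \<psi>0 e x)"
    proof eventually_elim
      fix x assume x: "\<psi> e x $ 2 = \<psi>0 e x $ 2" "\<eta>h e x $ 2 = (- \<i> * of_real c) * \<psi>0' e x $ 1 - ?M * \<psi>0 e x $ 2"
      have "down f e x + (?M + z) * down \<psi>0 e x = (- \<i> * of_real c) * \<psi>0' e x $ 1"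
        unfolding fh by (simp add: x algebra_simps)
      then show "up \<psi>0' e x = \<i> / of_real c * (down f e x + (?M + z) * down \<psi>0 e x)" by (simp only: ic)
    qed
  qed
  have e2: "ae_eq G len (down \<psi>0') (\<lambda>e x. \<i> / of_real c * (up f e x + (- (?M - z)) * up \<psi>0 e x))"
    unfolding ae_eq_def
  proof
    fix e assume e: "e \<in> arcs G"
    have "AE x in edge_measure e. \<psi> e x $ 1 = \<psi>0 e x $ 1"
      "AE x in edge_measure e. \<eta>h e x $ 1 = (- \<i> * of_real c) * \<psi>0' e x $ 2 + ?M * \<psi>0 e x $ 1"
      using a1(1) a2(1) e by (auto simp: ae_eq_def)
    then show "AE x in edge_measure e. down \<psi>0' e x = \<i> / of_real c * (up f e x + (- (?M - z)) * up \<psi>0 e x)"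
    proof eventually_elim
      fix x assume x: "\<psi> e x $ 1 = \<psi>0 e x $ 1" "\<eta>h e x $ 1 = (- \<i> * of_real c) * \<psi>0' e x $ 2 + ?M * \<psi>0 e x $ 1"
      have "up f e x + (- (?M - z)) * up \<psi>0 e x = (- \<i> * of_real c) * \<psi>0' e x $ 2"
        unfolding fh by (simp add: x algebra_simps)
      then show "down \<psi>0' e x = \<i> / of_real c * (up f e x + (- (?M - z)) * up \<psi>0 e x)" by (simp only: ic)
    qed
  qed
  have "vertex_pair (up \<psi>0) (\<lambda>e x. \<i> / of_real c * (down f e x + (?M + z) * down \<psi>0 e x))
       (down \<psi>0) (\<lambda>e x. \<i> / of_real c * (up f e x + (- (?M - z)) * up \<psi>0 e x))"
    unfolding vertex_pair_def
    by (intro conjI vc H1_derivative_ae_cong[OF HL(1) _ e1] H1_derivative_ae_cong[OF HL(2) _ e2] L2_cmult L2_add fc L0)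
  from that[OF L(1) fL a1 this] show ?thesis .
qed

lemma dirac_shiftI:
  assumes c: "c \<noteq> 0" and f: "f \<in> L2 G len"
    and vp: "vertex_pair \<phi> (\<lambda>e x. \<i> / of_real c * (down f e x + (of_real (m * c\<^sup>2) + z) * \<eta> e x))
       \<eta> (\<lambda>e x. \<i> / of_real c * (up f e x + (- (of_real (m * c\<^sup>2) - z)) * \<phi> e x))"
  shows "\<exists>\<psi>. (\<psi>, f) \<in> shift_op (dirac G len m c) z"
proof -
  let ?M = "of_real (m * c\<^sup>2) :: complex"
  define \<psi> :: "'e spinor" where "\<psi> e x = axis 1 (\<phi> e x) + axis 2 (\<eta> e x)" for e x
  define \<psi>' :: "'e spinor" where "\<psi>' e x = axis 1 (\<i> / of_real c * (down f e x + (?M + z) * \<eta> e x))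
     + axis 2 (\<i> / of_real c * (up f e x + (- (?M - z)) * \<phi> e x))" for e x
  have comp: "\<psi> e x $ 1 = \<phi> e x" "\<psi> e x $ 2 = \<eta> e x"
    "\<psi>' e x $ 1 = \<i> / of_real c * (down f e x + (?M + z) * \<eta> e x)"
    "\<psi>' e x $ 2 = \<i> / of_real c * (up f e x + (- (?M - z)) * \<phi> e x)" for e x
    by (simp_all add: \<psi>_def \<psi>'_def axis_def)
  define h where "h e x = f e x + z *s \<psi> e x" for e x
  have ic: "(- \<i> * of_real c) * (\<i> / of_real c * y) = y" for y :: complex using c by simp
  have heq: "h = (\<lambda>e x. (- \<i> * of_real c) *s (sigma1 *v \<psi>' e x) + ?M *s (sigma3 *v \<psi> e x))"
  proof (intro ext)
    fix e x
    have "h e x $ 1 = (- \<i> * of_real c) * \<psi>' e x $ 2 + ?M * \<psi> e x $ 1"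
      unfolding comp ic by (simp add: h_def comp algebra_simps)
    moreover have "h e x $ 2 = (- \<i> * of_real c) * \<psi>' e x $ 1 - ?M * \<psi> e x $ 2"
      unfolding comp ic by (simp add: h_def comp algebra_simps)
    ultimately show "h e x = (- \<i> * of_real c) *s (sigma1 *v \<psi>' e x) + ?M *s (sigma3 *v \<psi> e x)"
      by (simp add: vec_eq_iff forall_2 sigma1_vec_nth sigma3_vec_nth)
  qed
  have H: "H1 G len \<psi> \<psi>'" "continuous_at_verts G len (up \<psi>)" "balanced_at_verts G len (down \<psi>)"
    using vp unfolding H1_spinor_iff vertex_pair_def comp by auto
  have L: "\<psi> \<in> L2 G len" using H(1) H1_imp_L2 by blast
  have hL: "h \<in> L2 G len"
    using L f unfolding L2_spinor_iff h_def by (auto intro!: L2_add L2_cmult)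
  have "(\<psi>, h) \<in> dirac G len m c"
    unfolding dirac_def
    by (rule modulo_aeI[OF L hL], rule CollectI, rule exI[of _ \<psi>], rule exI[of _ \<psi>'], intro conjI H)
      (simp only: heq)
  moreover have "f = (\<lambda>e x. h e x - z *s \<psi> e x)" by (simp add: h_def)
  ultimately show ?thesis by (intro exI[of _ \<psi>] shift_opI)
qed

text \<open>
  The second-order equations of the two components as first-order systems: \<open>v = u'\<close> for the
  upper and \<open>y = w'\<close> for the lower component. In the upper one the derivative is the balanced member
  of the pair, in the lower one the continuous member.
\<close>

lemma laplacian_shiftD:
  fixes a :: real
  assumes a: "a \<noteq> 0" and h: "(\<psi>, f) \<in> shift_op (scale_op (of_real a) (laplacian G len)) k"
  obtains u v w y where "\<psi> \<in> L2 G len" "f \<in> L2 G len" "ae_eq G len (up \<psi>) u" "ae_eq G len (down \<psi>) w"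
    "vertex_pair u v v (\<lambda>e x. of_real (- 1 / a) * (up f e x + k * u e x))"
    "vertex_pair y (\<lambda>e x. of_real (- 1 / a) * (down f e x + k * w e x)) w y"
proof -
  from h obtain \<xi> where fh: "f = (\<lambda>e x. of_real a *s \<xi> e x - k *s \<psi> e x)" and d: "(\<psi>, \<xi>) \<in> laplacian G len"
    by (auto simp: shift_op_def scale_op_def)
  from d obtain u u' u'' where Lu: "up \<psi> \<in> L2 G len" "up \<xi> \<in> L2 G len" and au: "ae_eq G len (up \<psi>) u" "ae_eq G len (up \<xi>) (\<lambda>e x. - u'' e x)"
    and Hu: "H1 G len u u'" "H1 G len u' u''" "continuous_at_verts G len u" "balanced_at_verts G len u'"
    unfolding laplacian_def kirchhoff_laplacian_def modulo_ae_def by auto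
  from d obtain w w' w'' where Lw: "down \<psi> \<in> L2 G len" "down \<xi> \<in> L2 G len" and aw: "ae_eq G len (down \<psi>) w" "ae_eq G len (down \<xi>) (\<lambda>e x. - w'' e x)"
    and Hw: "H1 G len w w'" "H1 G len w' w''" "continuous_at_verts G len w'" "balanced_at_verts G len w"
    unfolding laplacian_def delta'_laplacian_def modulo_ae_def by auto
  have L: "\<psi> \<in> L2 G len" using Lu Lw by (simp add: L2_spinor_iff)
  have fc: "up f \<in> L2 G len" "down f \<in> L2 G len"
    using Lu Lw unfolding fh by (auto intro!: L2_diff L2_cmult)
  have fL: "f \<in> L2 G len" using fc L2_spinor_iff by blast
  have gen: "ae_eq G len t'' (\<lambda>e x. of_real (- 1 / a) * (f1 e x + k * t e x))"
    if "ae_eq G len p t" "ae_eq G len q (\<lambda>e x. - t'' e x)" "\<And>e x. f1 e x = of_real a * q e x - k * p e x" for p q t t'' f1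
    unfolding ae_eq_def
  proof
    fix e assume e: "e \<in> arcs G"
    have "AE x in edge_measure e. p e x = t e x" "AE x in edge_measure e. q e x = - t'' e x"
      using that(1,2) e by (auto simp: ae_eq_def)
    then show "AE x in edge_measure e. t'' e x = of_real (- 1 / a) * (f1 e x + k * t e x)"
    proof eventually_elim
      fix x assume x: "p e x = t e x" "q e x = - t'' e x"
      have "f1 e x + k * t e x = - (of_real a * t'' e x)" using that(3)[of e x] by (simp add: x)
      then show "t'' e x = of_real (- 1 / a) * (f1 e x + k * t e x)" using a by simp
    qed
  qed
  have eu: "ae_eq G len u'' (\<lambda>e x. of_real (- 1 / a) * (up f e x + k * u e x))"
    by (rule gen[OF au]) (simp add: fh)
  have ew: "ae_eq G len w'' (\<lambda>e x. of_real (- 1 / a) * (down f e x + k * w e x))"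
    by (rule gen[OF aw]) (simp add: fh)
  have L0: "u \<in> L2 G len" "w \<in> L2 G len" using Hu Hw H1_imp_L2 by blast+
  have "vertex_pair u u' u' (\<lambda>e x. of_real (- 1 / a) * (up f e x + k * u e x))"
    unfolding vertex_pair_def by (intro conjI Hu H1_derivative_ae_cong[OF Hu(2) _ eu] L2_cmult L2_add fc L0)
  moreover have "vertex_pair w' (\<lambda>e x. of_real (- 1 / a) * (down f e x + k * w e x)) w w'"
    unfolding vertex_pair_def by (intro conjI Hw H1_derivative_ae_cong[OF Hw(2) _ ew] L2_cmult L2_add fc L0)
  ultimately show ?thesis using that[OF L fL au(1) aw(1)] by blast
qed

lemma laplacian_shiftI:
  fixes a :: real
  assumes a: "a \<noteq> 0" and f: "f \<in> L2 G len"
    and u: "vertex_pair u v v (\<lambda>e x. of_real (- 1 / a) * (up f e x + k * u e x))"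
    and w: "vertex_pair y (\<lambda>e x. of_real (- 1 / a) * (down f e x + k * w e x)) w y"
  shows "\<exists>\<psi>. (\<psi>, f) \<in> shift_op (scale_op (of_real a) (laplacian G len)) k"
proof -
  define \<psi> :: "'e spinor" where "\<psi> e x = axis 1 (u e x) + axis 2 (w e x)" for e x
  define \<xi> where "\<xi> e x = of_real (1 / a) *s (f e x + k *s \<psi> e x)" for e x
  have comp: "\<psi> e x $ 1 = u e x" "\<psi> e x $ 2 = w e x" for e x by (simp_all add: \<psi>_def axis_def)
  have xi: "up \<xi> = (\<lambda>e x. - (of_real (- 1 / a) * (up f e x + k * u e x)))"
    "down \<xi> = (\<lambda>e x. - (of_real (- 1 / a) * (down f e x + k * w e x)))"
    by (simp_all add: \<xi>_def comp fun_eq_iff add_divide_distrib)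
  have upd: "up \<psi> = u" "down \<psi> = w" by (simp_all add: comp)
  have uw: "u \<in> L2 G len" "w \<in> L2 G len" using u w vertex_pair_L2 by blast+
  have fc: "up f \<in> L2 G len" "down f \<in> L2 G len" using f L2_spinor_iff by blast+
  have xi': "up \<xi> = (\<lambda>e x. of_real (1 / a) * (up f e x + k * u e x))"
    "down \<xi> = (\<lambda>e x. of_real (1 / a) * (down f e x + k * w e x))"
    by (simp_all only: \<xi>_def vector_smult_component vector_add_component comp)
  have xL: "up \<xi> \<in> L2 G len" "down \<xi> \<in> L2 G len"
    unfolding xi' by (intro L2_cmult L2_add fc uw)+
  have 1: "(up \<psi>, up \<xi>) \<in> kirchhoff_laplacian G len"
    unfolding kirchhoff_laplacian_def
  proof (rule modulo_aeI)
    show "up \<psi> \<in> L2 G len" "up \<xi> \<in> L2 G len" using uw(1) xL(1) upd by simp_all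
    show "(up \<psi>, up \<xi>) \<in> {(u, \<lambda>e x. - u'' e x) | u u' u''. H1 G len u u' \<and> H1 G len u' u'' \<and>
        continuous_at_verts G len u \<and> balanced_at_verts G len u'}"
      unfolding upd xi
      by (rule CollectI, rule exI[of _ u], rule exI[of _ v],
          rule exI[of _ "\<lambda>e x. of_real (- 1 / a) * (up f e x + k * u e x)"], intro conjI refl)
        (use u in \<open>simp_all only: vertex_pair_def\<close>)
  qed
  have 2: "(down \<psi>, down \<xi>) \<in> delta'_laplacian G len"
    unfolding delta'_laplacian_def
  proof (rule modulo_aeI)
    show "down \<psi> \<in> L2 G len" "down \<xi> \<in> L2 G len" using uw(2) xL(2) upd by simp_all
    show "(down \<psi>, down \<xi>) \<in> {(u, \<lambda>e x. - u'' e x) | u u' u''. H1 G len u u' \<and> H1 G len u' u'' \<and>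
        continuous_at_verts G len u' \<and> balanced_at_verts G len u}"
      unfolding upd xi
      by (rule CollectI, rule exI[of _ w], rule exI[of _ y],
          rule exI[of _ "\<lambda>e x. of_real (- 1 / a) * (down f e x + k * w e x)"], intro conjI refl)
        (use w in \<open>simp_all only: vertex_pair_def\<close>)
  qed
  have "(\<psi>, \<xi>) \<in> laplacian G len" using 1 2 by (simp add: laplacian_def)
  then have "(\<psi>, \<lambda>e x. of_real a *s \<xi> e x) \<in> scale_op (of_real a) (laplacian G len)" by (auto simp: scale_op_def)
  moreover have "f = (\<lambda>e x. of_real a *s \<xi> e x - k *s \<psi> e x)"
    using a by (simp add: \<xi>_def fun_eq_iff vec_eq_iff)
  ultimately show ?thesis by (intro exI[of _ \<psi>] shift_opI)
qed

section \<open>Resolvents and their convergence\<close>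

text \<open>
  Here \<open>\<alpha> \<beta> = (m\<^sup>2 c\<^sup>4 - z\<^sup>2) / c\<^sup>2\<close>, which is a nonpositive real number only for real \<open>z\<close>.
  The bound is the imaginary part of the energy identity.
\<close>

lemma dirac_resolvent_set:
  assumes c: "c \<noteq> 0" and z: "z \<notin> \<real>"
  shows "z \<in> resolvent_set G len (dirac G len m c)"
  unfolding resolvent_set_def
proof (intro CollectI conjI ballI)
  let ?M = "of_real (m * c\<^sup>2) :: complex" and ?r = "\<i> / of_real c :: complex"
  fix f :: "'e spinor" assume f: "f \<in> L2 G len"
  have fc: "up f \<in> L2 G len" "down f \<in> L2 G len" using f L2_spinor_iff by blast+
  have ab: "(?r * (?M + z)) * (?r * (- (?M - z))) \<notin> \<real>\<^sub>\<le>\<^sub>0"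
  proof
    assume "(?r * (?M + z)) * (?r * (- (?M - z))) \<in> \<real>\<^sub>\<le>\<^sub>0"
    then obtain r where r: "(?r * (?M + z)) * (?r * (- (?M - z))) = of_real r" "r \<le> 0"
      by (auto elim: nonpos_Reals_cases)
    have "(?r * (?M + z)) * (?r * (- (?M - z))) = (?M\<^sup>2 - z\<^sup>2) / (of_real c)\<^sup>2"
      using c by (simp add: field_simps power2_eq_square)
    with r(1) have "z\<^sup>2 = ?M\<^sup>2 - of_real r * (of_real c)\<^sup>2" using c by (simp add: field_simps)
    also have "\<dots> = of_real ((m * c\<^sup>2)\<^sup>2 - r * c\<^sup>2)" by simp
    finally have "z\<^sup>2 = of_real ((m * c\<^sup>2)\<^sup>2 - r * c\<^sup>2)" .
    moreover have "0 \<le> (m * c\<^sup>2)\<^sup>2 - r * c\<^sup>2"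
      using r(2) mult_nonpos_nonneg[of r "c\<^sup>2"] zero_le_power2[of "m * c\<^sup>2"] zero_le_power2[of c] by linarith
    ultimately show False using nonreal_square[OF z] by blast
  qed
  obtain \<phi> \<eta> where vp: "vertex_pair \<phi> (\<lambda>e x. (?r * (?M + z)) * \<eta> e x + ?r * down f e x)
      \<eta> (\<lambda>e x. (?r * (- (?M - z))) * \<phi> e x + ?r * up f e x)"
    using exists_vertex_pair_solution[OF ab L2_cmult[OF fc(1)] L2_cmult[OF fc(2)]] .
  have eq: "(r * p) * q + r * t = r * (t + p * q)" for r p q t :: complex
    by (simp add: algebra_simps)
  have "vertex_pair \<phi> (\<lambda>e x. ?r * (down f e x + (?M + z) * \<eta> e x)) \<eta> (\<lambda>e x. ?r * (up f e x + (- (?M - z)) * \<phi> e x))"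
    using vp by (simp only: eq)
  then show "\<exists>\<psi>. (\<psi>, f) \<in> shift_op (dirac G len m c) z" by (rule dirac_shiftI[OF c f])
next
  define \<kappa> where "\<kappa> = \<bar>Im z\<bar>"
  have k: "\<kappa> > 0" using z by (simp add: \<kappa>_def nonreal_Im)
  show "\<exists>K. \<forall>(\<psi>, f)\<in>shift_op (dirac G len m c) z. L2_norm G len \<psi> \<le> K * L2_norm G len f"
  proof (intro exI[of _ "1 / \<kappa>"] ballI, clarify)
    fix \<psi> f assume "(\<psi>, f) \<in> shift_op (dirac G len m c) z"
    then obtain \<phi> \<eta> where L: "\<psi> \<in> L2 G len" "f \<in> L2 G len" and ae: "ae_eq G len (up \<psi>) \<phi>" "ae_eq G len (down \<psi>) \<eta>"
      and vp: "vertex_pair \<phi> (\<lambda>e x. \<i> / of_real c * (down f e x + (of_real (m * c\<^sup>2) + z) * \<eta> e x))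
       \<eta> (\<lambda>e x. \<i> / of_real c * (up f e x + (- (of_real (m * c\<^sup>2) - z)) * \<phi> e x))"
      by (rule dirac_shiftD[OF c])
    note L0 = vertex_pair_L2[OF vp]
    have fc: "up f \<in> L2 G len" "down f \<in> L2 G len" and pc: "up \<psi> \<in> L2 G len" "down \<psi> \<in> L2 G len"
      using L L2_spinor_iff by blast+
    have nf: "nsq f = nsq (up f) + nsq (down f)" by (rule nsq_spinor[OF L(2)])
    have npsi: "nsq \<psi> = nsq \<phi> + nsq \<eta>"
      using nsq_spinor[OF L(1)] nsq_ae_cong[OF pc(1) L0(1) ae(1)] nsq_ae_cong[OF pc(2) L0(3) ae(2)] by simp
    have "Im (ip (down f) \<eta>) + Im z * nsq \<eta> = - Im (ip (up f) \<phi>) - Im z * nsq \<phi>"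
      using arg_cong[OF dirac_energy_identity[OF vp fc c], of Im] by (simp add: algebra_simps)
    then have "Im z * nsq \<psi> = - (Im (ip (down f) \<eta>) + Im (ip (up f) \<phi>))" by (simp add: npsi algebra_simps)
    then have "\<bar>Im z * nsq \<psi>\<bar> = \<bar>Im (ip (down f) \<eta>) + Im (ip (up f) \<phi>)\<bar>" by simp
    then have "\<kappa> * nsq \<psi> = \<bar>Im (ip (down f) \<eta>) + Im (ip (up f) \<phi>)\<bar>" using nsq_nonneg[of \<psi>] by (simp add: abs_mult \<kappa>_def)
    also have "\<dots> \<le> norm (ip (down f) \<eta>) + norm (ip (up f) \<phi>)"
      using abs_Im_le_cmod[of "ip (down f) \<eta>"] abs_Im_le_cmod[of "ip (up f) \<phi>"] by linarith
    finally have "2 * (\<kappa> * nsq \<psi>) \<le> (nsq (down f) / \<kappa> + \<kappa> * nsq \<eta>) + (nsq (up f) / \<kappa> + \<kappa> * nsq \<phi>)"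
      using norm_ip_le[OF fc(2) L0(3) k] norm_ip_le[OF fc(1) L0(1) k] by linarith
    also have "\<dots> = nsq f / \<kappa> + \<kappa> * nsq \<psi>" by (simp add: nf npsi algebra_simps add_divide_distrib)
    finally have "\<kappa> * nsq \<psi> \<le> nsq f / \<kappa>" by simp
    then have "nsq \<psi> \<le> nsq f / \<kappa>\<^sup>2" using k by (simp add: pos_le_divide_eq power2_eq_square mult_ac)
    then have "sqrt (nsq \<psi>) \<le> sqrt (nsq f / \<kappa>\<^sup>2)" by simp
    then show "L2_norm G len \<psi> \<le> 1 / \<kappa> * L2_norm G len f" using k by (simp add: L2_norm_eq real_sqrt_divide)
  qed
qed

text \<open>
  Pairing \<open>- a u'' - k u = f\<close> with \<open>u\<close> gives \<open>a \<parallel>u'\<parallel>\<^sup>2 - k \<parallel>u\<parallel>\<^sup>2 = \<langle>f, u\<rangle>\<close>, for either sign of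
  \<open>a\<close>.
\<close>

lemma kirchhoff_energy:
  fixes a :: real
  assumes a: "a \<noteq> 0" and k: "Im k \<noteq> 0" and f: "f \<in> L2 G len"
    and vp: "vertex_pair u v v (\<lambda>e x. of_real (- 1 / a) * (f e x + k * u e x))"
  shows "nsq u \<le> nsq f / (Im k)\<^sup>2" "\<bar>a\<bar> * nsq v \<le> (1 / \<bar>Im k\<bar> + norm k / (Im k)\<^sup>2) * nsq f"
proof -
  note L = vertex_pair_L2[OF vp]
  have "ip v v = - cnj (of_real (- 1 / a) * (ip f u + k * ip u u))"
    using vertex_pair_by_parts[OF vp] ip_cnj[of "\<lambda>e x. of_real (- 1 / a) * (f e x + k * u e x)" u]
      ip_add_cmult_left[OF f L(1,1)] by metis
  then have "of_real (a * nsq v) = cnj (ip f u + k * ip u u)" using a by (simp add: ip_self field_simps)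
  then have "of_real (a * nsq v) = cnj (ip f u) + cnj k * of_real (nsq u)" by (simp add: ip_self)
  note eq = this
  have k': "Im (cnj k) \<noteq> 0" using k by simp
  have w: "2 * norm (cnj (ip f u)) \<le> nsq f / \<epsilon> + \<epsilon> * nsq u" if "\<epsilon> > 0" for \<epsilon>
    using norm_ip_le[OF f L(1) that] by simp
  show "nsq u \<le> nsq f / (Im k)\<^sup>2" "\<bar>a\<bar> * nsq v \<le> (1 / \<bar>Im k\<bar> + norm k / (Im k)\<^sup>2) * nsq f"
    using laplacian_energy_bound[OF k' nsq_nonneg nsq_nonneg nsq_nonneg eq w] by simp_all
qed

lemma delta'_energy:
  fixes a :: real
  assumes a: "a \<noteq> 0" and k: "Im k \<noteq> 0" and f: "f \<in> L2 G len"
    and vp: "vertex_pair y (\<lambda>e x. of_real (- 1 / a) * (f e x + k * w e x)) w y"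
  shows "nsq w \<le> nsq f / (Im k)\<^sup>2" "\<bar>a\<bar> * nsq y \<le> (1 / \<bar>Im k\<bar> + norm k / (Im k)\<^sup>2) * nsq f"
proof -
  note L = vertex_pair_L2[OF vp]
  have "of_real (- 1 / a) * (ip f w + k * ip w w) = - ip y y"
    using vertex_pair_by_parts[OF vp] unfolding ip_add_cmult_left[OF f L(3) L(3)] .
  then have "of_real (a * nsq y) = ip f w + k * of_real (nsq w)" using a by (simp add: ip_self field_simps)
  note eq = this
  show "nsq w \<le> nsq f / (Im k)\<^sup>2" "\<bar>a\<bar> * nsq y \<le> (1 / \<bar>Im k\<bar> + norm k / (Im k)\<^sup>2) * nsq f"
    by (rule laplacian_energy_bound[OF k nsq_nonneg nsq_nonneg nsq_nonneg eq norm_ip_le[OF f L(3)]], assumption)+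
qed

lemma laplacian_resolvent_set:
  fixes a :: real
  assumes a: "a \<noteq> 0" and k: "k \<notin> \<real>"
  shows "k \<in> resolvent_set G len (scale_op (of_real a) (laplacian G len))"
  unfolding resolvent_set_def
proof (intro CollectI conjI ballI)
  let ?r = "of_real (- 1 / a) :: complex"
  fix f :: "'e spinor" assume f: "f \<in> L2 G len"
  have fc: "up f \<in> L2 G len" "down f \<in> L2 G len" using f L2_spinor_iff by blast+
  have z: "(\<lambda>e x. 0 :: complex) \<in> L2 G len" by (simp add: L2_def L2_on_zero)
  have nr: "?r * k \<notin> \<real>\<^sub>\<le>\<^sub>0"
    using a k by (auto simp: nonreal_Im complex_nonpos_Reals_iff)
  then have ab: "1 * (?r * k) \<notin> \<real>\<^sub>\<le>\<^sub>0" "(?r * k) * 1 \<notin> \<real>\<^sub>\<le>\<^sub>0" by simp_all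
  obtain u v where u: "vertex_pair u (\<lambda>e x. 1 * v e x + 0) v (\<lambda>e x. (?r * k) * u e x + ?r * up f e x)"
    using exists_vertex_pair_solution[OF ab(1) L2_cmult[OF fc(1)] z] .
  obtain y w where w: "vertex_pair y (\<lambda>e x. (?r * k) * w e x + ?r * down f e x) w (\<lambda>e x. 1 * y e x + 0)"
    using exists_vertex_pair_solution[OF ab(2) z L2_cmult[OF fc(2)]] .
  have eq: "(?r * k) * p + ?r * q = ?r * (q + k * p)" for p q :: complex
    by (simp add: algebra_simps add_divide_distrib)
  have "vertex_pair u v v (\<lambda>e x. ?r * (up f e x + k * u e x))"
    "vertex_pair y (\<lambda>e x. ?r * (down f e x + k * w e x)) w y"
    using u w by (simp_all only: eq mult_1_left add_0_right)
  then show "\<exists>\<psi>. (\<psi>, f) \<in> shift_op (scale_op (of_real a) (laplacian G len)) k"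
    by (rule laplacian_shiftI[OF a f])
next
  have k': "Im k \<noteq> 0" using k by (simp add: nonreal_Im)
  show "\<exists>K. \<forall>(\<psi>, f)\<in>shift_op (scale_op (of_real a) (laplacian G len)) k. L2_norm G len \<psi> \<le> K * L2_norm G len f"
  proof (intro exI[of _ "1 / \<bar>Im k\<bar>"] ballI, clarify)
    fix \<psi> f assume "(\<psi>, f) \<in> shift_op (scale_op (of_real a) (laplacian G len)) k"
    then obtain u v w y where L: "\<psi> \<in> L2 G len" "f \<in> L2 G len" and ae: "ae_eq G len (up \<psi>) u" "ae_eq G len (down \<psi>) w"
      and vp: "vertex_pair u v v (\<lambda>e x. of_real (- 1 / a) * (up f e x + k * u e x))"
        "vertex_pair y (\<lambda>e x. of_real (- 1 / a) * (down f e x + k * w e x)) w y"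
      by (rule laplacian_shiftD[OF a])
    have fc: "up f \<in> L2 G len" "down f \<in> L2 G len" and pc: "up \<psi> \<in> L2 G len" "down \<psi> \<in> L2 G len"
      using L L2_spinor_iff by blast+
    have "nsq \<psi> = nsq u + nsq w"
      using nsq_spinor[OF L(1)] nsq_ae_cong[OF pc(1) vertex_pair_L2(1)[OF vp(1)] ae(1)]
        nsq_ae_cong[OF pc(2) vertex_pair_L2(3)[OF vp(2)] ae(2)] by simp
    also have "\<dots> \<le> nsq (up f) / (Im k)\<^sup>2 + nsq (down f) / (Im k)\<^sup>2"
      by (intro add_mono kirchhoff_energy(1)[OF a k' fc(1) vp(1)] delta'_energy(1)[OF a k' fc(2) vp(2)])
    also have "\<dots> = nsq f / (Im k)\<^sup>2" using nsq_spinor[OF L(2)] by (simp add: add_divide_distrib)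
    finally have "sqrt (nsq \<psi>) \<le> sqrt (nsq f / (Im k)\<^sup>2)" by simp
    then show "L2_norm G len \<psi> \<le> 1 / \<bar>Im k\<bar> * L2_norm G len f" by (simp add: L2_norm_eq real_sqrt_divide)
  qed
qed


text \<open>
  The corrector \<open>\<eta>0 = - i u' / (2 m c)\<close> makes \<open>(u, \<eta>0)\<close> an element of the domain of the Dirac
  operator that solves the resolvent equation with right-hand side \<open>(f\<^sub>1, - k \<eta>0)\<close>, where \<open>f\<^sub>1\<close> is
  the upper component of \<open>f\<close>. So the difference solves it with right-hand side \<open>(0, F)\<close>.
\<close>

lemma dirac_laplacian_difference_plus:
  fixes m c :: real
  assumes m: "m > 0" and c: "c > 0" and k: "Im k \<noteq> 0"
    and d: "(\<psi>, f) \<in> shift_op (dirac G len m c) (of_real (m * c\<^sup>2) + k)"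
    and l: "(\<xi>, f) \<in> shift_op (scale_op (of_real (1 / (2 * m))) (laplacian G len)) k"
  shows "nsq (\<lambda>e x. \<psi> e x - P_plus *v \<xi> e x) \<le> resolvent_rate m k c * nsq f"
proof -
  have c0: "c \<noteq> 0" and a0: "1 / (2 * m) \<noteq> 0" using c m by auto
  let ?r = "\<i> / of_real c :: complex" and ?M = "of_real (2 * m * c\<^sup>2) :: complex"
  obtain \<phi> \<eta> where L: "\<psi> \<in> L2 G len" "f \<in> L2 G len" and ae: "ae_eq G len (up \<psi>) \<phi>" "ae_eq G len (down \<psi>) \<eta>"
    and vp0: "vertex_pair \<phi> (\<lambda>e x. ?r * (down f e x + (of_real (m * c\<^sup>2) + (of_real (m * c\<^sup>2) + k)) * \<eta> e x))
       \<eta> (\<lambda>e x. ?r * (up f e x + (- (of_real (m * c\<^sup>2) - (of_real (m * c\<^sup>2) + k))) * \<phi> e x))"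
    by (rule dirac_shiftD[OF c0 d])
  have "of_real (m * c\<^sup>2) + (of_real (m * c\<^sup>2) + k) = ?M + k" "- (of_real (m * c\<^sup>2) - (of_real (m * c\<^sup>2) + k)) = k"
    by simp_all
  with vp0 have vp: "vertex_pair \<phi> (\<lambda>e x. ?r * (down f e x + (?M + k) * \<eta> e x)) \<eta> (\<lambda>e x. ?r * (up f e x + k * \<phi> e x))"
    by (simp only:)
  obtain u v w y where Lx: "\<xi> \<in> L2 G len" and au: "ae_eq G len (up \<xi>) u"
    and vu: "vertex_pair u v v (\<lambda>e x. of_real (- 1 / (1 / (2 * m))) * (up f e x + k * u e x))"
    by (rule laplacian_shiftD[OF a0 l])
  define \<eta>0 where "\<eta>0 e x = - \<i> / of_real (2 * m * c) * v e x" for e x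
  define p where "p e x = \<phi> e x - u e x" for e x
  define q where "q e x = \<eta> e x - \<eta>0 e x" for e x
  define F where "F e x = down f e x + (- \<i> * k / of_real (2 * m * c)) * v e x" for e x
  note Lv = vertex_pair_L2[OF vu] and Lp = vertex_pair_L2[OF vp]
  have fc: "up f \<in> L2 G len" "down f \<in> L2 G len" using L(2) L2_spinor_iff by blast+
  have FL: "F \<in> L2 G len" unfolding F_def[abs_def] by (intro L2_add L2_cmult fc Lv)
  have zL: "(\<lambda>e x. 0 :: complex) \<in> L2 G len" by (simp add: L2_def L2_on_zero)
  have pq: "vertex_pair p (\<lambda>e x. ?r * (F e x + (?M + k) * q e x)) q (\<lambda>e x. ?r * (0 + (- (- k)) * p e x))"
  proof -
    have "vertex_pair (\<lambda>e x. \<phi> e x - 1 * u e x) (\<lambda>e x. ?r * (down f e x + (?M + k) * \<eta> e x) - 1 * v e x)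
       (\<lambda>e x. \<eta> e x - (- \<i> / of_real (2 * m * c)) * v e x)
       (\<lambda>e x. ?r * (up f e x + k * \<phi> e x) - (- \<i> / of_real (2 * m * c)) * (of_real (- 1 / (1 / (2 * m))) * (up f e x + k * u e x)))"
      by (rule vertex_pair_diff[OF vp vertex_pair_cmult[OF vu]])
    moreover have "?r * (down f e x + (?M + k) * \<eta> e x) - 1 * v e x = ?r * (F e x + (?M + k) * q e x)" for e x
      using c m by (simp add: F_def q_def \<eta>0_def field_simps power2_eq_square)
    moreover have "?r * (up f e x + k * \<phi> e x) - (- \<i> / of_real (2 * m * c)) * (of_real (- 1 / (1 / (2 * m))) * (up f e x + k * u e x))
      = ?r * (0 + (- (- k)) * p e x)" for e x
      using c m by (simp add: p_def field_simps)
    ultimately show ?thesis by (simp add: p_def[abs_def] q_def[abs_def] \<eta>0_def)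
  qed
  note Lpq = vertex_pair_L2[OF pq]
  have "ip F q + (?M + k) * of_real (nsq q) = cnj (ip (\<lambda>e x. 0) p) - cnj (- k) * of_real (nsq p)"
    by (rule dirac_energy_identity[OF pq zL FL c0])
  moreover have "ip (\<lambda>e x. 0) p = 0" by (simp add: ip_def)
  ultimately have eq: "cnj k * of_real (nsq p) = (?M + k) * of_real (nsq q) + ip F q" by (simp add: algebra_simps)
  have e0: "nsq \<eta>0 = nsq v / (4 * m\<^sup>2 * c\<^sup>2)"
    unfolding \<eta>0_def[abs_def] nsq_cmult using m c by (simp add: norm_divide norm_mult power_divide power_mult_distrib)
  have NF: "nsq F \<le> 2 * nsq (down f) + 2 * ((norm k)\<^sup>2 / (4 * m\<^sup>2 * c\<^sup>2) * nsq v)"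
    using nsq_add_le[OF fc(2) L2_cmult[OF Lv(3), of "- \<i> * k / of_real (2 * m * c)"]] m c
    unfolding F_def[abs_def] nsq_cmult by (simp add: norm_divide norm_mult power_divide power_mult_distrib)
  have V: "1 / (2 * m) * nsq v \<le> (1 / \<bar>Im k\<bar> + norm k / (Im k)\<^sup>2) * nsq (up f)"
    using kirchhoff_energy(2)[OF a0 k fc(1) vu] m by simp
  have bound: "nsq p + 2 * nsq q + 2 * (nsq v / (4 * m\<^sup>2 * c\<^sup>2)) \<le> resolvent_rate m k c * (nsq (up f) + nsq (down f))"
    by (rule resolvent_difference_bound[OF k m c nsq_nonneg nsq_nonneg nsq_nonneg nsq_nonneg nsq_nonneg nsq_nonneg eq norm_ip_le[OF FL Lpq(3)] NF V])
  let ?D = "\<lambda>e x. \<psi> e x - P_plus *v \<xi> e x"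
  have upD: "up ?D = (\<lambda>e x. \<psi> e x $ 1 - \<xi> e x $ 1)" and downD: "down ?D = down \<psi>"
    by (simp_all add: P_plus_vec_nth)
  have pc: "up \<psi> \<in> L2 G len" "down \<psi> \<in> L2 G len" "up \<xi> \<in> L2 G len" using L(1) Lx L2_spinor_iff by blast+
  have DL: "?D \<in> L2 G len" unfolding L2_spinor_iff[of ?D] upD downD by (intro conjI L2_diff pc)
  have "nsq ?D = nsq (\<lambda>e x. \<psi> e x $ 1 - \<xi> e x $ 1) + nsq (down \<psi>)" using nsq_spinor[OF DL] unfolding upD downD .
  also have "nsq (\<lambda>e x. \<psi> e x $ 1 - \<xi> e x $ 1) = nsq p"
    unfolding p_def[abs_def] by (rule nsq_ae_cong[OF L2_diff[OF pc(1,3)] L2_diff[OF Lp(1) Lv(1)] ae_eq_diff[OF ae(1) au]])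
  also have "nsq (down \<psi>) = nsq \<eta>" by (rule nsq_ae_cong[OF pc(2) Lp(3) ae(2)])
  also have "nsq \<eta> \<le> 2 * nsq q + 2 * nsq \<eta>0"
  proof -
    have "\<eta>0 \<in> L2 G len" unfolding \<eta>0_def[abs_def] by (rule L2_cmult[OF Lv(3)])
    from nsq_add_le[OF Lpq(3) this] show ?thesis by (simp add: q_def)
  qed
  finally show ?thesis using bound nsq_spinor[OF L(2)] e0 by simp
qed

text \<open>
  The previous argument with the components exchanged: the corrector \<open>\<phi>0 = i w' / (2 m c)\<close> is
  now in the upper component, and the energy identity, conjugated, has the same form with \<open>- k\<close> in place
  of \<open>k\<close>.
\<close>

lemma dirac_laplacian_difference_minus:
  fixes m c :: real
  assumes m: "m > 0" and c: "c > 0" and k: "Im k \<noteq> 0"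
    and d: "(\<psi>, f) \<in> shift_op (dirac G len m c) (- of_real (m * c\<^sup>2) + k)"
    and l: "(\<xi>, f) \<in> shift_op (scale_op (of_real (- 1 / (2 * m))) (laplacian G len)) k"
  shows "nsq (\<lambda>e x. \<psi> e x - P_minus *v \<xi> e x) \<le> resolvent_rate m (- k) c * nsq f"
proof -
  have c0: "c \<noteq> 0" and a0: "- 1 / (2 * m) \<noteq> 0" using c m by auto
  let ?r = "\<i> / of_real c :: complex" and ?M = "of_real (2 * m * c\<^sup>2) :: complex"
  obtain \<phi> \<eta> where L: "\<psi> \<in> L2 G len" "f \<in> L2 G len" and ae: "ae_eq G len (up \<psi>) \<phi>" "ae_eq G len (down \<psi>) \<eta>"
    and vp0: "vertex_pair \<phi> (\<lambda>e x. ?r * (down f e x + (of_real (m * c\<^sup>2) + (- of_real (m * c\<^sup>2) + k)) * \<eta> e x))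
       \<eta> (\<lambda>e x. ?r * (up f e x + (- (of_real (m * c\<^sup>2) - (- of_real (m * c\<^sup>2) + k))) * \<phi> e x))"
    by (rule dirac_shiftD[OF c0 d])
  have "of_real (m * c\<^sup>2) + (- of_real (m * c\<^sup>2) + k) = k" "of_real (m * c\<^sup>2) - (- of_real (m * c\<^sup>2) + k) = ?M - k"
    by simp_all
  with vp0 have vp: "vertex_pair \<phi> (\<lambda>e x. ?r * (down f e x + k * \<eta> e x)) \<eta> (\<lambda>e x. ?r * (up f e x + (- (?M - k)) * \<phi> e x))"
    by (simp only:)
  obtain u v w y where Lx: "\<xi> \<in> L2 G len" and aw: "ae_eq G len (down \<xi>) w"
    and vw: "vertex_pair y (\<lambda>e x. of_real (- 1 / (- 1 / (2 * m))) * (down f e x + k * w e x)) w y"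
    by (rule laplacian_shiftD[OF a0 l])
  define \<phi>0 where "\<phi>0 e x = \<i> / of_real (2 * m * c) * y e x" for e x
  define p where "p e x = \<phi> e x - \<phi>0 e x" for e x
  define q where "q e x = \<eta> e x - w e x" for e x
  define F where "F e x = up f e x + (\<i> * k / of_real (2 * m * c)) * y e x" for e x
  note Lv = vertex_pair_L2[OF vw] and Lp = vertex_pair_L2[OF vp]
  have fc: "up f \<in> L2 G len" "down f \<in> L2 G len" using L(2) L2_spinor_iff by blast+
  have FL: "F \<in> L2 G len" unfolding F_def[abs_def] by (intro L2_add L2_cmult fc Lv)
  have zL: "(\<lambda>e x. 0 :: complex) \<in> L2 G len" by (simp add: L2_def L2_on_zero)
  have pq: "vertex_pair p (\<lambda>e x. ?r * (0 + k * q e x)) q (\<lambda>e x. ?r * (F e x + (- (?M - k)) * p e x))"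
  proof -
    have "vertex_pair (\<lambda>e x. \<phi> e x - (\<i> / of_real (2 * m * c)) * y e x)
       (\<lambda>e x. ?r * (down f e x + k * \<eta> e x) - (\<i> / of_real (2 * m * c)) * (of_real (- 1 / (- 1 / (2 * m))) * (down f e x + k * w e x)))
       (\<lambda>e x. \<eta> e x - 1 * w e x)
       (\<lambda>e x. ?r * (up f e x + (- (?M - k)) * \<phi> e x) - 1 * y e x)"
      by (rule vertex_pair_diff[OF vp vertex_pair_cmult[OF vw]])
    moreover have "?r * (up f e x + (- (?M - k)) * \<phi> e x) - 1 * y e x = ?r * (F e x + (- (?M - k)) * p e x)" for e x
      using c m by (simp add: F_def p_def \<phi>0_def field_simps power2_eq_square)
    moreover have "?r * (down f e x + k * \<eta> e x) - (\<i> / of_real (2 * m * c)) * (of_real (- 1 / (- 1 / (2 * m))) * (down f e x + k * w e x))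
      = ?r * (0 + k * q e x)" for e x
      using c m by (simp add: q_def field_simps)
    ultimately show ?thesis by (simp add: p_def[abs_def] q_def[abs_def] \<phi>0_def)
  qed
  note Lpq = vertex_pair_L2[OF pq]
  have "ip (\<lambda>e x. 0) q + k * of_real (nsq q) = cnj (ip F p) - cnj (?M - k) * of_real (nsq p)"
    by (rule dirac_energy_identity[OF pq FL zL c0])
  moreover have "ip (\<lambda>e x. 0) q = 0" by (simp add: ip_def)
  ultimately have "cnj (k * of_real (nsq q)) = cnj (cnj (ip F p) - cnj (?M - k) * of_real (nsq p))" by simp
  then have eq: "cnj (- k) * of_real (nsq q) = (?M + - k) * of_real (nsq p) + - ip F p" by (simp add: algebra_simps)
  have e0: "nsq \<phi>0 = nsq y / (4 * m\<^sup>2 * c\<^sup>2)"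
    unfolding \<phi>0_def[abs_def] nsq_cmult using m c by (simp add: norm_divide norm_mult power_divide power_mult_distrib)
  have NF: "nsq F \<le> 2 * nsq (up f) + 2 * ((norm (- k))\<^sup>2 / (4 * m\<^sup>2 * c\<^sup>2) * nsq y)"
    using nsq_add_le[OF fc(1) L2_cmult[OF Lv(1), of "\<i> * k / of_real (2 * m * c)"]] m c
    unfolding F_def[abs_def] nsq_cmult by (simp add: norm_divide norm_mult power_divide power_mult_distrib)
  have V: "1 / (2 * m) * nsq y \<le> (1 / \<bar>Im (- k)\<bar> + norm (- k) / (Im (- k))\<^sup>2) * nsq (down f)"
    using delta'_energy(2)[OF a0 k fc(2) vw] m by simp
  have k': "Im (- k) \<noteq> 0" using k by simp
  have w: "2 * norm (- ip F p) \<le> nsq F / \<epsilon> + \<epsilon> * nsq p" if "\<epsilon> > 0" for \<epsilon>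
    using norm_ip_le[OF FL Lpq(1) that] by simp
  have bound: "nsq q + 2 * nsq p + 2 * (nsq y / (4 * m\<^sup>2 * c\<^sup>2)) \<le> resolvent_rate m (- k) c * (nsq (down f) + nsq (up f))"
    by (rule resolvent_difference_bound[OF k' m c nsq_nonneg nsq_nonneg nsq_nonneg nsq_nonneg nsq_nonneg nsq_nonneg eq w NF V])
  let ?D = "\<lambda>e x. \<psi> e x - P_minus *v \<xi> e x"
  have upD: "up ?D = up \<psi>" and downD: "down ?D = (\<lambda>e x. \<psi> e x $ 2 - \<xi> e x $ 2)"
    by (simp_all add: P_minus_vec_nth)
  have pc: "up \<psi> \<in> L2 G len" "down \<psi> \<in> L2 G len" "down \<xi> \<in> L2 G len" using L(1) Lx L2_spinor_iff by blast+
  have DL: "?D \<in> L2 G len" unfolding L2_spinor_iff[of ?D] upD downD by (intro conjI L2_diff pc)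
  have "nsq ?D = nsq (up \<psi>) + nsq (\<lambda>e x. \<psi> e x $ 2 - \<xi> e x $ 2)" using nsq_spinor[OF DL] unfolding upD downD .
  also have "nsq (\<lambda>e x. \<psi> e x $ 2 - \<xi> e x $ 2) = nsq q"
    unfolding q_def[abs_def] by (rule nsq_ae_cong[OF L2_diff[OF pc(2,3)] L2_diff[OF Lp(3) Lv(3)] ae_eq_diff[OF ae(2) aw]])
  also have "nsq (up \<psi>) = nsq \<phi>" by (rule nsq_ae_cong[OF pc(1) Lp(1) ae(1)])
  finally have D: "nsq ?D = nsq \<phi> + nsq q" .
  have "\<phi>0 \<in> L2 G len" unfolding \<phi>0_def[abs_def] by (rule L2_cmult[OF Lv(1)])
  from nsq_add_le[OF Lpq(1) this] have "nsq \<phi> \<le> 2 * nsq p + 2 * nsq \<phi>0" by (simp add: p_def)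
  then show ?thesis using bound nsq_spinor[OF L(2)] e0 D by (simp add: add.commute)
qed

lemma resolvent_in_shift_op:
  assumes "z \<in> resolvent_set G len A" "f \<in> L2 G len"
  shows "(resolvent A z f, f) \<in> shift_op A z"
proof -
  have "\<exists>\<psi>. (\<psi>, f) \<in> shift_op A z" using assms by (auto simp: resolvent_set_def)
  from someI_ex[OF this] show ?thesis by (simp add: resolvent_def)
qed

text \<open>
  The supremum defining the distance is one of real numbers, so the pointwise estimate serves twice:
  it bounds the supremum, and it makes the set bounded above, so that the supremum is at
  least the value at \<open>f = 0\<close>.
\<close>

lemma operator_dist_tendsto_0:
  assumes "\<And>c f. c > 0 \<Longrightarrow> f \<in> L2 G len \<Longrightarrow> nsq (\<lambda>e x. S c f e x - T f e x) \<le> r c * nsq f"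
    and r: "(r \<longlongrightarrow> 0) at_top"
  shows "((\<lambda>c :: real. operator_dist G len (S c) T) \<longlongrightarrow> 0) at_top"
proof (rule tendsto_sandwich)
  let ?B = "{f \<in> L2 G len. L2_norm G len f \<le> 1} :: 'e spinor set"
  have z: "(\<lambda>e x. 0) \<in> ?B" by (simp add: L2_def L2_on_zero L2_norm_def)
  have le: "L2_norm G len (\<lambda>e x. S c f e x - T f e x) \<le> sqrt \<bar>r c\<bar>" if "c > 0" "f \<in> ?B" for c f
  proof -
    have "nsq f \<le> 1" using that(2) by (simp add: L2_norm_eq)
    then have "r c * nsq f \<le> \<bar>r c\<bar>"
      using mult_mono[of "r c" "\<bar>r c\<bar>" "nsq f" 1] nsq_nonneg[of f] by simp
    then show ?thesis using assms(1)[OF that(1), of f] that(2) by (simp add: L2_norm_eq)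
  qed
  show "\<forall>\<^sub>F c in at_top. 0 \<le> operator_dist G len (S c) T"
  proof (rule eventually_mono[OF eventually_gt_at_top[of 0]])
    fix c :: real assume c: "0 < c"
    have "0 \<le> L2_norm G len (\<lambda>e x. S c (\<lambda>e x. 0) e x - T (\<lambda>e x. 0) e x)" by (simp add: L2_norm_eq nsq_nonneg)
    also have "\<dots> \<le> operator_dist G len (S c) T" unfolding operator_dist_def
      by (rule cSUP_upper[OF z]) (use le[OF c] in \<open>auto intro!: bdd_aboveI2\<close>)
    finally show "0 \<le> operator_dist G len (S c) T" .
  qed
  show "\<forall>\<^sub>F c in at_top. operator_dist G len (S c) T \<le> sqrt \<bar>r c\<bar>"
  proof (rule eventually_mono[OF eventually_gt_at_top[of 0]])
    fix c :: real assume c: "0 < c"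
    show "operator_dist G len (S c) T \<le> sqrt \<bar>r c\<bar>"
      unfolding operator_dist_def using z by (intro cSUP_least le[OF c]) auto
  qed
  show "((\<lambda>c. sqrt \<bar>r c\<bar>) \<longlongrightarrow> 0) at_top"
    using tendsto_real_sqrt[OF tendsto_rabs_zero[OF r]] by simp
qed simp

end

theorem proposition1p3:
  fixes G :: "('v, 'e) pre_digraph" and len :: "'e \<Rightarrow> ereal" and m :: real and k :: complex
  assumes "metric_graph G len" and "\<not> compact_graph G len" and "finite (arcs G)"
    and "m > 0" and "k \<notin> \<real>"
  shows "k \<in> resolvent_set G len (scale_op (of_real (1 / (2 * m))) (laplacian G len))
    \<and> k \<in> resolvent_set G len (scale_op (of_real (- 1 / (2 * m))) (laplacian G len))
    \<and> (\<forall>c>0. of_real (m * c\<^sup>2) + k \<in> resolvent_set G len (dirac G len m c))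
    \<and> (\<forall>c>0. - of_real (m * c\<^sup>2) + k \<in> resolvent_set G len (dirac G len m c))
    \<and> ((\<lambda>c. operator_dist G len
            (resolvent (dirac G len m c) (of_real (m * c\<^sup>2) + k))
            (matrix_op P_plus
              (resolvent (scale_op (of_real (1 / (2 * m))) (laplacian G len)) k)))
          \<longlongrightarrow> 0) at_top
    \<and> ((\<lambda>c. operator_dist G len
            (resolvent (dirac G len m c) (- of_real (m * c\<^sup>2) + k))
            (matrix_op P_minus
              (resolvent (scale_op (of_real (- 1 / (2 * m))) (laplacian G len)) k)))
          \<longlongrightarrow> 0) at_top"
proof -
  interpret finite_metric_graph G len
    using assms by (simp add: finite_metric_graph_def finite_metric_graph_axioms_def)
  have m: "m > 0" and k: "Im k \<noteq> 0" using assms(4,5) by (auto simp: nonreal_Im)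
  have l1: "k \<in> resolvent_set G len (scale_op (of_real (1 / (2 * m))) (laplacian G len))"
    and l2: "k \<in> resolvent_set G len (scale_op (of_real (- 1 / (2 * m))) (laplacian G len))"
    using m assms(5) by (intro laplacian_resolvent_set; simp)+
  have d1: "of_real (m * c\<^sup>2) + k \<in> resolvent_set G len (dirac G len m c)"
    and d2: "- of_real (m * c\<^sup>2) + k \<in> resolvent_set G len (dirac G len m c)" if "c > 0" for c
    using that k by (intro dirac_resolvent_set; simp add: nonreal_Im)+
  let ?R = "\<lambda>a. resolvent (scale_op (of_real a) (laplacian G len)) k"
  let ?D = "\<lambda>c z. resolvent (dirac G len m c) z"
  have c1: "((\<lambda>c. operator_dist G len (?D c (of_real (m * c\<^sup>2) + k)) (matrix_op P_plus (?R (1 / (2 * m))))) \<longlongrightarrow> 0) at_top"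
    by (rule operator_dist_tendsto_0[OF _ resolvent_rate_tendsto[OF m, of k]], unfold matrix_op_def)
      (rule dirac_laplacian_difference_plus[OF m _ k resolvent_in_shift_op[OF d1] resolvent_in_shift_op[OF l1]])
  have c2: "((\<lambda>c. operator_dist G len (?D c (- of_real (m * c\<^sup>2) + k)) (matrix_op P_minus (?R (- 1 / (2 * m))))) \<longlongrightarrow> 0) at_top"
    by (rule operator_dist_tendsto_0[OF _ resolvent_rate_tendsto[OF m, of "- k"]], unfold matrix_op_def)
      (rule dirac_laplacian_difference_minus[OF m _ k resolvent_in_shift_op[OF d2] resolvent_in_shift_op[OF l2]])
  show ?thesis using l1 l2 d1 d2 c1 c2 by blast
qed

end
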